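(* In the two-sample biased sampling model with censored data described in the context (so $g_0(x)=\theta_0w(x)f_0(x)$ with $\theta_0=1/w_0$, $w_0=\int_0^\infty w(x)\,dF_0(x)$, and $w$ a monotone weight function), assume the following. (2) $\rho_0=n_0/n$ and $\rho_1=n_1/n$ remain the same as $n\to\infty$. (3) As $n\to\infty$, $$\sqrt{n_0}\int_0^\infty\frac{\theta_0w(x)}{\rho_0+\rho_1\theta_0w(x)}\,d[\hat F(x)-F_0(x)]\xrightarrow{D}N(0,\sigma_{F,0}^2),\qquad \sqrt{n_1}\int_0^\infty\frac{1}{\rho_0+\rho_1\theta_0w(x)}\,d[\hat G(x)-G_0(x)]\xrightarrow{D}N(0,\sigma_{G,0}^2).$$ (4) $\|\hat F-F_0\|\to0$ and $\|\hat G-G_0\|\to0$ almost surely as $n\to\infty$. Let $$r(\theta_0)=\sup\left\{(\theta_0/\tilde\theta_n)^{n\rho_1}\prod_{i=1}^m(p_i/\tilde p_i)^{n\omega_i}\ \Big|\ p_i\ge0,\ \sum_{i=1}^mp_i=1,\ \sum_{i=1}^mp_iw(W_i)=\frac1{\theta_0}\right\}$$ be the weighted empirical likelihood ratio. Then $-2\ln r(\theta_0)\xrightarrow{D}c_0\chi_1^2$ as $n\to\infty$, where $0<c_0<\infty$ is a constant and $\chi^2_1$ has the chi-squared distribution with one degree of freedom.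
   Context: Model. $X_1,\dots,X_{n_0}$ is a random sample with density $f_0(x)$ and $Y_1,\dots,Y_{n_1}$ is a random sample with density $g_0(x)=\varphi(x;\theta_0)f_0(x)$, where $\varphi(x;\theta)=\theta w(x)$, $\theta\in(0,\infty)$, $w$ is a known monotone weight function with positive value on the support of $F_0$, and $\theta_0=1/w_0$ with $w_0=\int_0^\infty w(x)\,dF_0(x)$. The two samples are independent. $F_0,G_0$ are the unknown distribution functions, of nonnegative random variables, with densities $f_0,g_0$. Put $n=n_0+n_1$, $\rho_0=n_0/n$, $\rho_1=n_1/n$. $\|\cdot\|$ denotes the supremum norm over $[0,\infty)$. Observed data. Independent observed samples $\boldsymbol O^X_1,\dots,\boldsymbol O^X_{n_0}$ and $\boldsymbol O^Y_1,\dots,\boldsymbol O^Y_{n_1}$ are available for the $X$- and $Y$-samples; at least one of them is censored, in one of the following ways (described for the $X$-sample, the censoring variables being independent of $X_i$). - Right censored: $(V_i,\delta_i)$ with $V_i=X_i,\delta_i=1$ if $X_i\le C_i$; $V_i=C_i,\delta_i=0$ if $X_i>C_i$. - Doubly censored: $(V_i,\delta_i)$ with $V_i=X_i,\delta_i=1$ if $D_i<X_i\le C_i$; $V_i=C_i,\delta_i=2$ if $X_i>C_i$; $V_i=D_i,\delta_i=3$ if $X_i\le D_i$; $P\{D_i<C_i\}=1$. - Interval censored Case 1: $(C_i,\delta_i)$, $\delta_i=I\{X_i\le C_i\}$. - Interval censored Case 2: $(C_i,D_i,\delta_i)$ with $\delta_i=1$ if $D_i<X_i\le C_i$, $2$ if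 $X_i>C_i$, $3$ if $X_i\le D_i$; $P\{D_i<C_i\}=1$. - "Case 1" partly interval-censored: $X_i$ is observed for $1\le i\le k_0$, and $(C_i,I\{X_i\le C_i\})$ for $k_0<i\le n_0$. - General partly interval-censored: $X_i$ is observed for $1\le i\le k_0$, and for $k_0<i\le n_0$ one observes which of the intervals $(0,C_1],(C_1,C_2],\dots,(C_N,\infty)$ contains $X_i$, for potential examination times $C_1<\dots<C_N$. NPMLE. $\hat F$ and $\hat G$ are the nonparametric maximum likelihood estimators of $F_0$ and $G_0$ based on $\boldsymbol O^X_1,\dots,\boldsymbol O^X_{n_0}$ and on $\boldsymbol O^Y_1,\dots,\boldsymbol O^Y_{n_1}$, respectively, i.e. maximizers of the usual likelihood for the relevant type of data (the product over observations of the jump of $F$ at an exactly observed value, or of the $F$-mass of the interval in which the variable is known to lie); for uncensored data it is the empirical distribution function. They are step functions $\hat F(x)=\sum_{i=1}^{m_0}\hat p_i^X I\{W_i^X\le x\}$ and $\hat G(x)=\sum_{i=1}^{m_1}\hat p_i^Y I\{W_i^Y\le x\}$ with distinct points $W_1^X<\dots<W_{m_0}^X$, $W_1^Y<\dots<W_{m_1}^Y$ and positive weights; they need not be proper distribution functions (total mass may be less than 1). Pooled notation. $m=m_0+m_1$, $(W_1,\dots,W_m)=(W_1^X,\dots,W_{m_0}^X,W_1^Y,\dots,W_{m_1}^Y)$ and $(\omega_1,\dots,\omega_m)=(\rho_0\hat p_1^X,\dots,\rho_0\hat p_{m_0}^X,\rho_1\hat p_1^Y,\dots,\rho_1\hat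 p_{m_1}^Y)$. Semiparametric maximum likelihood estimator. $\tilde\theta_n\in(0,\infty)$ denotes the (unique) solution $\theta$ of $$\int_0^\infty\frac{\theta w(x)}{\rho_0+\rho_1\theta w(x)}\,d\hat F(x)-\int_0^\infty\frac{1}{\rho_0+\rho_1\theta w(x)}\,d\hat G(x)=0,$$ and $\tilde p_i=\omega_i/[\rho_0+\rho_1\tilde\theta_nw(W_i)]$, $i=1,\dots,m$.
   Formalization: Adds that the missing masses satisfy n0(1-F̂(∞))+n1(1-Ĝ(∞))→0 in probability (the claim fails e.g. for some unadjusted Kaplan–Meier estimators) and that w is not F0-a.e. constant (else r can be identically 1); the normal limits are taken nondegenerate and w≥0 on [0,∞). *)

theory Defs
  imports "HOL-Probability.Probability"
begin

section \<open>Censored observations\<close>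

text \<open>The parameter \<open>\<kappa>\<close> of the partly censored schemes maps the sample size to the number of exactly
  observed variables (\<open>k\<^sub>0\<close> in the literature); \<open>N\<close> is the number of potential examination times.\<close>

datatype censoring =
    Uncensored
  | Right_Censored
  | Doubly_Censored
  | Interval_Case1
  | Interval_Case2
  | Partly_Case1 "nat \<Rightarrow> nat"
  | Partly_General "nat \<Rightarrow> nat" nat

text \<open>An observation consists of the recorded times and an indicator \<open>\<delta>\<close>. Coordinates that are not
  recorded are set to 0, so that an observation carries no further information.\<close>

type_synonym obs = "(nat \<Rightarrow> real) \<times> nat"

definition times_space :: "(nat \<Rightarrow> real) measure" where
  "times_space = (\<Pi>\<^sub>M i\<in>UNIV. borel)"

definition obs_space :: "obs measure" where
  "obs_space = times_space \<Otimes>\<^sub>M count_space UNIV"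

definition one_time :: "real \<Rightarrow> nat \<Rightarrow> real" where
  "one_time u = (\<lambda>i. if i = 0 then u else 0)"

definition two_times :: "real \<Rightarrow> real \<Rightarrow> nat \<Rightarrow> real" where
  "two_times u v = (\<lambda>i. if i = 0 then u else if i = 1 then v else 0)"

text \<open>The vector \<open>t\<close> holds the censoring times of one subject: \<open>t 0 = C\<close> and \<open>t 1 = D\<close>, except for
  \<open>Partly_General\<close>, where \<open>t j\<close> is the examination time \<open>C\<^bsub>j+1\<^esub>\<close>.\<close>

fun admissible_times :: "censoring \<Rightarrow> (nat \<Rightarrow> real) \<Rightarrow> bool" where
  "admissible_times Doubly_Censored t \<longleftrightarrow> t 1 < t 0"
| "admissible_times Interval_Case2 t \<longleftrightarrow> t 1 < t 0"
| "admissible_times (Partly_General \<kappa> N) t \<longleftrightarrow>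
     1 \<le> N \<and> 0 < t 0 \<and> (\<forall>j. Suc j < N \<longrightarrow> t j < t (Suc j))"
| "admissible_times _ t \<longleftrightarrow> True"

text \<open>\<open>observe S n i x t\<close> is the observation of subject \<open>i < n\<close> in a sample of size \<open>n\<close> whose variable
  has the value \<open>x\<close>. For \<open>Partly_General\<close>, the indicator \<open>\<delta> = j\<close> stands for the interval
  \<open>(C\<^sub>j, C\<^bsub>j+1\<^esub>]\<close>, with \<open>C\<^sub>0 = 0\<close> and \<open>C\<^bsub>N+1\<^esub> = \<infinity>\<close>.\<close>

fun observe :: "censoring \<Rightarrow> nat \<Rightarrow> nat \<Rightarrow> real \<Rightarrow> (nat \<Rightarrow> real) \<Rightarrow> obs" where
  "observe Uncensored n i x t = (one_time x, 1)"
| "observe Right_Censored n i x t =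
     (if x \<le> t 0 then (one_time x, 1) else (one_time (t 0), 0))"
| "observe Doubly_Censored n i x t =
     (if t 1 < x \<and> x \<le> t 0 then (one_time x, 1)
      else if x > t 0 then (one_time (t 0), 2)
      else (one_time (t 1), 3))"
| "observe Interval_Case1 n i x t = (one_time (t 0), if x \<le> t 0 then 1 else 0)"
| "observe Interval_Case2 n i x t =
     (two_times (t 0) (t 1), if t 1 < x \<and> x \<le> t 0 then 1 else if x > t 0 then 2 else 3)"
| "observe (Partly_Case1 \<kappa>) n i x t =
     (if i < \<kappa> n then (one_time x, 1) else (one_time (t 0), if x \<le> t 0 then 1 else 0))"
| "observe (Partly_General \<kappa> N) n i x t =
     (if i < \<kappa> n then (one_time x, 1)
      else ((\<lambda>j. if j < N then t j else 0), card {j. j < N \<and> t j < x}))"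

definition observed_sample ::
  "censoring \<Rightarrow> nat \<Rightarrow> (nat \<Rightarrow> 'a \<Rightarrow> real) \<Rightarrow> (nat \<Rightarrow> 'a \<Rightarrow> nat \<Rightarrow> real) \<Rightarrow> 'a \<Rightarrow> nat \<Rightarrow> obs" where
  "observed_sample S n X T \<omega> = (\<lambda>i\<in>{..<n}. observe S n i (X i \<omega>) (T i \<omega>))"


section \<open>Nonparametric maximum likelihood estimators\<close>

text \<open>Total mass less than 1 is allowed; the missing mass is thought of as sitting at infinity.\<close>

definition sub_df :: "(real \<Rightarrow> real) \<Rightarrow> bool" where
  "sub_df F \<longleftrightarrow> mono F \<and> (\<forall>x. continuous (at_right x) F) \<and> (\<forall>x<0. F x = 0) \<and> (\<forall>x. F x \<le> 1)"

definition step_df :: "(real \<Rightarrow> real) \<Rightarrow> bool" where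
  "step_df F \<longleftrightarrow> sub_df F \<and>
     (\<exists>m W p. strict_mono_on {..<m} W \<and> (\<forall>i<m. (0::real) < p i) \<and>
        F = (\<lambda>x. \<Sum>i<(m::nat). p i * indicator {W i..} x))"

definition jump :: "(real \<Rightarrow> real) \<Rightarrow> real \<Rightarrow> real" where
  "jump F x = F x - Lim (at_left x) F"

text \<open>The \<open>F\<close>-mass of \<open>(a, b]\<close>, which is 0 if the interval is empty.\<close>

definition mass_Ioc :: "(real \<Rightarrow> real) \<Rightarrow> real \<Rightarrow> real \<Rightarrow> real" where
  "mass_Ioc F a b = (if a < b then F b - F a else 0)"

definition total_mass :: "(real \<Rightarrow> real) \<Rightarrow> real" where
  "total_mass F = measure (interval_measure F) UNIV"

fun contribution :: "censoring \<Rightarrow> nat \<Rightarrow> nat \<Rightarrow> obs \<Rightarrow> (real \<Rightarrow> real) \<Rightarrow> real" where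
  "contribution Uncensored n i (t, \<delta>) F = jump F (t 0)"
| "contribution Right_Censored n i (t, \<delta>) F = (if \<delta> = 1 then jump F (t 0) else 1 - F (t 0))"
| "contribution Doubly_Censored n i (t, \<delta>) F =
     (if \<delta> = 1 then jump F (t 0) else if \<delta> = 2 then 1 - F (t 0) else F (t 0))"
| "contribution Interval_Case1 n i (t, \<delta>) F = (if \<delta> = 1 then F (t 0) else 1 - F (t 0))"
| "contribution Interval_Case2 n i (t, \<delta>) F =
     (if \<delta> = 1 then mass_Ioc F (t 1) (t 0) else if \<delta> = 2 then 1 - F (t 0) else F (t 1))"
| "contribution (Partly_Case1 \<kappa>) n i (t, \<delta>) F =
     (if i < \<kappa> n then jump F (t 0) else if \<delta> = 1 then F (t 0) else 1 - F (t 0))"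
| "contribution (Partly_General \<kappa> N) n i (t, \<delta>) F =
     (if i < \<kappa> n then jump F (t 0)
      else if \<delta> = 0 then mass_Ioc F 0 (t 0)
      else if \<delta> < N then mass_Ioc F (t (\<delta> - 1)) (t \<delta>)
      else 1 - F (t (N - 1)))"

definition likelihood :: "censoring \<Rightarrow> nat \<Rightarrow> (nat \<Rightarrow> obs) \<Rightarrow> (real \<Rightarrow> real) \<Rightarrow> real" where
  "likelihood S n d F = (\<Prod>i<n. contribution S n i (d i) F)"

text \<open>The maximizer is in general not unique, so an NPMLE is any measurable choice of a step function
  maximizing the likelihood. For uncensored data it is the empirical distribution function.\<close>

definition is_NPMLE :: "censoring \<Rightarrow> nat \<Rightarrow> ((nat \<Rightarrow> obs) \<Rightarrow> real \<Rightarrow> real) \<Rightarrow> bool" where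
  "is_NPMLE S n \<Phi> \<longleftrightarrow>
     (\<forall>x. (\<lambda>d. \<Phi> d x) \<in> borel_measurable (\<Pi>\<^sub>M i\<in>{..<n}. obs_space)) \<and>
     (\<forall>d\<in>space (\<Pi>\<^sub>M i\<in>{..<n}. obs_space).
        step_df (\<Phi> d) \<and> (\<forall>H. sub_df H \<longrightarrow> likelihood S n d H \<le> likelihood S n d (\<Phi> d)))"


section \<open>The two-sample biased sampling model\<close>

definition support :: "real measure \<Rightarrow> real set" where
  "support \<mu> = {x. \<forall>e>0. 0 < emeasure \<mu> (ball x e)}"

text \<open>Only the values of \<open>w\<close> on \<open>[0, \<infinity>)\<close> matter. The positivity requirement concerns the support of
  \<open>F\<^sub>0\<close>; outside of it (where estimators may put mass) a weight function is still nonnegative.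
  If \<open>w\<close> is \<open>F\<^sub>0\<close>-almost everywhere constant, there is no bias (\<open>G\<^sub>0 = F\<^sub>0\<close>) and the likelihood ratio
  degenerates; this case is excluded.\<close>

locale biased_two_sample_model = prob_space M
  for M :: "'a measure" +
  fixes f0 g0 w :: "real \<Rightarrow> real" and \<theta>0 :: real
    and X Y :: "nat \<Rightarrow> 'a \<Rightarrow> real"
    and T U :: "nat \<Rightarrow> 'a \<Rightarrow> nat \<Rightarrow> real"
    and SX SY :: censoring
  assumes f0_nonneg: "0 \<le> f0 x"
    and f0_nonneg_support: "x < 0 \<Longrightarrow> f0 x = 0"
    and w_monotone: "mono_on {0..} w \<or> antimono_on {0..} w"
    and w_nonneg: "0 \<le> x \<Longrightarrow> 0 \<le> w x"
    and w_pos: "x \<in> support (density lborel f0) \<Longrightarrow> 0 < w x"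
    and w_not_constant: "\<not> (\<exists>c. AE x in density lborel f0. w x = c)"
    and w_integrable: "set_integrable (density lborel f0) {0..} w"
    and \<theta>0_eq: "\<theta>0 = 1 / (LINT x:{0..}|density lborel f0. w x)"
    and g0_eq: "g0 x = \<theta>0 * w x * f0 x"
    and X_density: "distributed M lborel (X i) f0"
    and Y_density: "distributed M lborel (Y i) g0"
    and subjects_independent:
      "indep_vars (\<lambda>_. borel \<Otimes>\<^sub>M times_space)
         (\<lambda>s \<omega>. case s of Inl i \<Rightarrow> (X i \<omega>, T i \<omega>) | Inr i \<Rightarrow> (Y i \<omega>, U i \<omega>)) (UNIV :: (nat + nat) set)"
    and X_independent_times:
      "indep_set {X i -` A \<inter> space M | A. A \<in> sets borel} {T i -` B \<inter> space M | B. B \<in> sets times_space}"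
    and Y_independent_times:
      "indep_set {Y i -` A \<inter> space M | A. A \<in> sets borel} {U i -` B \<inter> space M | B. B \<in> sets times_space}"
    and X_times: "AE \<omega> in M. admissible_times SX (T i \<omega>)"
    and Y_times: "AE \<omega> in M. admissible_times SY (U i \<omega>)"
    and censored: "SX \<noteq> Uncensored \<or> SY \<noteq> Uncensored"


section \<open>The semiparametric estimator and the weighted empirical likelihood ratio\<close>

definition stieltjes_integral :: "(real \<Rightarrow> real) \<Rightarrow> (real \<Rightarrow> real) \<Rightarrow> real" where
  "stieltjes_integral h F = (LINT x:{0..}|interval_measure F. h x)"

definition theta_equation ::
  "real \<Rightarrow> real \<Rightarrow> (real \<Rightarrow> real) \<Rightarrow> (real \<Rightarrow> real) \<Rightarrow> (real \<Rightarrow> real) \<Rightarrow> real \<Rightarrow> bool" where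
  "theta_equation \<rho>0 \<rho>1 w F G \<theta> \<longleftrightarrow>
     stieltjes_integral (\<lambda>x. \<theta> * w x / (\<rho>0 + \<rho>1 * \<theta> * w x)) F
       - stieltjes_integral (\<lambda>x. 1 / (\<rho>0 + \<rho>1 * \<theta> * w x)) G = 0"

text \<open>For degenerate samples the equation may fail to have a unique solution; then the value is set
  to 1. The probability of this event tends to 0 in the situation considered.\<close>

definition theta_tilde ::
  "real \<Rightarrow> real \<Rightarrow> (real \<Rightarrow> real) \<Rightarrow> (real \<Rightarrow> real) \<Rightarrow> (real \<Rightarrow> real) \<Rightarrow> real" where
  "theta_tilde \<rho>0 \<rho>1 w F G =
     (if \<exists>!\<theta>. 0 < \<theta> \<and> theta_equation \<rho>0 \<rho>1 w F G \<theta>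
      then THE \<theta>. 0 < \<theta> \<and> theta_equation \<rho>0 \<rho>1 w F G \<theta> else 1)"

definition jump_points :: "(real \<Rightarrow> real) \<Rightarrow> real list" where
  "jump_points F = sorted_list_of_set {x. jump F x \<noteq> 0}"

definition pooled_points :: "(real \<Rightarrow> real) \<Rightarrow> (real \<Rightarrow> real) \<Rightarrow> real list" where
  "pooled_points F G = jump_points F @ jump_points G"

definition pooled_weights ::
  "real \<Rightarrow> real \<Rightarrow> (real \<Rightarrow> real) \<Rightarrow> (real \<Rightarrow> real) \<Rightarrow> real list" where
  "pooled_weights \<rho>0 \<rho>1 F G =
     map (\<lambda>x. \<rho>0 * jump F x) (jump_points F) @ map (\<lambda>x. \<rho>1 * jump G x) (jump_points G)"

definition p_tilde ::
  "real \<Rightarrow> real \<Rightarrow> (real \<Rightarrow> real) \<Rightarrow> (real \<Rightarrow> real) \<Rightarrow> (real \<Rightarrow> real) \<Rightarrow> nat \<Rightarrow> real" where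
  "p_tilde \<rho>0 \<rho>1 w F G i =
     pooled_weights \<rho>0 \<rho>1 F G ! i
       / (\<rho>0 + \<rho>1 * theta_tilde \<rho>0 \<rho>1 w F G * w (pooled_points F G ! i))"

text \<open>The supremum is taken in \<^typ>\<open>ennreal\<close>, so that it is 0 if the constraints are infeasible.\<close>

definition weighted_EL_ratio ::
  "real \<Rightarrow> real \<Rightarrow> nat \<Rightarrow> (real \<Rightarrow> real) \<Rightarrow> (real \<Rightarrow> real) \<Rightarrow> (real \<Rightarrow> real) \<Rightarrow> real \<Rightarrow> ennreal" where
  "weighted_EL_ratio \<rho>0 \<rho>1 n w F G \<theta> =
     (let W = pooled_points F G; m = length W in
      SUP p\<in>{p :: nat \<Rightarrow> real. (\<forall>i<m. 0 \<le> p i) \<and> (\<Sum>i<m. p i) = 1 \<and> (\<Sum>i<m. p i * w (W ! i)) = 1 / \<theta>}.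
        ennreal ((\<theta> / theta_tilde \<rho>0 \<rho>1 w F G) powr (real n * \<rho>1) *
          (\<Prod>i<m. (p i / p_tilde \<rho>0 \<rho>1 w F G i) powr (real n * pooled_weights \<rho>0 \<rho>1 F G ! i))))"

text \<open>\<open>-2 ln r\<close> with \<open>ln 0 = -\<infinity>\<close>; the library's real logarithm has \<open>ln 0 = 0\<close>.\<close>

definition neg_two_ln :: "ennreal \<Rightarrow> ereal" where
  "neg_two_ln r =
     (if r = 0 then \<infinity> else if r = top then - \<infinity> else ereal (- 2 * ln (enn2real r)))"

text \<open>The law of \<open>c \<cdot> \<chi>\<^sup>2\<close> with one degree of freedom.\<close>

definition scaled_chi_square_1 :: "real \<Rightarrow> real measure" where
  "scaled_chi_square_1 c = distr std_normal_distribution borel (\<lambda>z. c * z\<^sup>2)"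

end

theory Submission
  imports Defs
begin

text \<open>Let \<open>\<omega>\<^sub>i\<close> be the pooled weights, \<open>s\<close> their sum, \<open>w\<^sub>i\<close> the values of \<open>w\<close> at the pooled points, and
\<open>q\<^sub>i = \<rho>1 \<theta>0 w\<^sub>i / (\<rho>0 + \<rho>1 \<theta>0 w\<^sub>i)\<close>, which is the probability, under \<open>\<theta>0\<close>, that a pooled observation of
weight \<open>w\<^sub>i\<close> comes from the second sample. Put \<open>\<phi>\<^sub>i = (q\<^sub>i - \<rho>1) / (\<rho>0 \<rho>1)\<close> and let \<open>x\<close> be the
semiparametric estimator divided by \<open>\<theta>0\<close>. Lagrange duality (\<open>EL_duality\<close>, \<open>weighted_EL_ratio_dual\<close>)
gives
\<open>-2 ln r = 2n (s ln s + \<rho>1 ln x - \<Sum>\<omega>\<^sub>i ln (1 + q\<^sub>i (x - 1)) + sup\<^sub>\<tau> \<Sum>\<omega>\<^sub>i ln (1 + \<tau> \<phi>\<^sub>i))\<close>.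

The supremum is the peak of a concave function of \<open>\<tau>\<close>. Up to a term carrying the missing mass of the
second NPMLE, the part with \<open>x\<close> is the peak of a concave function of \<open>ln x\<close>, because the estimating
equation says that its derivative vanishes. Near 0 both functions are quadratics \<open>a t - b t\<^sup>2 / 2\<close> up to
a cubic error, so their peaks are \<open>a\<^sup>2 / (2 b)\<close> up to an error of cubic order
(\<open>concave_max_of_quadratic_approx\<close>). Let \<open>E = \<integral> h1 dF - \<integral> h0 dG\<close> be formed with the two NPMLEs. Up to missing
mass, the slopes are \<open>E\<close> and \<open>- \<rho>0 \<rho>1 E\<close>; the curvatures are linear combinations of \<open>s\<close>, \<open>\<Sum>\<omega>\<^sub>i q\<^sub>i\<close> and
\<open>\<Sum>\<omega>\<^sub>i q\<^sub>i\<^sup>2\<close>, which converge by consistency (\<open>stieltjes_limit\<close>). Hence \<open>-2 ln r - c n E\<^sup>2\<close> tends to 0 in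
probability for a constant \<open>c\<close> (\<open>EL_limit\<close>). It is positive because \<open>w\<close> is not almost everywhere constant,
so that the limiting variance of \<open>q\<close> in the pooled population is positive, and because \<open>q\<close> is not almost
everywhere 0 (\<open>population_moments\<close>).

The two integrals in \<open>E\<close> have the same population value and are computed from independent samples, so
\<open>\<surd>n E\<close> is asymptotically normal with mean 0 and some variance \<open>\<tau>\<^sup>2\<close>, and \<open>-2 ln r\<close> converges in law to
\<open>c \<tau>\<^sup>2\<close> times a chi-square variable with one degree of freedom.

A set outside the sigma-algebra has measure 0, so \<open>-2 ln r\<close> must be shown to be measurable on the whole
sample space, including samples for which the constraints cannot be met or the estimating equation has
no unique root. The dual formula holds for every sample with at least one atom, as an identity of
extended reals, and it is built from countably many integrals against the NPMLEs (\<open>neg_two_ln_EL_ratio_measurable\<close>).\<close>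

section \<open>Duality for the weighted empirical likelihood\<close>

text \<open>The dual objective as a function of the Lagrange multiplier \<open>\<tau>\<close>: up to factors free of \<open>\<tau>\<close>, the
candidate maximizer of the likelihood gives atom \<open>i\<close> the mass \<open>om i / (1 + \<tau> \<phi>\<^sub>i)\<close>.\<close>

definition EL_gain :: "nat \<Rightarrow> (nat \<Rightarrow> real) \<Rightarrow> (nat \<Rightarrow> real) \<Rightarrow> real \<Rightarrow> real" where
  "EL_gain m om \<phi> \<tau> = (\<Sum>i<m. om i * ln (1 + \<tau> * \<phi> i))"

definition EL_dom :: "nat \<Rightarrow> (nat \<Rightarrow> real) \<Rightarrow> real set" where
  "EL_dom m \<phi> = {\<tau>. \<forall>i<m. 0 < 1 + \<tau> * \<phi> i}"

text \<open>Weak duality. It is Gibbs' inequality: bound \<open>ln z \<le> z - 1\<close> at the ratio of \<open>p i\<close> to the candidate mass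
with multiplier \<open>\<tau>\<close>; by the two constraints, the bounds add up to 0. The factors \<open>e\<close> allow constraints that are
centred at \<open>\<theta>0\<close>, and the factors \<open>d\<close> are the denominators of the semiparametric estimator.\<close>

lemma EL_value_le:
  fixes om e d \<phi> p :: "nat \<Rightarrow> real"
  assumes om: "\<And>i. i < m \<Longrightarrow> 0 < om i" and e: "\<And>i. i < m \<Longrightarrow> 0 < e i"
    and d: "\<And>i. i < m \<Longrightarrow> 0 < d i" and "0 < K" "0 < N"
    and p: "\<And>i. i < m \<Longrightarrow> 0 \<le> p i" "(\<Sum>i<m. p i * e i) = 1" "(\<Sum>i<m. p i * e i * \<phi> i) = 0"
    and \<tau>: "\<tau> \<in> EL_dom m \<phi>" and s: "s = (\<Sum>i<m. om i)"
  shows "K * (\<Prod>i<m. (p i * d i / om i) powr (N * om i))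
       \<le> exp (ln K + N * (\<Sum>i<m. om i * ln (d i / e i)) - N * (s * ln s) - N * EL_gain m om \<phi> \<tau>)"
proof (cases "\<exists>i<m. p i = 0")
  case True
  then obtain j where "j < m" "p j = 0" by auto
  then have "(\<Prod>i<m. (p i * d i / om i) powr (N * om i)) = 0"
    by (intro prod_zero) (use \<open>j < m\<close> \<open>p j = 0\<close> in auto)
  then show ?thesis by (simp only: mult_zero_right exp_ge_zero)
next
  case False
  then have pp: "0 < p i" if "i < m" for i using p(1)[OF that] that by (auto simp: less_le)
  have tp: "0 < 1 + \<tau> * \<phi> i" if "i < m" for i using \<tau> that by (auto simp: EL_dom_def)
  have "m \<noteq> 0" using p(2) by (cases m) auto
  then have sp: "0 < s" unfolding s by (intro sum_pos) (auto simp: om)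
  let ?z = "\<lambda>i. s * p i * e i * (1 + \<tau> * \<phi> i) / om i"
  have zp: "0 < ?z i" if "i < m" for i
    using that sp pp tp om e by (intro divide_pos_pos mult_pos_pos) auto
  have "(\<Sum>i<m. om i * ln (?z i)) \<le> (\<Sum>i<m. om i * (?z i - 1))"
    by (intro sum_mono mult_left_mono ln_le_minus_one zp) (auto intro: less_imp_le om)
  also have "\<dots> = (\<Sum>i<m. s * (p i * e i) + s * \<tau> * (p i * e i * \<phi> i) - om i)"
    by (intro sum.cong refl) (use om in \<open>auto simp: field_simps less_le\<close>)
  also have "\<dots> = s * (\<Sum>i<m. p i * e i) + s * \<tau> * (\<Sum>i<m. p i * e i * \<phi> i) - s"
    by (simp add: sum.distrib sum_subtractf sum_distrib_left s)
  also have "\<dots> = 0" using p by simp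
  finally have 1: "(\<Sum>i<m. om i * ln (?z i)) \<le> 0" .
  have s2: "s * ln s = (\<Sum>i<m. om i * ln s)" by (simp add: s sum_distrib_right)
  have 2: "om i * ln (p i * d i / om i)
      = om i * ln (?z i) - om i * ln s + om i * ln (d i / e i) - om i * ln (1 + \<tau> * \<phi> i)" if "i < m" for i
  proof -
    have "p i * d i / om i = ?z i * (d i / e i) / (s * (1 + \<tau> * \<phi> i))"
      using that sp tp[of i] om[of i] e[of i] by simp
    then have "ln (p i * d i / om i) = ln (?z i * (d i / e i)) - ln (s * (1 + \<tau> * \<phi> i))"
      using that sp tp[of i] e[of i] d[of i] zp[of i] by (simp only: ln_divide_pos mult_pos_pos divide_pos_pos)
    also have "\<dots> = (ln (?z i) + ln (d i / e i)) - (ln s + ln (1 + \<tau> * \<phi> i))"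
      using that sp tp[of i] e[of i] d[of i] zp[of i] by (simp only: ln_mult_pos divide_pos_pos)
    finally show ?thesis by (simp only: right_diff_distrib distrib_left)
  qed
  have "(\<Sum>i<m. om i * ln (p i * d i / om i))
      = (\<Sum>i<m. om i * ln (?z i)) - s * ln s + (\<Sum>i<m. om i * ln (d i / e i)) - EL_gain m om \<phi> \<tau>"
    unfolding EL_gain_def s2 by (simp add: 2 sum.distrib sum_subtractf del: times_divide_eq_right times_divide_eq_left)
  then have 3: "(\<Sum>i<m. om i * ln (p i * d i / om i))
      \<le> (\<Sum>i<m. om i * ln (d i / e i)) - s * ln s - EL_gain m om \<phi> \<tau>" using 1 by simp
  have "K * (\<Prod>i<m. (p i * d i / om i) powr (N * om i))
      = exp (ln K + N * (\<Sum>i<m. om i * ln (p i * d i / om i)))"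
  proof -
    have "(p i * d i / om i) powr (N * om i) = exp (N * (om i * ln (p i * d i / om i)))" if "i < m" for i
      using that pp[of i] om[of i] d[of i] by (simp add: powr_def)
    then have "(\<Prod>i<m. (p i * d i / om i) powr (N * om i)) = exp (\<Sum>i<m. N * (om i * ln (p i * d i / om i)))"
      by (subst exp_sum) (auto intro!: prod.cong)
    then show ?thesis using \<open>0 < K\<close> by (simp add: exp_add sum_distrib_left)
  qed
  also have "\<dots> \<le> exp (ln K + N * ((\<Sum>i<m. om i * ln (d i / e i)) - s * ln s - EL_gain m om \<phi> \<tau>))"
    using 3 \<open>0 < N\<close> by simp
  finally show ?thesis by (simp add: algebra_simps)
qed

text \<open>At a critical point of the dual objective the candidate masses satisfy the constraints, and all
inequalities in the proof of weak duality become equalities.\<close>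

lemma EL_value_critical:
  fixes om e d \<phi> :: "nat \<Rightarrow> real"
  assumes om: "\<And>i. i < m \<Longrightarrow> 0 < om i" and e: "\<And>i. i < m \<Longrightarrow> 0 < e i"
    and d: "\<And>i. i < m \<Longrightarrow> 0 < d i" and "0 < K" "0 < N" "m > 0"
    and \<tau>: "\<tau> \<in> EL_dom m \<phi>" and s: "s = (\<Sum>i<m. om i)"
    and crit: "(\<Sum>i<m. om i * \<phi> i / (1 + \<tau> * \<phi> i)) = 0"
  shows "\<exists>p. (\<forall>i<m. 0 \<le> p i) \<and> (\<Sum>i<m. p i * e i) = 1 \<and> (\<Sum>i<m. p i * e i * \<phi> i) = 0
    \<and> K * (\<Prod>i<m. (p i * d i / om i) powr (N * om i))
       = exp (ln K + N * (\<Sum>i<m. om i * ln (d i / e i)) - N * (s * ln s) - N * EL_gain m om \<phi> \<tau>)"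
proof -
  have tp: "0 < 1 + \<tau> * \<phi> i" if "i < m" for i using \<tau> that by (auto simp: EL_dom_def)
  have sp: "0 < s" unfolding s using \<open>m > 0\<close> by (intro sum_pos) (auto simp: om)
  define p where "p i = om i / (s * e i * (1 + \<tau> * \<phi> i))" for i
  have pe: "p i * e i = om i / (1 + \<tau> * \<phi> i) / s" if "i < m" for i
    using that sp tp[of i] e[of i] by (simp add: p_def)
  have pp: "0 < p i" if "i < m" for i
    unfolding p_def using that sp tp[of i] e[of i] om[of i] by (intro divide_pos_pos mult_pos_pos) auto
  have b: "(\<Sum>i<m. p i * e i * \<phi> i) = 0"
  proof -
    have "(\<Sum>i<m. p i * e i * \<phi> i) = (\<Sum>i<m. om i * \<phi> i / (1 + \<tau> * \<phi> i)) / s"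
      unfolding sum_divide_distrib by (intro sum.cong) (auto simp: pe)
    then show ?thesis using crit by simp
  qed
  have a: "(\<Sum>i<m. p i * e i) = 1"
  proof -
    have "(\<Sum>i<m. om i / (1 + \<tau> * \<phi> i)) = (\<Sum>i<m. om i - \<tau> * (om i * \<phi> i / (1 + \<tau> * \<phi> i)))"
      by (intro sum.cong refl) (use tp in \<open>fastforce simp: field_simps\<close>)
    also have "\<dots> = s" unfolding sum_subtractf s[symmetric] sum_distrib_left[symmetric] crit by simp
    finally have "(\<Sum>i<m. om i / (1 + \<tau> * \<phi> i)) = s" .
    moreover have "(\<Sum>i<m. p i * e i) = (\<Sum>i<m. om i / (1 + \<tau> * \<phi> i)) / s"
      unfolding sum_divide_distrib by (intro sum.cong) (auto simp: pe)
    ultimately show ?thesis using sp by simp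
  qed
  have s2: "s * ln s = (\<Sum>i<m. om i * ln s)" by (simp add: s sum_distrib_right)
  have 2: "om i * ln (p i * d i / om i)
      = - om i * ln s + om i * ln (d i / e i) - om i * ln (1 + \<tau> * \<phi> i)" if "i < m" for i
  proof -
    have "p i * d i / om i = d i / e i / (s * (1 + \<tau> * \<phi> i))"
      unfolding p_def using that sp tp[of i] om[of i] e[of i] by simp
    then have "ln (p i * d i / om i) = ln (d i / e i) - (ln s + ln (1 + \<tau> * \<phi> i))"
      using that sp tp[of i] e[of i] d[of i] by (simp only: ln_div ln_mult) (simp add: ln_div ln_mult)
    then show ?thesis by (simp only: right_diff_distrib distrib_left)
  qed
  have 3: "(\<Sum>i<m. om i * ln (p i * d i / om i))
      = (\<Sum>i<m. om i * ln (d i / e i)) - s * ln s - EL_gain m om \<phi> \<tau>"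
    unfolding EL_gain_def s2 by (simp add: 2 sum.distrib sum_subtractf sum_negf)
  have "(p i * d i / om i) powr (N * om i) = exp (N * (om i * ln (p i * d i / om i)))" if "i < m" for i
    using that pp[of i] om[of i] d[of i] by (simp add: powr_def)
  then have "(\<Prod>i<m. (p i * d i / om i) powr (N * om i)) = exp (\<Sum>i<m. N * (om i * ln (p i * d i / om i)))"
    by (subst exp_sum) (auto intro!: prod.cong)
  then have "K * (\<Prod>i<m. (p i * d i / om i) powr (N * om i))
      = exp (ln K + N * (\<Sum>i<m. om i * ln (p i * d i / om i)))"
    using \<open>0 < K\<close> by (simp add: exp_add sum_distrib_left)
  then have "K * (\<Prod>i<m. (p i * d i / om i) powr (N * om i))
       = exp (ln K + N * (\<Sum>i<m. om i * ln (d i / e i)) - N * (s * ln s) - N * EL_gain m om \<phi> \<tau>)"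
    by (simp only: 3) (simp add: algebra_simps)
  with a b pp show ?thesis by (intro exI[of _ p]) (auto intro: less_imp_le)
qed


lemma EL_gain_minus:
  "EL_gain m om (\<lambda>i. - \<phi> i) \<tau> = EL_gain m om \<phi> (- \<tau>)"
  "\<tau> \<in> EL_dom m (\<lambda>i. - \<phi> i) \<longleftrightarrow> - \<tau> \<in> EL_dom m \<phi>"
  by (simp_all add: EL_gain_def EL_dom_def)

text \<open>This covers half of the degenerate cases. If 0 is not in the relative interior of the convex hull of the \<open>\<phi>\<^sub>i\<close>, the constraints force some
\<open>p i = 0\<close> or cannot be met, so the likelihood vanishes; on the dual side the objective is unbounded.\<close>

lemma EL_gain_unbounded:
  assumes om: "\<And>i. i < m \<Longrightarrow> 0 < om i" and \<phi>: "\<And>i. i < m \<Longrightarrow> 0 \<le> \<phi> i" and j: "j < m" "0 < \<phi> j"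
  shows "\<exists>\<tau>\<in>EL_dom m \<phi>. B < EL_gain m om \<phi> \<tau>"
proof (intro bexI)
  let ?\<tau> = "exp (B / om j) / \<phi> j"
  have pos: "0 \<le> ?\<tau> * \<phi> i" if "i < m" for i using j \<phi>[OF that] by simp
  then show "?\<tau> \<in> EL_dom m \<phi>" by (auto simp: EL_dom_def intro: add_pos_nonneg)
  have "0 < ?\<tau> * \<phi> j" using j by simp
  then have "ln (?\<tau> * \<phi> j) < ln (1 + ?\<tau> * \<phi> j)" by (subst ln_less_cancel_iff) linarith+
  then have "om j * ln (?\<tau> * \<phi> j) < om j * ln (1 + ?\<tau> * \<phi> j)"
    using om[of j] j(1) by (intro mult_strict_left_mono)
  moreover have "B = om j * ln (?\<tau> * \<phi> j)" using om[of j] j by simp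
  ultimately have "B < om j * ln (1 + ?\<tau> * \<phi> j)" by linarith
  also have "\<dots> \<le> EL_gain m om \<phi> ?\<tau>"
    unfolding EL_gain_def using j
    by (intro member_le_sum mult_nonneg_nonneg ln_ge_zero) (use om pos in \<open>auto intro: less_imp_le\<close>)
  finally show "B < EL_gain m om \<phi> ?\<tau>" .
qed

text \<open>The score tends to \<open>-\<infinity>\<close> at the right end \<open>1 / a\<close> of the domain, where \<open>- a\<close> is the least
\<open>\<phi>\<^sub>i\<close>: there the summand of that index dominates the others, which stay bounded above by \<open>C\<close>.\<close>

lemma EL_score_nonpos:
  fixes om \<phi> :: "nat \<Rightarrow> real"
  assumes om: "\<And>i. i < m \<Longrightarrow> 0 < om i" and k: "k < m" "\<phi> k < 0"
  shows "\<exists>\<tau>\<ge>0. \<tau> \<in> EL_dom m \<phi> \<and> (\<Sum>i<m. om i * \<phi> i / (1 + \<tau> * \<phi> i)) \<le> 0"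
proof -
  have "finite (\<phi> ` {..<m})" "\<phi> ` {..<m} \<noteq> {}" using k by auto
  from Min_in[OF this] obtain j where j: "j < m" "\<phi> j = Min (\<phi> ` {..<m})" by auto
  then have jmin: "\<phi> j \<le> \<phi> i" if "i < m" for i using that by simp
  define a where "a = - \<phi> j"
  have a: "0 < a" using jmin[OF k(1)] k by (simp add: a_def)
  define C where "C = (\<Sum>i<m. om i * max (\<phi> i) 0)"
  have C: "0 \<le> C" unfolding C_def using om by (intro sum_nonneg mult_nonneg_nonneg) (auto intro: less_imp_le)
  \<comment> \<open>\<open>\<eta>\<close> is the value of \<open>1 + \<tau> \<phi> j\<close>; it is so small that the summand of index \<open>j\<close> is at most \<open>- (C + 1)\<close>.\<close>
  define \<eta> where "\<eta> = min (1/2) (om j * a / (C + 1))"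
  have \<eta>: "0 < \<eta>" "\<eta> < 1" "\<eta> \<le> om j * a / (C + 1)" using C a om[of j] j by (auto simp: \<eta>_def)
  define \<tau> where "\<tau> = (1 - \<eta>) / a"
  have \<tau>0: "0 \<le> \<tau>" using \<eta> a by (simp add: \<tau>_def)
  have low: "\<eta> \<le> 1 + \<tau> * \<phi> i" if "i < m" for i
  proof -
    have "\<tau> * - a \<le> \<tau> * \<phi> i" using jmin[OF that] \<tau>0 by (intro mult_left_mono) (auto simp: a_def)
    moreover have "\<tau> * a = 1 - \<eta>" using a by (simp add: \<tau>_def)
    ultimately show ?thesis by simp
  qed
  have summand_le: "om i * \<phi> i / (1 + \<tau> * \<phi> i) \<le> om i * max (\<phi> i) 0 + (if i = j then - (C + 1) else 0)"
    if i: "i < m" for i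
  proof (cases "i = j")
    case True
    have "\<tau> * a = 1 - \<eta>" using a by (simp add: \<tau>_def)
    then have "1 + \<tau> * \<phi> j = \<eta>" by (simp add: a_def)
    moreover have "C + 1 \<le> om j * a / \<eta>" using \<eta> C by (simp add: field_simps)
    ultimately have "om j * \<phi> j / (1 + \<tau> * \<phi> j) \<le> - (C + 1)" by (simp add: a_def)
    then show ?thesis using True a by (simp add: a_def)
  next
    case False
    show ?thesis
    proof (cases "0 \<le> \<phi> i")
      case True
      then have "om i * \<phi> i / (1 + \<tau> * \<phi> i) \<le> om i * \<phi> i / 1"
        using om[OF i] \<tau>0 by (intro divide_left_mono) (auto intro: add_pos_nonneg mult_nonneg_nonneg)
      then show ?thesis using \<open>i \<noteq> j\<close> True by simp
    next
      case neg: False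
      then have "om i * \<phi> i / (1 + \<tau> * \<phi> i) \<le> 0"
        using om[OF i] low[OF i] \<eta> by (intro divide_nonpos_pos mult_nonneg_nonpos) auto
      then show ?thesis using \<open>i \<noteq> j\<close> neg by (simp add: max_def)
    qed
  qed
  have "(\<Sum>i<m. om i * \<phi> i / (1 + \<tau> * \<phi> i))
      \<le> (\<Sum>i<m. om i * max (\<phi> i) 0 + (if i = j then - (C + 1) else 0))"
    by (intro sum_mono summand_le) auto
  also have "\<dots> = C - (C + 1)" using j by (simp add: sum.distrib C_def sum.delta)
  also have "\<dots> \<le> 0" by simp
  finally have "(\<Sum>i<m. om i * \<phi> i / (1 + \<tau> * \<phi> i)) \<le> 0" .
  moreover have "\<tau> \<in> EL_dom m \<phi>" using low \<eta>(1) by (auto simp: EL_dom_def intro: less_le_trans)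
  ultimately show ?thesis using \<tau>0 by blast
qed

lemma EL_dom_interval:
  assumes "a \<in> EL_dom m \<phi>" "b \<in> EL_dom m \<phi>" "a \<le> \<tau>" "\<tau> \<le> b"
  shows "\<tau> \<in> EL_dom m \<phi>"
  unfolding EL_dom_def
proof safe
  fix i assume i: "i < m"
  show "0 < 1 + \<tau> * \<phi> i"
  proof (cases "0 \<le> \<phi> i")
    case True
    then have "a * \<phi> i \<le> \<tau> * \<phi> i" using assms by (intro mult_right_mono) auto
    moreover have "0 < 1 + a * \<phi> i" using assms i by (simp add: EL_dom_def)
    ultimately show ?thesis by linarith
  next
    case False
    then have "b * \<phi> i \<le> \<tau> * \<phi> i" using assms by (intro mult_right_mono_neg) auto
    moreover have "0 < 1 + b * \<phi> i" using assms i by (simp add: EL_dom_def)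
    ultimately show ?thesis by linarith
  qed
qed

text \<open>If the \<open>\<phi>\<^sub>i\<close> have both signs, the score changes sign on the domain and the intermediate value theorem
yields a critical point. Otherwise all \<open>\<phi>\<^sub>i\<close> vanish, or the objective is unbounded.\<close>

lemma EL_critical_or_unbounded:
  fixes om \<phi> :: "nat \<Rightarrow> real"
  assumes om: "\<And>i. i < m \<Longrightarrow> 0 < om i"
  shows "(\<exists>\<tau>\<in>EL_dom m \<phi>. (\<Sum>i<m. om i * \<phi> i / (1 + \<tau> * \<phi> i)) = 0)
       \<or> (\<forall>B. \<exists>\<tau>\<in>EL_dom m \<phi>. B < EL_gain m om \<phi> \<tau>)"
proof -
  consider "\<forall>i<m. \<phi> i = 0" | "\<forall>i<m. 0 \<le> \<phi> i" "\<exists>i<m. 0 < \<phi> i" | "\<forall>i<m. \<phi> i \<le> 0" "\<exists>i<m. \<phi> i < 0"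
    | "\<exists>i<m. \<phi> i < 0" "\<exists>i<m. 0 < \<phi> i"
    by (metis less_linear not_le)
  then show ?thesis
  proof cases
    case 1
    then show ?thesis by (intro disjI1 bexI[of _ 0]) (auto simp: EL_dom_def)
  next
    case 2
    then show ?thesis using EL_gain_unbounded[of m om \<phi>] om by blast
  next
    case 3
    then have "\<forall>B. \<exists>\<tau>\<in>EL_dom m (\<lambda>i. - \<phi> i). B < EL_gain m om (\<lambda>i. - \<phi> i) \<tau>"
      using EL_gain_unbounded[of m om "\<lambda>i. - \<phi> i"] om by fastforce
    then show ?thesis unfolding Bex_def EL_gain_minus by blast
  next
    case 4
    let ?f = "\<lambda>\<tau>. \<Sum>i<m. om i * \<phi> i / (1 + \<tau> * \<phi> i)"
    obtain b where b: "0 \<le> b" "b \<in> EL_dom m \<phi>" "?f b \<le> 0"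
      using EL_score_nonpos[of m om _ \<phi>] 4(1) om by blast
    obtain a where a: "0 \<le> a" "- a \<in> EL_dom m \<phi>"
      "(\<Sum>i<m. om i * - \<phi> i / (1 + a * - \<phi> i)) \<le> 0"
      using EL_score_nonpos[of m om _ "\<lambda>i. - \<phi> i"] 4(2) om unfolding EL_gain_minus by force
    from a(3) have a3: "0 \<le> ?f (- a)" by (simp add: sum_negf)
    have "continuous_on {- a..b} ?f"
      using EL_dom_interval[OF a(2) b(2)]
      by (intro continuous_intros) (force simp: EL_dom_def)+
    then have "\<exists>x. - a \<le> x \<and> x \<le> b \<and> ?f x = 0"
      using b a a3 by (intro IVT2') auto
    then show ?thesis using EL_dom_interval[OF a(2) b(2)] by blast
  qed
qed

text \<open>In the unbounded case weak duality makes the supremum on the left 0, and both sides are \<open>\<infinity>\<close>. Without atoms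
the left side is also \<open>\<infinity>\<close>, since masses cannot sum to 1, whereas the dual objective is 0.\<close>

lemma EL_duality:
  fixes om e d \<phi> :: "nat \<Rightarrow> real"
  assumes om: "\<And>i. i < m \<Longrightarrow> 0 < om i" and e: "\<And>i. i < m \<Longrightarrow> 0 < e i"
    and d: "\<And>i. i < m \<Longrightarrow> 0 < d i" and K: "0 < K" and N: "0 < N"
    and s: "s = (\<Sum>i<m. om i)"
    and P: "P = {p. (\<forall>i<m. 0 \<le> p i) \<and> (\<Sum>i<m. p i * e i) = 1 \<and> (\<Sum>i<m. p i * e i * \<phi> i) = 0}"
  shows "neg_two_ln (SUP p\<in>P. ennreal (K * (\<Prod>i<m. (p i * d i / om i) powr (N * om i))))
    = (if m = 0 then \<infinity> else
        ereal (2 * (N * (s * ln s) - ln K - N * (\<Sum>i<m. om i * ln (d i / e i))))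
        + ereal (2 * N) * (SUP \<tau>\<in>EL_dom m \<phi>. ereal (EL_gain m om \<phi> \<tau>)))"
proof (cases "m = 0")
  case True
  then have "P = {}" by (auto simp: P)
  then show ?thesis using True by (simp add: neg_two_ln_def bot_ennreal)
next
  case False
  define v where "v p = K * (\<Prod>i<m. (p i * d i / om i) powr (N * om i))" for p
  define c where "c = ln K + N * (\<Sum>i<m. om i * ln (d i / e i)) - N * (s * ln s)"
  define R where "R \<tau> = exp (c - N * EL_gain m om \<phi> \<tau>)" for \<tau>
  have le: "v p \<le> R \<tau>" if "p \<in> P" "\<tau> \<in> EL_dom m \<phi>" for p \<tau>
    unfolding v_def R_def c_def
    by (rule EL_value_le) (use that om e d K N s in \<open>simp_all add: P\<close>)
  from EL_critical_or_unbounded[of m om \<phi>] om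
  consider \<tau> where "\<tau> \<in> EL_dom m \<phi>" "(\<Sum>i<m. om i * \<phi> i / (1 + \<tau> * \<phi> i)) = 0"
    | "\<forall>B. \<exists>\<tau>\<in>EL_dom m \<phi>. B < EL_gain m om \<phi> \<tau>" by blast
  then have "neg_two_ln (SUP p\<in>P. ennreal (v p))
    = ereal (- 2 * c) + ereal (2 * N) * (SUP \<tau>\<in>EL_dom m \<phi>. ereal (EL_gain m om \<phi> \<tau>))"
  proof cases
    case (1 \<tau>)
    have "\<exists>p. (\<forall>i<m. 0 \<le> p i) \<and> (\<Sum>i<m. p i * e i) = 1 \<and> (\<Sum>i<m. p i * e i * \<phi> i) = 0 \<and> v p = R \<tau>"
      unfolding v_def R_def c_def
      by (rule EL_value_critical) (use om e d K N s 1 False in simp_all)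
    then obtain p where p: "p \<in> P" "v p = R \<tau>" unfolding P by auto
    have "(SUP p\<in>P. ennreal (v p)) = ennreal (R \<tau>)"
      using p le 1(1) by (intro antisym SUP_least SUP_upper2[of p]) (auto intro: ennreal_leI)
    then have A: "neg_two_ln (SUP p\<in>P. ennreal (v p)) = ereal (- 2 * (c - N * EL_gain m om \<phi> \<tau>))"
      by (simp add: neg_two_ln_def R_def)
    have "EL_gain m om \<phi> t \<le> EL_gain m om \<phi> \<tau>" if "t \<in> EL_dom m \<phi>" for t
      using le[OF p(1) that] p(2) N by (simp add: R_def)
    then have "(SUP \<tau>\<in>EL_dom m \<phi>. ereal (EL_gain m om \<phi> \<tau>)) = ereal (EL_gain m om \<phi> \<tau>)"
      using 1(1) by (intro antisym SUP_least SUP_upper2[of \<tau>]) auto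
    then show ?thesis using A by (simp add: right_diff_distrib)
  next
    case 2
    have "v p \<le> 0" if p: "p \<in> P" for p
    proof (rule ccontr)
      assume "\<not> v p \<le> 0"
      then have "0 < v p" by simp
      obtain \<tau> where \<tau>: "\<tau> \<in> EL_dom m \<phi>" "(c - ln (v p)) / N < EL_gain m om \<phi> \<tau>" using 2 by blast
      then have "c - N * EL_gain m om \<phi> \<tau> < ln (v p)"
        using N by (simp add: pos_divide_less_eq mult.commute)
      then have "exp (c - N * EL_gain m om \<phi> \<tau>) < exp (ln (v p))" by (subst exp_less_cancel_iff)
      then have "R \<tau> < v p" unfolding R_def using \<open>0 < v p\<close> by simp
      with le[OF p \<tau>(1)] show False by simp
    qed
    then have "(SUP p\<in>P. ennreal (v p)) \<le> 0" by (intro SUP_least) (simp add: ennreal_neg)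
    then have "(SUP p\<in>P. ennreal (v p)) = 0" by simp
    moreover have "(SUP \<tau>\<in>EL_dom m \<phi>. ereal (EL_gain m om \<phi> \<tau>)) = \<infinity>"
    proof (rule SUP_PInfty)
      fix k :: nat
      show "\<exists>\<tau>\<in>EL_dom m \<phi>. ereal (real k) \<le> ereal (EL_gain m om \<phi> \<tau>)"
        using 2[rule_format, of "real k"] by (auto intro: less_imp_le)
    qed
    ultimately show ?thesis using N by (simp add: neg_two_ln_def)
  qed
  then show ?thesis using False by (simp add: v_def c_def algebra_simps)
qed

text \<open>The domain is open and the objective is continuous on it. The countable supremum is what makes the
dual formula measurable.\<close>

lemma EL_gain_SUP_Rats:
  fixes om \<phi> :: "nat \<Rightarrow> real"
  shows "(SUP \<tau>\<in>EL_dom m \<phi>. ereal (EL_gain m om \<phi> \<tau>)) = (SUP \<tau>\<in>EL_dom m \<phi> \<inter> \<rat>. ereal (EL_gain m om \<phi> \<tau>))"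
proof (rule antisym)
  show "(SUP \<tau>\<in>EL_dom m \<phi> \<inter> \<rat>. ereal (EL_gain m om \<phi> \<tau>)) \<le> (SUP \<tau>\<in>EL_dom m \<phi>. ereal (EL_gain m om \<phi> \<tau>))"
    by (rule SUP_subset_mono) auto
  show "(SUP \<tau>\<in>EL_dom m \<phi>. ereal (EL_gain m om \<phi> \<tau>)) \<le> (SUP \<tau>\<in>EL_dom m \<phi> \<inter> \<rat>. ereal (EL_gain m om \<phi> \<tau>))"
  proof (rule SUP_least)
    fix \<tau> assume \<tau>: "\<tau> \<in> EL_dom m \<phi>"
    obtain t where t: "\<And>n. t n \<in> \<rat>" "t \<longlonglongrightarrow> \<tau>"
    proof -
      have "\<tau> \<in> closure \<rat>" using Rats_closure_real by simp
      then show ?thesis using that unfolding closure_sequential by blast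
    qed
    have "\<forall>i\<in>{..<m}. \<forall>\<^sub>F n in sequentially. 0 < 1 + t n * \<phi> i"
    proof
      fix i assume "i \<in> {..<m}"
      then have "0 < 1 + \<tau> * \<phi> i" using \<tau> by (auto simp: EL_dom_def)
      moreover have "(\<lambda>n. 1 + t n * \<phi> i) \<longlonglongrightarrow> 1 + \<tau> * \<phi> i" by (intro tendsto_intros t)
      ultimately show "\<forall>\<^sub>F n in sequentially. 0 < 1 + t n * \<phi> i" by (rule order_tendstoD(1)[rotated])
    qed
    then have ev: "\<forall>\<^sub>F n in sequentially. t n \<in> EL_dom m \<phi>"
      by (subst (asm) eventually_ball_finite_distrib[symmetric]) (auto simp: EL_dom_def elim: eventually_mono)
    have "(\<lambda>n. EL_gain m om \<phi> (t n)) \<longlonglongrightarrow> EL_gain m om \<phi> \<tau>"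
      unfolding EL_gain_def using \<tau> by (intro tendsto_intros t) (auto simp: EL_dom_def)
    then have "(\<lambda>n. ereal (EL_gain m om \<phi> (t n))) \<longlonglongrightarrow> ereal (EL_gain m om \<phi> \<tau>)" by simp
    then show "ereal (EL_gain m om \<phi> \<tau>) \<le> (SUP \<tau>\<in>EL_dom m \<phi> \<inter> \<rat>. ereal (EL_gain m om \<phi> \<tau>))"
      by (rule tendsto_upperbound)
        (use ev in eventually_elim, auto intro!: SUP_upper t)
  qed
qed

section \<open>Concave functions close to a quadratic\<close>

lemma ln_one_plus_cubic:
  fixes x :: real assumes "\<bar>x\<bar> \<le> 1/2"
  shows "\<bar>ln (1 + x) - (x - x\<^sup>2 / 2)\<bar> \<le> 3 * \<bar>x\<bar> ^ 3"
proof (cases "x = 0")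
  case False
  define df :: "nat \<Rightarrow> real \<Rightarrow> real" where
    "df = (\<lambda>k t. if k = 0 then ln (1 + t) else if k = 1 then inverse (1 + t) else
       if k = 2 then - (inverse (1 + t))\<^sup>2 else 2 * inverse (1 + t) ^ 3)"
  have D: "DERIV (df k) t :> df (Suc k) t" if "k < 3" "- 1/2 \<le> t" "t \<le> 1/2" for k t
  proof -
    have "0 < 1 + t" using that by simp
    have "k = 0 \<or> k = 1 \<or> k = 2" using that by auto
    have d1: "DERIV (\<lambda>t. inverse (1 + t)) t :> - (inverse (1 + t) * inverse (1 + t))"
      using \<open>0 < 1 + t\<close> by (auto intro!: derivative_eq_intros)
    have "DERIV (\<lambda>t. - (inverse (1 + t))\<^sup>2) t :> 2 * inverse (1 + t) ^ 3"
      using DERIV_minus[OF DERIV_power[OF d1, of 2]] by (simp add: power3_eq_cube mult.assoc)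
    moreover have "DERIV (\<lambda>t. ln (1 + t)) t :> inverse (1 + t)"
      using \<open>0 < 1 + t\<close> by (auto intro!: derivative_eq_intros simp: inverse_eq_divide)
    ultimately show ?thesis
      using d1 \<open>k = 0 \<or> k = 1 \<or> k = 2\<close>
      by (elim disjE) (simp_all add: df_def power2_eq_square)
  qed
  have "\<exists>t. (if x < 0 then x < t \<and> t < 0 else 0 < t \<and> t < x) \<and>
      ln (1 + x) = (\<Sum>k<3. (df k 0 / fact k) * (x - 0) ^ k) + (df 3 t / fact 3) * (x - 0) ^ 3"
    by (rule Taylor[where a="-1/2" and b="1/2"]) (use assms False D in \<open>auto simp: df_def\<close>)
  then obtain t where "if x < 0 then x < t \<and> t < 0 else 0 < t \<and> t < x"
    and exp: "ln (1 + x) = (\<Sum>k<3. (df k 0 / fact k) * (x - 0) ^ k) + (df 3 t / fact 3) * (x - 0) ^ 3"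
    by blast
  then have t: "- 1/2 \<le> t" using assms by (auto split: if_splits)
  have "ln (1 + x) - (x - x\<^sup>2 / 2) = (1 / (3 * (1 + t)^3)) * x^3"
    using exp by (simp add: df_def eval_nat_numeral divide_simps)
  then have "\<bar>ln (1 + x) - (x - x\<^sup>2 / 2)\<bar> = (1 / (3 * (1 + t)^3)) * \<bar>x\<bar>^3"
    using t by (simp add: abs_mult power_abs)
  also have "\<dots> \<le> 3 * \<bar>x\<bar>^3"
  proof (rule mult_right_mono)
    have "(1/2)^3 \<le> (1 + t)^3" using t by (intro power_mono) auto
    then show "1 / (3 * (1 + t)^3) \<le> 3" by (simp add: field_simps power3_eq_cube)
  qed simp
  finally show ?thesis .
qed simp

text \<open>If \<open>q\<close> is the probability of an event, \<open>tilt q x\<close> is its probability after the odds have been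
multiplied by \<open>x\<close>. Replacing \<open>\<theta>0\<close> by \<open>\<theta>0 x\<close> changes the probability of belonging to the second sample
in this way.\<close>

definition tilt :: "real \<Rightarrow> real \<Rightarrow> real" where
  "tilt q x = q * x / (1 + q * (x - 1))"

lemma tilt_denominator_pos:
  assumes "0 \<le> q" "q < 1" "0 < x" shows "0 < 1 + q * (x - (1::real))"
proof -
  have "0 < (1 - q) + q * x" using assms by (intro add_pos_nonneg) auto
  then show ?thesis by (simp add: algebra_simps)
qed

lemma tilt_bounds:
  assumes "0 \<le> q" "q < 1" "0 < x" shows "0 \<le> tilt q x" "tilt q x < 1"
  using assms tilt_denominator_pos[OF assms] by (auto simp: tilt_def divide_simps algebra_simps)

lemma tilt_mono:
  assumes "0 \<le> q" "q < 1" "0 < x" "x < y"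
  shows "tilt q x \<le> tilt q y" "0 < q \<Longrightarrow> tilt q x < tilt q y"
proof -
  have py: "0 < 1 + q * (y - 1)" and px: "0 < 1 + q * (x - 1)"
    using assms by (auto intro: tilt_denominator_pos)
  have "tilt q y - tilt q x = q * (1 - q) * (y - x) / ((1 + q * (y - 1)) * (1 + q * (x - 1)))"
    using px py unfolding tilt_def by (simp add: divide_simps) (simp add: algebra_simps)
  moreover have "0 \<le> q * (1 - q) * (y - x)" "0 < q \<Longrightarrow> 0 < q * (1 - q) * (y - x)" using assms by auto
  ultimately have "0 \<le> tilt q y - tilt q x" "0 < q \<Longrightarrow> 0 < tilt q y - tilt q x"
    using px py by auto
  then show "tilt q x \<le> tilt q y" "0 < q \<Longrightarrow> tilt q x < tilt q y" by auto
qed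

text \<open>In the coordinate \<open>t = ln x\<close> the derivative of the cumulant generating function of a Bernoulli variable
is its tilted mean, and the second derivative is the tilted variance.\<close>

lemma DERIV_log_tilt:
  assumes "0 \<le> q" "q < 1"
  shows "DERIV (\<lambda>t. ln (1 + q * (exp t - 1))) t :> tilt q (exp t)"
    and "DERIV (\<lambda>t. tilt q (exp t)) t :> tilt q (exp t) * (1 - tilt q (exp t))"
proof -
  have p: "0 < 1 + q * (exp t - 1)" using assms by (intro tilt_denominator_pos) auto
  then show "DERIV (\<lambda>t. ln (1 + q * (exp t - 1))) t :> tilt q (exp t)"
    by (auto simp: tilt_def intro!: derivative_eq_intros)
  show "DERIV (\<lambda>t. tilt q (exp t)) t :> tilt q (exp t) * (1 - tilt q (exp t))"
    using p unfolding tilt_def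
    by (auto intro!: derivative_eq_intros simp: divide_simps) (simp add: algebra_simps)
qed

lemma convex_log_tilt:
  assumes "0 \<le> q" "q < 1" shows "convex_on UNIV (\<lambda>t. ln (1 + q * (exp t - 1)))"
proof (rule f''_ge0_imp_convex)
  fix t :: real
  show "DERIV (\<lambda>t. ln (1 + q * (exp t - 1))) t :> tilt q (exp t)"
    "DERIV (\<lambda>t. tilt q (exp t)) t :> tilt q (exp t) * (1 - tilt q (exp t))"
    using DERIV_log_tilt assms by blast+
  show "0 \<le> tilt q (exp t) * (1 - tilt q (exp t))"
    using tilt_bounds[OF assms, of "exp t"] by simp
qed auto

text \<open>Writing \<open>\<pi>\<close> for the tilted mean, the third derivative is \<open>\<pi> (1 - \<pi>) (1 - 2 \<pi>)\<close>, which is at most 1 in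
absolute value. The bound does not depend on \<open>q\<close>.\<close>

lemma log_tilt_cubic:
  fixes q :: real
  assumes q: "0 \<le> q" "q < 1"
  shows "\<bar>ln (1 + q * (exp \<epsilon> - 1)) - (q * \<epsilon> + q * (1 - q) * \<epsilon>\<^sup>2 / 2)\<bar> \<le> \<bar>\<epsilon>\<bar> ^ 3"
proof (cases "\<epsilon> = 0")
  case False
  let ?\<pi> = "\<lambda>t. tilt q (exp t)"
  define df :: "nat \<Rightarrow> real \<Rightarrow> real" where
    "df = (\<lambda>k t. if k = 0 then ln (1 + q * (exp t - 1)) else if k = 1 then ?\<pi> t else
       if k = 2 then ?\<pi> t * (1 - ?\<pi> t) else ?\<pi> t * (1 - ?\<pi> t) * (1 - 2 * ?\<pi> t))"
  have D: "DERIV (df k) t :> df (Suc k) t" if "k < 3" for k t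
  proof -
    have "k = 0 \<or> k = 1 \<or> k = 2" using that by auto
    then show ?thesis
      using DERIV_log_tilt[OF q, of t]
      by (elim disjE) (auto simp: df_def algebra_simps intro!: derivative_eq_intros)
  qed
  have "\<exists>t. (if \<epsilon> < 0 then \<epsilon> < t \<and> t < 0 else 0 < t \<and> t < \<epsilon>) \<and>
      ln (1 + q * (exp \<epsilon> - 1)) = (\<Sum>k<3. (df k 0 / fact k) * (\<epsilon> - 0) ^ k) + (df 3 t / fact 3) * (\<epsilon> - 0) ^ 3"
    by (rule Taylor[where a="-\<bar>\<epsilon>\<bar>" and b="\<bar>\<epsilon>\<bar>"]) (use False D in \<open>auto simp: df_def\<close>)
  then obtain t where "ln (1 + q * (exp \<epsilon> - 1)) = (\<Sum>k<3. (df k 0 / fact k) * \<epsilon> ^ k) + (df 3 t / fact 3) * \<epsilon> ^ 3"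
    by auto
  then have "ln (1 + q * (exp \<epsilon> - 1)) - (q * \<epsilon> + q * (1 - q) * \<epsilon>\<^sup>2 / 2) = df 3 t / 6 * \<epsilon>^3"
    by (simp add: df_def eval_nat_numeral tilt_def)
  then have "\<bar>ln (1 + q * (exp \<epsilon> - 1)) - (q * \<epsilon> + q * (1 - q) * \<epsilon>\<^sup>2 / 2)\<bar> = \<bar>df 3 t / 6\<bar> * \<bar>\<epsilon>\<bar>^3"
    by (simp only: abs_mult power_abs)
  also have "\<dots> \<le> 1 * \<bar>\<epsilon>\<bar>^3"
  proof (rule mult_right_mono)
    have b: "0 \<le> ?\<pi> t" "?\<pi> t < 1" using tilt_bounds[OF q, of "exp t"] by auto
    have "\<bar>?\<pi> t\<bar> * \<bar>1 - ?\<pi> t\<bar> * \<bar>1 - 2 * ?\<pi> t\<bar> \<le> 1 * 1 * 1"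
      using b by (intro mult_mono) auto
    then show "\<bar>df 3 t / 6\<bar> \<le> 1" by (simp add: df_def abs_mult)
  qed simp
  finally show ?thesis by simp
qed simp

text \<open>The point \<open>a / b\<close> is where the quadratic peaks, with value \<open>a\<^sup>2 / (2 b)\<close>. The radius \<open>r\<close> is at least four times
\<open>\<bar>a / b\<bar>\<close>, so that at distance \<open>r\<close> the quadratic is at most \<open>- b r\<^sup>2 / 4\<close>, and it is so small that the
cubic error cannot make up for this; then \<open>g\<close> is negative at distance \<open>r\<close>. Concavity, used only along rays
from 0 where \<open>g\<close> vanishes, carries the sign to all points farther out.\<close>

lemma concave_max_of_quadratic_approx:
  fixes g :: "real \<Rightarrow> real" and a b C r \<delta> :: real
  assumes star: "\<And>\<tau> l. \<tau> \<in> I \<Longrightarrow> 0 \<le> l \<Longrightarrow> l \<le> 1 \<Longrightarrow> l * g \<tau> \<le> g (l * \<tau>)"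
    and approx: "\<And>\<tau>. \<bar>\<tau>\<bar> \<le> \<delta> \<Longrightarrow> \<bar>g \<tau> - (a * \<tau> - b * \<tau>\<^sup>2 / 2)\<bar> \<le> C * \<bar>\<tau>\<bar> ^ 3"
    and b: "0 < b" and C: "0 \<le> C" and r: "0 < r" "r \<le> \<delta>" "4 * \<bar>a\<bar> \<le> b * r" "C * r < b / 4"
  shows "\<And>\<tau>. \<tau> \<in> I \<Longrightarrow> r \<le> \<bar>\<tau>\<bar> \<Longrightarrow> g \<tau> < 0"
    and "\<And>\<tau>. \<tau> \<in> I \<Longrightarrow> g \<tau> \<le> a\<^sup>2 / (2 * b) + C * r ^ 3"
    and "\<bar>a / b\<bar> \<le> r" "a\<^sup>2 / (2 * b) - C * r ^ 3 \<le> g (a / b)"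
proof -
  have edge: "g \<tau> < 0" if "\<bar>\<tau>\<bar> = r" for \<tau>
  proof -
    have "g \<tau> \<le> a * \<tau> - b * \<tau>\<^sup>2 / 2 + C * \<bar>\<tau>\<bar> ^ 3" using approx[of \<tau>] that r by linarith
    also have "a * \<tau> \<le> \<bar>a\<bar> * r" using that by (metis abs_ge_self abs_mult)
    also have "\<tau>\<^sup>2 = r\<^sup>2" using that by (metis power2_abs)
    also have "\<bar>a\<bar> * r \<le> b * r / 4 * r" using r by (intro mult_right_mono) auto
    finally have "g \<tau> \<le> (C * r - b / 4) * r\<^sup>2"
      using that by (simp add: algebra_simps power2_eq_square power3_eq_cube)
    also have "\<dots> < 0" using r by (intro mult_neg_pos) auto
    finally show ?thesis .
  qed
  show outside: "g \<tau> < 0" if "\<tau> \<in> I" "r \<le> \<bar>\<tau>\<bar>" for \<tau>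
  proof -
    have "r / \<bar>\<tau>\<bar> * g \<tau> \<le> g (r / \<bar>\<tau>\<bar> * \<tau>)" using that r by (intro star) auto
    also have "\<dots> < 0" using that r by (intro edge) (auto simp: abs_mult)
    finally show ?thesis using that r by (auto simp: mult_less_0_iff divide_less_0_iff)
  qed
  have Cr: "0 \<le> C * r ^ 3" using C r by simp
  have sq: "0 \<le> a\<^sup>2 / (2 * b)" using b by simp
  show "g \<tau> \<le> a\<^sup>2 / (2 * b) + C * r ^ 3" if "\<tau> \<in> I" for \<tau>
  proof (cases "r \<le> \<bar>\<tau>\<bar>")
    case True
    then show ?thesis using outside[OF that] Cr sq by linarith
  next
    case False
    then have "g \<tau> \<le> a * \<tau> - b * \<tau>\<^sup>2 / 2 + C * \<bar>\<tau>\<bar> ^ 3" using approx[of \<tau>] r by linarith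
    also have "C * \<bar>\<tau>\<bar> ^ 3 \<le> C * r ^ 3" using False C by (intro mult_left_mono power_mono) auto
    also have "a * \<tau> - b * \<tau>\<^sup>2 / 2 = a\<^sup>2 / (2 * b) - (a - b * \<tau>)\<^sup>2 / (2 * b)"
      using b by (simp add: field_simps power2_eq_square)
    also have "\<dots> \<le> a\<^sup>2 / (2 * b)" using b by simp
    finally show ?thesis by simp
  qed
  show ab: "\<bar>a / b\<bar> \<le> r" using b r by (simp add: abs_divide pos_divide_le_eq mult.commute)
  have "a * (a / b) - b * (a / b)\<^sup>2 / 2 = a\<^sup>2 / (2 * b)"
    using b by (simp add: field_simps power2_eq_square)
  moreover have "C * \<bar>a / b\<bar> ^ 3 \<le> C * r ^ 3" using ab C by (intro mult_left_mono power_mono) auto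
  ultimately show "a\<^sup>2 / (2 * b) - C * r ^ 3 \<le> g (a / b)"
    using approx[of "a / b"] ab r by linarith
qed

lemma EL_gain_star:
  assumes om: "\<And>i. i < m \<Longrightarrow> 0 < om i" and "\<tau> \<in> EL_dom m \<phi>" "0 \<le> l" "l \<le> 1"
  shows "l * EL_gain m om \<phi> \<tau> \<le> EL_gain m om \<phi> (l * \<tau>)"
  unfolding EL_gain_def sum_distrib_left
proof (rule sum_mono)
  fix i assume i: "i \<in> {..<m}"
  then have p: "0 < 1 + \<tau> * \<phi> i" using assms by (auto simp: EL_dom_def)
  have "l * ln (1 + \<tau> * \<phi> i) + (1 - l) * ln 1 \<le> ln (l * (1 + \<tau> * \<phi> i) + (1 - l) * 1)"
    using concave_onD[OF ln_concave, of "1 - l" "1 + \<tau> * \<phi> i" 1] p assms by simp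
  moreover have "l * (1 + \<tau> * \<phi> i) + (1 - l) * 1 = 1 + l * \<tau> * \<phi> i" by (simp add: algebra_simps)
  ultimately have "l * ln (1 + \<tau> * \<phi> i) \<le> ln (1 + l * \<tau> * \<phi> i)" by (simp only: ln_one mult_zero_right add_0_right)
  then show "l * (om i * ln (1 + \<tau> * \<phi> i)) \<le> om i * ln (1 + l * \<tau> * \<phi> i)"
    using om[of i] i by (simp add: mult.left_commute[of l])
qed

lemma EL_gain_approx:
  assumes om: "\<And>i. i < m \<Longrightarrow> 0 < om i" "(\<Sum>i<m. om i) \<le> 1" and K: "0 < K" "\<And>i. i < m \<Longrightarrow> \<bar>\<phi> i\<bar> \<le> K"
    and \<tau>: "\<bar>\<tau>\<bar> \<le> 1 / (2 * K)"
  shows "\<tau> \<in> EL_dom m \<phi>"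
    "\<bar>EL_gain m om \<phi> \<tau> - ((\<Sum>i<m. om i * \<phi> i) * \<tau> - (\<Sum>i<m. om i * (\<phi> i)\<^sup>2) * \<tau>\<^sup>2 / 2)\<bar> \<le> 3 * K ^ 3 * \<bar>\<tau>\<bar> ^ 3"
proof -
  have le: "\<bar>\<tau> * \<phi> i\<bar> \<le> K * \<bar>\<tau>\<bar>" "\<bar>\<tau> * \<phi> i\<bar> \<le> 1/2" if "i < m" for i
  proof -
    show *: "\<bar>\<tau> * \<phi> i\<bar> \<le> K * \<bar>\<tau>\<bar>"
      using mult_left_mono[OF K(2)[OF that], of "\<bar>\<tau>\<bar>"] by (simp add: abs_mult mult.commute)
    have "K * \<bar>\<tau>\<bar> \<le> 1/2" using \<tau> K by (simp add: field_simps)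
    with * show "\<bar>\<tau> * \<phi> i\<bar> \<le> 1/2" by simp
  qed
  show "\<tau> \<in> EL_dom m \<phi>" unfolding EL_dom_def using le(2) by (fastforce simp: abs_le_iff)
  have "EL_gain m om \<phi> \<tau> - ((\<Sum>i<m. om i * \<phi> i) * \<tau> - (\<Sum>i<m. om i * (\<phi> i)\<^sup>2) * \<tau>\<^sup>2 / 2)
      = (\<Sum>i<m. om i * (ln (1 + \<tau> * \<phi> i) - (\<tau> * \<phi> i - (\<tau> * \<phi> i)\<^sup>2 / 2)))"
    unfolding EL_gain_def sum_distrib_right sum_divide_distrib sum_subtractf[symmetric]
    by (intro sum.cong refl) (simp add: algebra_simps)
  also have "\<bar>\<dots>\<bar> \<le> (\<Sum>i<m. om i * (3 * (K * \<bar>\<tau>\<bar>) ^ 3))"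
  proof (rule order_trans[OF sum_abs sum_mono])
    fix i assume "i \<in> {..<m}"
    then have i: "i < m" by simp
    have "\<bar>ln (1 + \<tau> * \<phi> i) - (\<tau> * \<phi> i - (\<tau> * \<phi> i)\<^sup>2 / 2)\<bar> \<le> 3 * \<bar>\<tau> * \<phi> i\<bar> ^ 3"
      by (rule ln_one_plus_cubic) (rule le[OF i])
    also have "\<dots> \<le> 3 * (K * \<bar>\<tau>\<bar>) ^ 3" using le[OF i] by (intro mult_left_mono power_mono) auto
    finally show "\<bar>om i * (ln (1 + \<tau> * \<phi> i) - (\<tau> * \<phi> i - (\<tau> * \<phi> i)\<^sup>2 / 2))\<bar> \<le> om i * (3 * (K * \<bar>\<tau>\<bar>) ^ 3)"
      using om(1)[OF i] by (simp add: abs_mult)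
  qed
  also have "\<dots> \<le> 1 * (3 * (K * \<bar>\<tau>\<bar>) ^ 3)"
    unfolding sum_distrib_right[symmetric] using om(2) K by (intro mult_right_mono) auto
  finally show "\<bar>EL_gain m om \<phi> \<tau> - ((\<Sum>i<m. om i * \<phi> i) * \<tau> - (\<Sum>i<m. om i * (\<phi> i)\<^sup>2) * \<tau>\<^sup>2 / 2)\<bar> \<le> 3 * K ^ 3 * \<bar>\<tau>\<bar> ^ 3"
    by (simp add: power_mult_distrib)
qed

text \<open>For \<open>h = \<rho>1\<close> times the mass of the second NPMLE, this is a concave function of \<open>\<epsilon> = ln (\<theta> / \<theta>0)\<close> with
derivative \<open>h - tilt_score (exp \<epsilon>)\<close>; setting the derivative to 0 is the estimating equation for \<open>\<theta>\<close>.\<close>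

definition tilt_gain :: "nat \<Rightarrow> (nat \<Rightarrow> real) \<Rightarrow> (nat \<Rightarrow> real) \<Rightarrow> real \<Rightarrow> real \<Rightarrow> real" where
  "tilt_gain m om q h \<epsilon> = h * \<epsilon> - (\<Sum>i<m. om i * ln (1 + q i * (exp \<epsilon> - 1)))"

definition tilt_score :: "nat \<Rightarrow> (nat \<Rightarrow> real) \<Rightarrow> (nat \<Rightarrow> real) \<Rightarrow> real \<Rightarrow> real" where
  "tilt_score m om q x = (\<Sum>i<m. om i * tilt (q i) x)"

lemma tilt_gain_tangent:
  assumes om: "\<And>i. i < m \<Longrightarrow> 0 < om i" and q: "\<And>i. i < m \<Longrightarrow> 0 \<le> q i" "\<And>i. i < m \<Longrightarrow> q i < 1"
  shows "tilt_gain m om q h t \<le> tilt_gain m om q h c + (h - tilt_score m om q (exp c)) * (t - c)"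
proof -
  have "(\<Sum>i<m. om i * (tilt (q i) (exp c) * (t - c)))
    \<le> (\<Sum>i<m. om i * (ln (1 + q i * (exp t - 1)) - ln (1 + q i * (exp c - 1))))"
  proof (intro sum_mono mult_left_mono)
    fix i assume "i \<in> {..<m}"
    then have i: "i < m" by simp
    show "tilt (q i) (exp c) * (t - c) \<le> ln (1 + q i * (exp t - 1)) - ln (1 + q i * (exp c - 1))"
      by (rule convex_on_imp_above_tangent[OF convex_log_tilt[OF q(1)[OF i] q(2)[OF i]]])
        (use DERIV_log_tilt(1)[OF q(1)[OF i] q(2)[OF i]] in auto)
  qed (auto intro: less_imp_le om)
  then show ?thesis
    unfolding tilt_gain_def tilt_score_def
    by (simp add: right_diff_distrib left_diff_distrib sum_subtractf sum_distrib_right mult.assoc)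
qed

lemma tilt_gain_star:
  assumes om: "\<And>i. i < m \<Longrightarrow> 0 < om i" and q: "\<And>i. i < m \<Longrightarrow> 0 \<le> q i" "\<And>i. i < m \<Longrightarrow> q i < 1"
    and l: "0 \<le> l" "l \<le> 1"
  shows "l * tilt_gain m om q h \<epsilon> \<le> tilt_gain m om q h (l * \<epsilon>)"
proof -
  have "(\<Sum>i<m. om i * ln (1 + q i * (exp (l * \<epsilon>) - 1))) \<le> (\<Sum>i<m. om i * (l * ln (1 + q i * (exp \<epsilon> - 1))))"
  proof (intro sum_mono mult_left_mono)
    fix i assume "i \<in> {..<m}"
    then have i: "i < m" by simp
    show "ln (1 + q i * (exp (l * \<epsilon>) - 1)) \<le> l * ln (1 + q i * (exp \<epsilon> - 1))"
      using convex_onD[OF convex_log_tilt[OF q(1)[OF i] q(2)[OF i]], of l 0 \<epsilon>] l by simp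
  qed (auto intro: less_imp_le om)
  then show ?thesis
    unfolding tilt_gain_def by (simp add: right_diff_distrib sum_distrib_left mult.left_commute)
qed

lemma tilt_gain_approx:
  assumes om: "\<And>i. i < m \<Longrightarrow> 0 < om i" "(\<Sum>i<m. om i) \<le> 1"
    and q: "\<And>i. i < m \<Longrightarrow> 0 \<le> q i" "\<And>i. i < m \<Longrightarrow> q i < 1"
  shows "\<bar>tilt_gain m om q h \<epsilon> - ((h - (\<Sum>i<m. om i * q i)) * \<epsilon>
           - ((\<Sum>i<m. om i * q i) - (\<Sum>i<m. om i * (q i)\<^sup>2)) * \<epsilon>\<^sup>2 / 2)\<bar> \<le> 1 * \<bar>\<epsilon>\<bar> ^ 3"
proof -
  have "tilt_gain m om q h \<epsilon> - ((h - (\<Sum>i<m. om i * q i)) * \<epsilon>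
           - ((\<Sum>i<m. om i * q i) - (\<Sum>i<m. om i * (q i)\<^sup>2)) * \<epsilon>\<^sup>2 / 2)
      = - (\<Sum>i<m. om i * (ln (1 + q i * (exp \<epsilon> - 1)) - (q i * \<epsilon> + q i * (1 - q i) * \<epsilon>\<^sup>2 / 2)))"
    unfolding tilt_gain_def
    by (simp add: algebra_simps sum.distrib sum_subtractf sum_distrib_right sum_distrib_left
        sum_divide_distrib power2_eq_square diff_divide_distrib add_divide_distrib)
  also have "\<bar>\<dots>\<bar> \<le> (\<Sum>i<m. om i * \<bar>\<epsilon>\<bar> ^ 3)"
    unfolding abs_minus_cancel
  proof (rule order_trans[OF sum_abs sum_mono])
    fix i assume "i \<in> {..<m}"
    then have i: "i < m" by simp
    show "\<bar>om i * (ln (1 + q i * (exp \<epsilon> - 1)) - (q i * \<epsilon> + q i * (1 - q i) * \<epsilon>\<^sup>2 / 2))\<bar> \<le> om i * \<bar>\<epsilon>\<bar> ^ 3"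
      using om(1)[OF i] log_tilt_cubic[OF q(1)[OF i] q(2)[OF i]]
      by (simp only: abs_mult) (auto intro!: mult_left_mono)
  qed
  also have "\<dots> \<le> 1 * \<bar>\<epsilon>\<bar> ^ 3"
    unfolding sum_distrib_right[symmetric] using om(2) by (intro mult_right_mono) auto
  finally show ?thesis .
qed

section \<open>Quadratic expansion of the dual statistic\<close>

lemma tilt_score_mono:
  assumes om: "\<And>i. i < m \<Longrightarrow> 0 < om i" and q: "\<And>i. i < m \<Longrightarrow> 0 \<le> q i" "\<And>i. i < m \<Longrightarrow> q i < 1"
    and xy: "0 < x" "x < y"
  shows "tilt_score m om q x \<le> tilt_score m om q y"
    and "i < m \<Longrightarrow> 0 < q i \<Longrightarrow> tilt_score m om q x < tilt_score m om q y"
proof -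
  show "tilt_score m om q x \<le> tilt_score m om q y" unfolding tilt_score_def
    using om by (intro sum_mono mult_left_mono tilt_mono q xy) (auto intro: less_imp_le)
  assume i: "i < m" "0 < q i"
  have "\<forall>i<m. om i * tilt (q i) x \<le> om i * tilt (q i) y"
    using om by (intro allI impI mult_left_mono tilt_mono q xy) (auto intro: less_imp_le)
  moreover have "om i * tilt (q i) x < om i * tilt (q i) y"
    using i om by (intro mult_strict_left_mono tilt_mono q xy) auto
  ultimately show "tilt_score m om q x < tilt_score m om q y"
    unfolding tilt_score_def using i by (intro sum_strict_mono_ex1) auto
qed

text \<open>The score is continuous, and it is constant 0 or strictly increasing in \<open>x\<close>. A unique root therefore
exists exactly if the score crosses \<open>h\<close>, and rational points on both sides suffice to see this. The
criterion makes the event of a unique root measurable.\<close>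

lemma tilt_score_unique_root_iff:
  assumes om: "\<And>i. i < m \<Longrightarrow> 0 < om i" and q: "\<And>i. i < m \<Longrightarrow> 0 \<le> q i" "\<And>i. i < m \<Longrightarrow> q i < 1"
  shows "(\<exists>!x. 0 < x \<and> tilt_score m om q x = h) \<longleftrightarrow>
    (\<exists>a\<in>\<rat>. \<exists>b\<in>\<rat>. 0 < a \<and> a < b \<and> tilt_score m om q a < h \<and> h < tilt_score m om q b)"
proof
  assume ex1: "\<exists>!x. 0 < x \<and> tilt_score m om q x = h"
  then obtain x where x: "0 < x" "tilt_score m om q x = h" by blast
  have "\<exists>i<m. 0 < q i"
  proof (rule ccontr)
    assume "\<not> ?thesis"
    then have "tilt_score m om q y = 0" for y
      using q(1) by (force simp: tilt_score_def tilt_def intro!: sum.neutral)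
    then have "0 < (1::real) \<and> tilt_score m om q 1 = h" "0 < (2::real) \<and> tilt_score m om q 2 = h" using x by auto
    with ex1 have "(1::real) = 2" by blast
    then show False by simp
  qed
  then obtain i where i: "i < m" "0 < q i" by blast
  obtain a where a: "a \<in> \<rat>" "0 < a" "a < x" using Rats_dense_in_real[of 0 x] x by auto
  obtain b where b: "b \<in> \<rat>" "x < b" using Rats_dense_in_real[of x "x + 1"] by auto
  have "tilt_score m om q a < h" "h < tilt_score m om q b"
    using tilt_score_mono(2)[of m om q, OF om q _ _ i] a b x by auto
  with a b show "\<exists>a\<in>\<rat>. \<exists>b\<in>\<rat>. 0 < a \<and> a < b \<and> tilt_score m om q a < h \<and> h < tilt_score m om q b"
    by (meson less_trans)
next
  assume "\<exists>a\<in>\<rat>. \<exists>b\<in>\<rat>. 0 < a \<and> a < b \<and> tilt_score m om q a < h \<and> h < tilt_score m om q b"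
  then obtain a b where ab: "0 < a" "a < b" "tilt_score m om q a < h" "h < tilt_score m om q b" by blast
  have "\<exists>i<m. 0 < q i"
  proof (rule ccontr)
    assume "\<not> ?thesis"
    then have "tilt_score m om q y = 0" for y
      using q(1) by (force simp: tilt_score_def tilt_def intro!: sum.neutral)
    with ab show False by simp
  qed
  then obtain i where i: "i < m" "0 < q i" by blast
  note strict = tilt_score_mono(2)[of m om q, OF om q _ _ i]
  have "1 + q i * (x - 1) \<noteq> 0" if "i < m" "a \<le> x" for i x
    using tilt_denominator_pos[of "q i" x] q that ab by force
  then have "continuous_on {a..b} (tilt_score m om q)"
    unfolding tilt_score_def tilt_def by (intro continuous_intros) auto
  then obtain x where x: "a \<le> x" "tilt_score m om q x = h"
    using IVT'[of "tilt_score m om q" a h b] ab by auto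
  show "\<exists>!x. 0 < x \<and> tilt_score m om q x = h"
  proof (rule ex1I[of _ x])
    show "0 < x \<and> tilt_score m om q x = h" using x ab by simp
    fix y assume y: "0 < y \<and> tilt_score m om q y = h"
    show "y = x" using strict[of x y] strict[of y x] x y ab by (cases x y rule: linorder_cases) auto
  qed
qed

text \<open>A critical point of the concave function is a maximizer, and maximizers lie where the function is not
negative, that is, within distance \<open>r\<close> of 0. Comparing the tangents at \<open>r\<close> and \<open>- r\<close> with the value 0 at 0 shows
that the derivative changes sign in between, which gives existence.\<close>

lemma tilt_root_near_one:
  assumes om: "\<And>i. i < m \<Longrightarrow> 0 < om i" and q: "\<And>i. i < m \<Longrightarrow> 0 \<le> q i" "\<And>i. i < m \<Longrightarrow> q i < 1"
    and r: "0 < r" "\<And>\<epsilon>. r \<le> \<bar>\<epsilon>\<bar> \<Longrightarrow> tilt_gain m om q h \<epsilon> < 0"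
  shows "\<exists>!x. 0 < x \<and> tilt_score m om q x = h"
    and "0 < x \<Longrightarrow> tilt_score m om q x = h \<Longrightarrow> \<bar>ln x\<bar> \<le> r"
    and "0 < x \<Longrightarrow> tilt_score m om q x = h \<Longrightarrow> tilt_gain m om q h t \<le> tilt_gain m om q h (ln x)"
proof -
  note tangent = tilt_gain_tangent[of m om q, OF om q]
  have zero: "tilt_gain m om q h 0 = 0" by (simp add: tilt_gain_def)
  have "(h - tilt_score m om q (exp c)) * c < 0" if "\<bar>c\<bar> = r" for c
    using tangent[of h 0 c] r(2)[of c] that zero by auto
  from this[of r] this[of "- r"]
  have "h < tilt_score m om q (exp r)" "tilt_score m om q (exp (- r)) < h"
    using r(1) by (auto simp: zero_less_mult_iff mult_less_0_iff)
  then have sc: "tilt_score m om q (exp (- r)) < h" "h < tilt_score m om q (exp r)" by auto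
  show max: "tilt_gain m om q h t \<le> tilt_gain m om q h (ln x)"
    if "0 < x" "tilt_score m om q x = h" for x t
    using tangent[of h t "ln x"] that by simp
  show "\<bar>ln x\<bar> \<le> r" if "0 < x" "tilt_score m om q x = h" for x
    using max[OF that, of 0] r(2)[of "ln x"] zero by linarith
  have mono: "x < y" if "0 < x" "0 < y" "tilt_score m om q x < tilt_score m om q y" for x y
    using tilt_score_mono(1)[of m om q y x, OF om q] that by (cases x y rule: linorder_cases) auto
  have cont: "isCont (tilt_score m om q) x" if "0 < x" for x
  proof -
    have "1 + q i * (x - 1) \<noteq> 0" if "i < m" for i
      using tilt_denominator_pos[of "q i" x] q that \<open>0 < x\<close> by force
    then show ?thesis unfolding tilt_score_def tilt_def by (intro continuous_intros) auto
  qed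
  have "\<forall>\<^sub>F a in at_left (exp (- r)). tilt_score m om q a < h"
    using cont[of "exp (- r)"] sc(1) unfolding isCont_def
    by (intro order_tendstoD(2)[of _ "tilt_score m om q (exp (- r))"])
      (auto intro: filterlim_mono at_le)
  moreover have "\<forall>\<^sub>F a in at_left (exp (- r)). a \<in> {0<..<exp (- r)}"
    by (rule eventually_at_leftI[of 0]) auto
  ultimately have "\<forall>\<^sub>F a in at_left (exp (- r)). tilt_score m om q a < h \<and> a \<in> {0<..<exp (- r)}"
    by (rule eventually_conj)
  then obtain l where l: "l < exp (- r)" "\<And>a. l < a \<Longrightarrow> a < exp (- r) \<Longrightarrow> tilt_score m om q a < h \<and> 0 < a"
    by (subst (asm) eventually_at_left[of "exp (- r) - 1"]) auto
  obtain a where a: "a \<in> \<rat>" "l < a" "a < exp (- r)" using Rats_dense_in_real[OF l(1)] by auto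
  obtain b where b: "b \<in> \<rat>" "exp r < b" using Rats_dense_in_real[of "exp r" "exp r + 1"] by auto
  have "h < tilt_score m om q b" using sc(2) tilt_score_mono(1)[of m om q "exp r" b, OF om q] b by force
  moreover have "tilt_score m om q a < h" "0 < a" using l(2)[of a] a by auto
  ultimately have "\<exists>a\<in>\<rat>. \<exists>b\<in>\<rat>. 0 < a \<and> a < b \<and> tilt_score m om q a < h \<and> h < tilt_score m om q b"
    using a b mono[of a b] by (meson less_trans exp_gt_zero)
  then show "\<exists>!x. 0 < x \<and> tilt_score m om q x = h"
    using tilt_score_unique_root_iff[of m om q h, OF om q] by blast
qed

text \<open>\<open>M\<close> is a peak known up to the cubic error. After multiplication by \<open>2 N\<close> its main part is
\<open>(\<surd>N a)\<^sup>2 / b\<close> and the error is of the order of \<open>(\<surd>N \<bar>a\<bar> + 1)\<^sup>3 / \<surd>N\<close>. The assumption that products of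
\<open>x\<close> with null functions are null expresses that \<open>x\<close> is bounded in probability, if the limits are limits in
probability; the summand \<open>1 / \<surd>N\<close> in \<open>r\<close> keeps the radius positive.\<close>

lemma quadratic_max_tendsto:
  fixes F :: "'p filter" and N a b x :: "'p \<Rightarrow> real"
  assumes N: "filterlim N at_top F"
    and y: "((\<lambda>p. sqrt (N p) * a p - \<kappa> * x p) \<longlongrightarrow> 0) F"
    and b: "(b \<longlongrightarrow> \<beta>) F" "0 < \<beta>"
    and mult: "\<And>f. (f \<longlongrightarrow> 0) F \<Longrightarrow> ((\<lambda>p. x p * f p) \<longlongrightarrow> 0) F"
    and r: "\<And>p. r p = 4 * (\<bar>a p\<bar> + 1 / sqrt (N p)) / b p"
  shows "(r \<longlongrightarrow> 0) F"
    and "\<And>M. \<forall>\<^sub>F p in F. \<bar>M p - (a p)\<^sup>2 / (2 * b p)\<bar> \<le> C * r p ^ 3 \<Longrightarrow>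
      ((\<lambda>p. 2 * N p * M p - \<kappa>\<^sup>2 * (x p)\<^sup>2 / \<beta>) \<longlongrightarrow> 0) F"
proof -
  define o' where "o' = (\<lambda>p. sqrt (N p) * a p - \<kappa> * x p)"
  define y where "y = (\<lambda>p. sqrt (N p) * a p)"
  define s where "s = (\<lambda>p. 1 / sqrt (N p))"
  have o': "(o' \<longlongrightarrow> 0) F" using assms(2) by (simp add: o'_def)
  have y_eq: "y p = \<kappa> * x p + o' p" for p by (simp add: y_def o'_def)
  have Npos: "\<forall>\<^sub>F p in F. 0 < N p" using N filterlim_at_top_dense by blast
  have s: "(s \<longlongrightarrow> 0) F"
    unfolding s_def by (intro tendsto_divide_0[OF tendsto_const] filterlim_at_top_imp_at_infinity
        filterlim_compose[OF sqrt_at_top N])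
  have ymult: "((\<lambda>p. y p * f p) \<longlongrightarrow> 0) F" if "(f \<longlongrightarrow> 0) F" for f
    using tendsto_add[OF tendsto_mult_left[OF mult[OF that], of \<kappa>] tendsto_mult[OF o' that]]
    by (simp add: y_eq algebra_simps)
  have zmult: "((\<lambda>p. (\<bar>y p\<bar> + 1) * f p) \<longlongrightarrow> 0) F" if "(f \<longlongrightarrow> 0) F" for f
  proof -
    have "((\<lambda>p. \<bar>y p\<bar> * f p) \<longlongrightarrow> 0) F"
    proof (rule tendsto_rabs_zero_cancel)
      show "((\<lambda>p. \<bar>\<bar>y p\<bar> * f p\<bar>) \<longlongrightarrow> 0) F"
        using tendsto_rabs_zero[OF ymult[OF that]] by (simp add: abs_mult)
    qed
    from tendsto_add[OF this that] show ?thesis by (simp add: algebra_simps)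
  qed
  have r_eq: "\<forall>\<^sub>F p in F. r p = 4 * ((\<bar>y p\<bar> + 1) * s p) / b p"
    using Npos by eventually_elim (simp add: r y_def s_def abs_mult field_simps)
  have "((\<lambda>p. 4 * ((\<bar>y p\<bar> + 1) * s p) / b p) \<longlongrightarrow> 4 * 0 / \<beta>) F"
    using b by (intro tendsto_intros zmult s) auto
  then show "(r \<longlongrightarrow> 0) F" using r_eq by (subst tendsto_cong[OF r_eq]) simp
  fix M assume M: "\<forall>\<^sub>F p in F. \<bar>M p - (a p)\<^sup>2 / (2 * b p)\<bar> \<le> C * r p ^ 3"
  have bpos: "\<forall>\<^sub>F p in F. 0 < b p" using b by (rule order_tendstoD(1))
  let ?z = "\<lambda>p. \<bar>y p\<bar> + 1"
  have lim3: "((\<lambda>p. 128 * C * (?z p * (?z p * (?z p * s p))) / b p ^ 3) \<longlongrightarrow> 128 * C * 0 / \<beta> ^ 3) F"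
    using b by (intro tendsto_intros zmult s) auto
  have "\<forall>\<^sub>F p in F. norm (2 * N p * (M p - (a p)\<^sup>2 / (2 * b p)))
      \<le> 128 * C * (?z p * (?z p * (?z p * s p))) / b p ^ 3"
    using M r_eq Npos bpos
  proof eventually_elim
    case (elim p)
    have "N p * s p ^ 2 = 1" using elim(3) by (simp add: s_def power_divide)
    then have Ns: "N p * s p ^ 3 = s p" by (metis mult.assoc mult_1 power2_eq_square power3_eq_cube)
    have "norm (2 * N p * (M p - (a p)\<^sup>2 / (2 * b p))) = 2 * N p * \<bar>M p - (a p)\<^sup>2 / (2 * b p)\<bar>"
      using elim by (simp add: abs_mult)
    also have "\<dots> \<le> 2 * N p * (C * r p ^ 3)" using elim by (intro mult_left_mono) auto
    also have "\<dots> = 128 * C * ?z p ^ 3 * (N p * s p ^ 3) / b p ^ 3"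
      unfolding elim(2) by (simp add: power_mult_distrib power_divide)
    also have "\<dots> = 128 * C * (?z p * (?z p * (?z p * s p))) / b p ^ 3"
      unfolding Ns by (simp add: power3_eq_cube mult.assoc)
    finally show ?case .
  qed
  then have 1: "((\<lambda>p. 2 * N p * (M p - (a p)\<^sup>2 / (2 * b p))) \<longlongrightarrow> 0) F"
    by (rule Lim_null_comparison) (use lim3 in simp)
  have "((\<lambda>p. 1 / b p - 1 / \<beta>) \<longlongrightarrow> 1 / \<beta> - 1 / \<beta>) F" using b by (intro tendsto_intros) auto
  then have 2: "((\<lambda>p. y p * (y p * (1 / b p - 1 / \<beta>))) \<longlongrightarrow> 0) F" by (intro ymult) simp
  have 3: "((\<lambda>p. (y p * o' p + \<kappa> * (x p * o' p)) / \<beta>) \<longlongrightarrow> (0 + \<kappa> * 0) / \<beta>) F"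
    using b by (intro tendsto_intros ymult mult o') auto
  have "\<forall>\<^sub>F p in F. 2 * N p * (M p - (a p)\<^sup>2 / (2 * b p)) + y p * (y p * (1 / b p - 1 / \<beta>))
      + (y p * o' p + \<kappa> * (x p * o' p)) / \<beta> = 2 * N p * M p - \<kappa>\<^sup>2 * (x p)\<^sup>2 / \<beta>"
    using Npos bpos
  proof eventually_elim
    case (elim p)
    have "(y p)\<^sup>2 = N p * (a p)\<^sup>2" using elim by (simp add: y_def power_mult_distrib)
    then have "2 * N p * (M p - (a p)\<^sup>2 / (2 * b p)) = 2 * N p * M p - (y p)\<^sup>2 / b p"
      by (simp add: right_diff_distrib)
    moreover have "y p * (y p * (1 / b p - 1 / \<beta>)) = (y p)\<^sup>2 / b p - (y p)\<^sup>2 / \<beta>"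
      by (simp add: power2_eq_square right_diff_distrib)
    moreover have "y p * o' p + \<kappa> * (x p * o' p) = (y p)\<^sup>2 - \<kappa>\<^sup>2 * (x p)\<^sup>2"
      unfolding y_eq by (simp add: power2_eq_square algebra_simps)
    ultimately show ?case by (simp add: diff_divide_distrib)
  qed
  from tendsto_cong[OF this] show "((\<lambda>p. 2 * N p * M p - \<kappa>\<^sup>2 * (x p)\<^sup>2 / \<beta>) \<longlongrightarrow> 0) F"
    using tendsto_add[OF tendsto_add[OF 1 2] 3] by simp
qed


text \<open>The value of \<open>-2 ln r\<close> given by duality; \<open>s\<close> is the total pooled mass and \<open>x\<close> the estimator divided by
\<open>\<theta>0\<close>.\<close>

definition EL_dual_statistic ::
  "real \<Rightarrow> real \<Rightarrow> real \<Rightarrow> nat \<Rightarrow> (nat \<Rightarrow> real) \<Rightarrow> (nat \<Rightarrow> real) \<Rightarrow> real \<Rightarrow> real \<Rightarrow> ereal" where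
  "EL_dual_statistic \<rho>0 \<rho>1 N m om q s x =
    (if m = 0 then \<infinity> else
      ereal (2 * N * (s * ln s + \<rho>1 * ln x - (\<Sum>i<m. om i * ln (1 + q i * (x - 1)))))
      + ereal (2 * N) * (SUP \<tau>\<in>EL_dom m (\<lambda>i. (q i - \<rho>1) / (\<rho>0 * \<rho>1)).
          ereal (EL_gain m om (\<lambda>i. (q i - \<rho>1) / (\<rho>0 * \<rho>1)) \<tau>)))"

text \<open>The sums \<open>A1\<close> and \<open>A2\<close> are first and second moments of the \<open>q\<^sub>i\<close>, and \<open>x\<close> is the normalized score at \<open>\<theta>0\<close>.
The slope and curvature at 0 are \<open>a1\<close> and \<open>b1\<close> for the dual objective, \<open>a2\<close> and \<open>b2\<close> for the function
of the estimator; both slopes are multiples of \<open>x / \<surd>N\<close> up to the mass defects. The two summands of \<open>c\<close>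
are the squared factors of \<open>x\<close> divided by the limits of the curvatures.\<close>

lemma EL_limit:
  fixes F :: "'p filter" and m :: "'p \<Rightarrow> nat" and om q :: "'p \<Rightarrow> nat \<Rightarrow> real"
    and N g xr x :: "'p \<Rightarrow> real" and \<rho>0 \<rho>1 lam :: real
  assumes rho: "0 < \<rho>0" "0 < \<rho>1" "\<rho>0 + \<rho>1 = 1"
    and om: "\<And>p i. i < m p \<Longrightarrow> 0 < om p i" and s1: "\<And>p. s p \<le> 1"
    and q: "\<And>p i. i < m p \<Longrightarrow> 0 \<le> q p i" "\<And>p i. i < m p \<Longrightarrow> q p i < 1"
    and s: "\<And>p. s p = (\<Sum>i<m p. om p i)" and A1: "\<And>p. A1 p = (\<Sum>i<m p. om p i * q p i)"
    and A2: "\<And>p. A2 p = (\<Sum>i<m p. om p i * (q p i)\<^sup>2)"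
    and x: "\<And>p. x p = sqrt (N p) * ((A1 p - \<rho>1 * g p) / (\<rho>0 * \<rho>1))"
    and N: "filterlim N at_top F"
    and mult: "\<And>f. (f \<longlongrightarrow> 0) F \<Longrightarrow> ((\<lambda>p. x p * f p) \<longlongrightarrow> 0) F"
    and lims: "(A1 \<longlongrightarrow> \<rho>1) F" "(A2 \<longlongrightarrow> lam) F" "\<rho>1\<^sup>2 < lam" "lam < \<rho>1"
    and mass: "((\<lambda>p. N p * (1 - s p)) \<longlongrightarrow> 0) F" "((\<lambda>p. N p * (1 - g p)) \<longlongrightarrow> 0) F"
    and root: "\<And>p. \<exists>!y. 0 < y \<and> tilt_score (m p) (om p) (q p) y = \<rho>1 * g p \<Longrightarrow>
      0 < xr p \<and> tilt_score (m p) (om p) (q p) (xr p) = \<rho>1 * g p"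
    and Z: "\<And>p. Z p = EL_dual_statistic \<rho>0 \<rho>1 (N p) (m p) (om p) (q p) (s p) (xr p)"
    and c: "c = (\<rho>0 * \<rho>1)\<^sup>2 * (1 / (lam - \<rho>1\<^sup>2) + 1 / (\<rho>1 - lam))"
  shows "\<forall>\<^sub>F p in F. \<bar>Z p\<bar> \<noteq> \<infinity>" and "((\<lambda>p. real_of_ereal (Z p) - c * (x p)\<^sup>2) \<longlongrightarrow> 0) F"
proof -
  define R where "R = \<rho>0 * \<rho>1"
  have R: "0 < R" using rho by (simp add: R_def)
  define \<phi> where "\<phi> = (\<lambda>p i. (q p i - \<rho>1) / R)"
  define SU where "SU = (\<lambda>p. SUP \<tau>\<in>EL_dom (m p) (\<phi> p). ereal (EL_gain (m p) (om p) (\<phi> p) \<tau>))"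
  define a1 where "a1 = (\<lambda>p. (A1 p - \<rho>1 * s p) / R)"
  define b1 where "b1 = (\<lambda>p. (A2 p - 2 * \<rho>1 * A1 p + \<rho>1\<^sup>2 * s p) / R\<^sup>2)"
  define a2 where "a2 = (\<lambda>p. \<rho>1 * g p - A1 p)"
  define b2 where "b2 = (\<lambda>p. A1 p - A2 p)"
  have a1_eq: "(\<Sum>i<m p. om p i * \<phi> p i) = a1 p" for p
    unfolding a1_def A1 s \<phi>_def
    by (simp add: right_diff_distrib sum_subtractf sum_divide_distrib[symmetric] sum_distrib_left mult.commute)
  have b1_eq: "(\<Sum>i<m p. om p i * (\<phi> p i)\<^sup>2) = b1 p" for p
  proof -
    have "(\<Sum>i<m p. om p i * (\<phi> p i)\<^sup>2)
        = (\<Sum>i<m p. om p i * (q p i)\<^sup>2 - 2 * \<rho>1 * (om p i * q p i) + \<rho>1\<^sup>2 * om p i) / R\<^sup>2"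
      unfolding \<phi>_def sum_divide_distrib
      by (intro sum.cong refl) (simp add: power_divide power2_diff algebra_simps)
    then show ?thesis
      unfolding b1_def A1 A2 s by (simp add: sum.distrib sum_subtractf sum_distrib_left)
  qed
  define r1 where "r1 = (\<lambda>p. 4 * (\<bar>a1 p\<bar> + 1 / sqrt (N p)) / b1 p)"
  define r2 where "r2 = (\<lambda>p. 4 * (\<bar>a2 p\<bar> + 1 / sqrt (N p)) / b2 p)"
  have Npos: "\<forall>\<^sub>F p in F. 1 < N p" using N filterlim_at_top_dense by blast
  have Ninv: "((\<lambda>p. 1 / N p) \<longlongrightarrow> 0) F"
    by (intro tendsto_divide_0[OF tendsto_const] filterlim_at_top_imp_at_infinity N)
  have mass1: "((\<lambda>p. 1 - s p) \<longlongrightarrow> 0) F" "((\<lambda>p. 1 - g p) \<longlongrightarrow> 0) F"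
  proof -
    have "\<forall>\<^sub>F p in F. 1 / N p * (N p * u p) = u p" for u :: "'p \<Rightarrow> real"
      using Npos by eventually_elim simp
    from tendsto_cong[OF this[of "\<lambda>p. 1 - s p"]] tendsto_cong[OF this[of "\<lambda>p. 1 - g p"]]
    show "((\<lambda>p. 1 - s p) \<longlongrightarrow> 0) F" "((\<lambda>p. 1 - g p) \<longlongrightarrow> 0) F"
      using tendsto_mult[OF Ninv mass(1)] tendsto_mult[OF Ninv mass(2)] by simp_all
  qed
  have sqrtmass: "((\<lambda>p. sqrt (N p) * u p) \<longlongrightarrow> 0) F" if "((\<lambda>p. N p * u p) \<longlongrightarrow> 0) F" for u
  proof (rule Lim_null_comparison)
    show "\<forall>\<^sub>F p in F. norm (sqrt (N p) * u p) \<le> \<bar>N p * u p\<bar>"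
      using Npos
    proof eventually_elim
      case (elim p)
      then have "sqrt (N p) \<le> sqrt (N p * N p)" by (intro real_sqrt_le_mono) simp
      then have "sqrt (N p) \<le> N p" using elim by simp
      then show ?case using elim by (simp add: abs_mult mult_right_mono)
    qed
  qed (use tendsto_rabs_zero[OF that] in simp)
  have slim: "(s \<longlongrightarrow> 1) F" using tendsto_diff[OF tendsto_const[of 1] mass1(1)] by simp
  have "((\<lambda>p. \<rho>1 / R * (sqrt (N p) * (1 - s p)) - \<rho>1 / R * (sqrt (N p) * (1 - g p))) \<longlongrightarrow> \<rho>1 / R * 0 - \<rho>1 / R * 0) F"
    by (intro tendsto_intros sqrtmass mass)
  moreover have "\<rho>1 / R * (sqrt (N p) * (1 - s p)) - \<rho>1 / R * (sqrt (N p) * (1 - g p)) = sqrt (N p) * a1 p - 1 * x p" for p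
    unfolding a1_def x R_def[symmetric] using R by (simp add: field_simps)
  ultimately have y1: "((\<lambda>p. sqrt (N p) * a1 p - 1 * x p) \<longlongrightarrow> 0) F" by simp
  have y2: "((\<lambda>p. sqrt (N p) * a2 p - (- R) * x p) \<longlongrightarrow> 0) F"
    unfolding a2_def x R_def[symmetric] using R by (simp add: field_simps)
  have b1lim: "(b1 \<longlongrightarrow> (lam - 2 * \<rho>1 * \<rho>1 + \<rho>1\<^sup>2 * 1) / R\<^sup>2) F"
    unfolding b1_def using R by (intro tendsto_intros lims slim) auto
  then have b1lim: "(b1 \<longlongrightarrow> (lam - \<rho>1\<^sup>2) / R\<^sup>2) F" by (simp add: power2_eq_square)
  have b1pos: "0 < (lam - \<rho>1\<^sup>2) / R\<^sup>2" using R lims by simp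
  have b2lim: "(b2 \<longlongrightarrow> \<rho>1 - lam) F" unfolding b2_def by (intro tendsto_intros lims)
  have b2pos: "0 < \<rho>1 - lam" using lims by simp
  have r1_eq: "r1 p = 4 * (\<bar>a1 p\<bar> + 1 / sqrt (N p)) / b1 p" for p by (simp add: r1_def)
  have r2_eq: "r2 p = 4 * (\<bar>a2 p\<bar> + 1 / sqrt (N p)) / b2 p" for p by (simp add: r2_def)
  have r1lim: "(r1 \<longlongrightarrow> 0) F"
    by (rule quadratic_max_tendsto(1)[where x=x]) (fact N y1 b1lim b1pos mult r1_eq)+
  have r2lim: "(r2 \<longlongrightarrow> 0) F"
    by (rule quadratic_max_tendsto(1)[where x=x]) (fact N y2 b2lim b2pos mult r2_eq)+
  \<comment> \<open>\<open>K\<close> bounds the \<open>\<phi>\<^sub>i\<close>, and the cubic approximation of the dual objective holds for \<open>\<bar>\<tau>\<bar> \<le> 1 / (2 K)\<close>.\<close>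
  define K where "K = 1 / R"
  have K: "0 < K" using R by (simp add: K_def)
  define C where "C = 3 * K ^ 3"
  have C: "0 < C" using K by (simp add: C_def)
  have \<phi>K: "\<bar>\<phi> p i\<bar> \<le> K" if "i < m p" for p i
  proof -
    have "\<bar>q p i - \<rho>1\<bar> \<le> 1" using q(1)[OF that] q(2)[OF that] rho by (auto simp: abs_le_iff)
    then show ?thesis unfolding \<phi>_def K_def using R by (simp add: abs_divide divide_right_mono)
  qed
  have small: "\<forall>\<^sub>F p in F. 0 < r p \<and> r p \<le> \<delta> \<and> 4 * \<bar>a p\<bar> \<le> b p * r p \<and> C * r p < b p / 4 \<and> 0 < b p"
    if r: "(r \<longlongrightarrow> 0) F" "\<And>p. r p = 4 * (\<bar>a p\<bar> + 1 / sqrt (N p)) / b p" and b: "(b \<longlongrightarrow> \<beta>) F" "0 < \<beta>" and "0 < \<delta>" for r a b \<beta> \<delta> and C :: real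
  proof -
    have "((\<lambda>p. b p / 4 - C * r p) \<longlongrightarrow> \<beta> / 4 - C * 0) F" by (intro tendsto_intros r b) auto
    then have "\<forall>\<^sub>F p in F. 0 < b p / 4 - C * r p" by (rule order_tendstoD(1)) (use b in simp)
    moreover have "\<forall>\<^sub>F p in F. 0 < b p" using b by (rule order_tendstoD(1))
    moreover have "\<forall>\<^sub>F p in F. r p < \<delta>" using r(1) \<open>0 < \<delta>\<close> by (rule order_tendstoD(2))
    ultimately show ?thesis using Npos
    proof eventually_elim
      case (elim p)
      have "0 < \<bar>a p\<bar> + 1 / sqrt (N p)" using elim by (intro add_nonneg_pos) auto
      moreover have "b p * r p = 4 * (\<bar>a p\<bar> + 1 / sqrt (N p))" using elim by (simp add: r(2))
      ultimately show ?case using elim by (auto simp: r(2))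
    qed
  qed
  have E1: "\<forall>\<^sub>F p in F. \<bar>SU p\<bar> \<noteq> \<infinity> \<and> \<bar>real_of_ereal (SU p) - (a1 p)\<^sup>2 / (2 * b1 p)\<bar> \<le> C * r1 p ^ 3"
    using small[OF r1lim r1_eq b1lim b1pos, of "1 / (2 * K)" C, OF divide_pos_pos[OF zero_less_one mult_pos_pos[OF zero_less_numeral K]]]
  proof (eventually_elim)
    case (elim p)
    then have el: "0 < r1 p" "r1 p \<le> 1 / (2 * K)" "4 * \<bar>a1 p\<bar> \<le> b1 p * r1 p" "C * r1 p < b1 p / 4" "0 < b1 p" by auto
    have C0: "0 \<le> C" using C by simp
    let ?g = "EL_gain (m p) (om p) (\<phi> p)" and ?I = "EL_dom (m p) (\<phi> p)"
    have st: "l * ?g \<tau> \<le> ?g (l * \<tau>)" if "\<tau> \<in> ?I" "0 \<le> l" "l \<le> 1" for \<tau> l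
      using EL_gain_star[of "m p" "om p" \<tau> "\<phi> p" l] om that by blast
    have ap: "\<tau> \<in> ?I" "\<bar>?g \<tau> - (a1 p * \<tau> - b1 p * \<tau>\<^sup>2 / 2)\<bar> \<le> C * \<bar>\<tau>\<bar> ^ 3" if "\<bar>\<tau>\<bar> \<le> 1 / (2 * K)" for \<tau>
      using EL_gain_approx[of "m p" "om p" K "\<phi> p" \<tau>] om s1[of p] s[of p] K \<phi>K that
      unfolding a1_eq b1_eq C_def by auto
    have con2: "?g \<tau> \<le> (a1 p)\<^sup>2 / (2 * b1 p) + C * r1 p ^ 3" if "\<tau> \<in> ?I" for \<tau>
      by (rule concave_max_of_quadratic_approx(2)[where I="?I" and g="?g"]) (fact st ap(2) el C0 that)+
    have con3: "\<bar>a1 p / b1 p\<bar> \<le> r1 p"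
      by (rule concave_max_of_quadratic_approx(3)[where I="?I" and g="?g"]) (fact st ap(2) el C0)+
    have con4: "(a1 p)\<^sup>2 / (2 * b1 p) - C * r1 p ^ 3 \<le> ?g (a1 p / b1 p)"
      by (rule concave_max_of_quadratic_approx(4)[where I="?I" and g="?g"]) (fact st ap(2) el C0)+
    have up: "SU p \<le> ereal ((a1 p)\<^sup>2 / (2 * b1 p) + C * r1 p ^ 3)"
      unfolding SU_def by (rule SUP_least) (use con2 in simp)
    have lo: "ereal ((a1 p)\<^sup>2 / (2 * b1 p) - C * r1 p ^ 3) \<le> SU p"
      unfolding SU_def using ap(1)[of "a1 p / b1 p"] con3 con4 el by (intro SUP_upper2[of "a1 p / b1 p"]) auto
    from up lo show ?case by (cases "SU p") (auto simp: abs_le_iff)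
  qed
  define B where "B p = tilt_gain (m p) (om p) (q p) (\<rho>1 * g p) (ln (xr p))" for p
  have E2: "\<forall>\<^sub>F p in F. 0 < xr p \<and> \<bar>ln (xr p)\<bar> \<le> r2 p \<and> \<bar>B p - (a2 p)\<^sup>2 / (2 * b2 p)\<bar> \<le> 1 * r2 p ^ 3"
    using small[OF r2lim r2_eq b2lim b2pos zero_less_one, of 1]
  proof (eventually_elim)
    case (elim p)
    then have el: "0 < r2 p" "r2 p \<le> 1" "4 * \<bar>a2 p\<bar> \<le> b2 p * r2 p" "1 * r2 p < b2 p / 4" "0 < b2 p" by auto
    have C0: "0 \<le> (1::real)" by simp
    let ?g = "tilt_gain (m p) (om p) (q p) (\<rho>1 * g p)"
    have st: "l * ?g \<tau> \<le> ?g (l * \<tau>)" if "\<tau> \<in> UNIV" "0 \<le> l" "l \<le> 1" for \<tau> l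
      using tilt_gain_star[of "m p" "om p" "q p" l "\<rho>1 * g p" \<tau>] om q that by blast
    have ap: "\<bar>?g \<tau> - (a2 p * \<tau> - b2 p * \<tau>\<^sup>2 / 2)\<bar> \<le> 1 * \<bar>\<tau>\<bar> ^ 3" if "\<bar>\<tau>\<bar> \<le> 1" for \<tau>
      using tilt_gain_approx[of "m p" "om p" "q p" "\<rho>1 * g p" \<tau>] om s1[of p] s[of p] q
      unfolding a2_def b2_def A1 A2 by auto
    have neg: "?g \<tau> < 0" if "r2 p \<le> \<bar>\<tau>\<bar>" for \<tau>
      by (rule concave_max_of_quadratic_approx(1)[where I=UNIV and g="?g"]) (fact st ap el C0 that UNIV_I)+
    have "\<exists>!y. 0 < y \<and> tilt_score (m p) (om p) (q p) y = \<rho>1 * g p"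
      by (rule tilt_root_near_one(1)) (fact om q el(1) neg)+
    then have xr: "0 < xr p" "tilt_score (m p) (om p) (q p) (xr p) = \<rho>1 * g p" using root by auto
    have near: "\<bar>ln (xr p)\<bar> \<le> r2 p"
      by (rule tilt_root_near_one(2)[where m="m p" and om="om p" and q="q p" and h="\<rho>1 * g p"])
        (fact om q el(1) neg xr)+
    have "B p \<le> (a2 p)\<^sup>2 / (2 * b2 p) + 1 * r2 p ^ 3" unfolding B_def
      by (rule concave_max_of_quadratic_approx(2)[where I=UNIV and g="?g"]) (fact st ap el C0 UNIV_I)+
    moreover have "(a2 p)\<^sup>2 / (2 * b2 p) - 1 * r2 p ^ 3 \<le> ?g (a2 p / b2 p)"
      by (rule concave_max_of_quadratic_approx(4)[where I=UNIV and g="?g"]) (fact st ap el C0)+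
    moreover have "?g (a2 p / b2 p) \<le> B p" unfolding B_def
      by (rule tilt_root_near_one(3)) (fact om q el(1) neg xr)+
    ultimately show ?case using xr near by (auto simp: abs_le_iff)
  qed
  have L1: "((\<lambda>p. 2 * N p * real_of_ereal (SU p) - 1\<^sup>2 * (x p)\<^sup>2 / ((lam - \<rho>1\<^sup>2) / R\<^sup>2)) \<longlongrightarrow> 0) F"
  proof (rule quadratic_max_tendsto(2)[where x=x])
    show "\<forall>\<^sub>F p in F. \<bar>real_of_ereal (SU p) - (a1 p)\<^sup>2 / (2 * b1 p)\<bar> \<le> C * r1 p ^ 3"
      using E1 by eventually_elim auto
  qed (fact N y1 b1lim b1pos mult r1_eq)+
  have L2: "((\<lambda>p. 2 * N p * B p - (- R)\<^sup>2 * (x p)\<^sup>2 / (\<rho>1 - lam)) \<longlongrightarrow> 0) F"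
  proof (rule quadratic_max_tendsto(2)[where x=x])
    show "\<forall>\<^sub>F p in F. \<bar>B p - (a2 p)\<^sup>2 / (2 * b2 p)\<bar> \<le> 1 * r2 p ^ 3"
      using E2 by eventually_elim auto
  qed (fact N y2 b2lim b2pos mult r2_eq)+
  have lnx: "((\<lambda>p. ln (xr p)) \<longlongrightarrow> 0) F"
    by (rule Lim_null_comparison[OF _ r2lim]) (use E2 in eventually_elim, auto)
  have spos: "\<forall>\<^sub>F p in F. 0 < s p" using slim by (rule order_tendstoD(1)) simp
  have L3: "((\<lambda>p. N p * (s p * ln (s p))) \<longlongrightarrow> 0) F"
  proof (rule Lim_null_comparison[OF _ mass(1)])
    show "\<forall>\<^sub>F p in F. norm (N p * (s p * ln (s p))) \<le> N p * (1 - s p)"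
      using spos Npos
    proof eventually_elim
      case (elim p)
      have "- ln (s p) \<le> 1 / s p - 1" using ln_le_minus_one[of "1 / s p"] elim by (simp add: ln_div)
      then have "s p * - ln (s p) \<le> s p * (1 / s p - 1)" using elim by (intro mult_left_mono) auto
      then have "- (s p * ln (s p)) \<le> 1 - s p" using elim by (simp add: right_diff_distrib)
      moreover have "s p * ln (s p) \<le> 0" using elim s1[of p] by (intro mult_nonneg_nonpos) auto
      ultimately have "\<bar>s p * ln (s p)\<bar> \<le> 1 - s p" by simp
      then show ?case using elim by (simp add: abs_mult mult_left_mono)
    qed
  qed
  \<comment> \<open>The four parts of the statistic: both peaks, the entropy of the total mass, and the mass defect of the second sample.\<close>
  have sumL: "((\<lambda>p. (2 * N p * real_of_ereal (SU p) - 1\<^sup>2 * (x p)\<^sup>2 / ((lam - \<rho>1\<^sup>2) / R\<^sup>2))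
      + (2 * N p * B p - (- R)\<^sup>2 * (x p)\<^sup>2 / (\<rho>1 - lam)) + 2 * (N p * (s p * ln (s p)))
      + 2 * \<rho>1 * ((N p * (1 - g p)) * ln (xr p))) \<longlongrightarrow> 0 + 0 + 2 * 0 + 2 * \<rho>1 * (0 * 0)) F"
    by (intro tendsto_intros L1 L2 L3 lnx mass)
  have Zeq: "\<forall>\<^sub>F p in F. Z p = ereal (2 * N p * (s p * ln (s p)) + 2 * N p * B p
      + 2 * \<rho>1 * ((N p * (1 - g p)) * ln (xr p)) + 2 * N p * real_of_ereal (SU p))"
    using E1 E2 spos
  proof eventually_elim
    case (elim p)
    have m0: "m p \<noteq> 0" using elim(3) s[of p] by (cases "m p") auto
    obtain S where S: "SU p = ereal S" using elim by (cases "SU p") auto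
    define T where "T = (\<Sum>i<m p. om p i * ln (1 + q p i * (xr p - 1)))"
    have B: "B p = \<rho>1 * g p * ln (xr p) - T"
      unfolding B_def tilt_gain_def T_def using elim by simp
    have SUP: "(SUP \<tau>\<in>EL_dom (m p) (\<lambda>i. (q p i - \<rho>1) / (\<rho>0 * \<rho>1)).
            ereal (EL_gain (m p) (om p) (\<lambda>i. (q p i - \<rho>1) / (\<rho>0 * \<rho>1)) \<tau>)) = ereal S"
      using S by (simp add: SU_def \<phi>_def R_def)
    have "Z p = ereal (2 * N p * (s p * ln (s p) + \<rho>1 * ln (xr p) - T)) + ereal (2 * N p) * ereal S"
      unfolding Z EL_dual_statistic_def SUP T_def using m0 by simp
    then show ?case unfolding S B by (simp add: algebra_simps)
  qed
  show "\<forall>\<^sub>F p in F. \<bar>Z p\<bar> \<noteq> \<infinity>" using Zeq by eventually_elim auto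
  have "\<forall>\<^sub>F p in F. real_of_ereal (Z p) - c * (x p)\<^sup>2 =
      (2 * N p * real_of_ereal (SU p) - 1\<^sup>2 * (x p)\<^sup>2 / ((lam - \<rho>1\<^sup>2) / R\<^sup>2))
      + (2 * N p * B p - (- R)\<^sup>2 * (x p)\<^sup>2 / (\<rho>1 - lam)) + 2 * (N p * (s p * ln (s p)))
      + 2 * \<rho>1 * ((N p * (1 - g p)) * ln (xr p))"
    using Zeq by eventually_elim (simp add: c R_def[symmetric] distrib_left distrib_right)
  from tendsto_cong[OF this] sumL
  show "((\<lambda>p. real_of_ereal (Z p) - c * (x p)\<^sup>2) \<longlongrightarrow> 0) F" by simp
qed

section \<open>Integrals against step distribution functions\<close>

text \<open>Both measures are finite and have the same distribution function.\<close>

lemma interval_measure_cdf: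
  assumes "finite_borel_measure N" shows "interval_measure (cdf N) = N"
proof -
  interpret finite_borel_measure N by fact
  have fin: "finite_borel_measure (interval_measure (cdf N))"
    by (rule finite_borel_measure_interval_measure[OF cdf_nondecreasing cdf_is_right_cont cdf_lim_at_bot cdf_lim_at_top])
      auto
  show ?thesis
    by (rule cdf_unique'[OF fin assms])
      (rule cdf_interval_measure[OF cdf_nondecreasing cdf_is_right_cont cdf_lim_at_bot])
qed

definition jump_set :: "(real \<Rightarrow> real) \<Rightarrow> real set" where
  "jump_set F = {x. jump F x \<noteq> 0}"

lemma jump_step:
  fixes W p :: "nat \<Rightarrow> real"
  shows "jump (\<lambda>x. \<Sum>i<m. p i * indicator {W i..} x) x = (\<Sum>i<m. if W i = x then p i else 0)"
proof -
  have "((\<lambda>x. \<Sum>i<m. p i * indicator {W i..} x) \<longlongrightarrow> (\<Sum>i<m. p i * indicator {W i<..} x)) (at_left x)"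
  proof (intro tendsto_sum tendsto_mult tendsto_const)
    fix i
    have "\<forall>\<^sub>F y in at_left x. indicator {W i..} y = (indicator {W i<..} x :: real)"
    proof (cases "W i < x")
      case True
      show ?thesis using eventually_at_left_real[OF True] by eventually_elim auto
    next
      case False
      have "x - 1 < x" by simp
      from eventually_at_left_real[OF this] show ?thesis
        by (rule eventually_mono) (use False in \<open>auto simp: indicator_def\<close>)
    qed
    then show "((\<lambda>y. indicator {W i..} y) \<longlongrightarrow> (indicator {W i<..} x :: real)) (at_left x)"
      by (rule tendsto_eventually)
  qed
  then have lim: "Lim (at_left x) (\<lambda>x. \<Sum>i<m. p i * indicator {W i..} x) = (\<Sum>i<m. p i * indicator {W i<..} x)"
    by (intro tendsto_Lim) auto
  show ?thesis
    unfolding jump_def lim sum_subtractf[symmetric]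
    by (intro sum.cong refl) (auto simp: indicator_def)
qed

text \<open>The jumps determine the step function, so its atoms and weights can be read off from it and need not be
carried along. An atom at a negative point would contradict that the function vanishes there.\<close>

lemma step_df_representation:
  assumes "step_df F"
  shows "finite (jump_set F)" "\<And>x. 0 \<le> jump F x" "\<And>x. x \<in> jump_set F \<Longrightarrow> 0 < jump F x"
    "F x = (\<Sum>a\<in>jump_set F. jump F a * indicator {a..} x)" "x \<in> jump_set F \<Longrightarrow> 0 \<le> x"
    "(\<Sum>a\<in>jump_set F. jump F a) \<le> 1"
proof -
  obtain m :: nat and W p where W: "strict_mono_on {..<m} W" and p: "\<forall>i<m. (0::real) < p i"
    and F: "F = (\<lambda>x. \<Sum>i<m. p i * indicator {W i..} x)" and sub: "sub_df F"
    using assms by (auto simp: step_df_def)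
  have inj: "inj_on W {..<m}" using W by (rule strict_mono_on_imp_inj_on)
  have J: "jump F x = (\<Sum>i<m. if W i = x then p i else 0)" for x
    unfolding F by (rule jump_step)
  have JW: "jump F (W i) = p i" if "i < m" for i
  proof -
    have "jump F (W i) = (\<Sum>j<m. if j = i then p j else 0)"
      unfolding J using inj that by (intro sum.cong) (auto simp: inj_on_def)
    then show ?thesis using that by simp
  qed
  have set: "jump_set F = W ` {..<m}"
  proof -
    have "jump F x = 0" if "x \<notin> W ` {..<m}" for x
      unfolding J using that by (intro sum.neutral) auto
    moreover have "jump F (W i) \<noteq> 0" if "i < m" for i using JW[OF that] p that by auto
    ultimately show ?thesis unfolding jump_set_def by blast
  qed
  then show "finite (jump_set F)" by simp
  show "0 \<le> jump F x" for x
    unfolding J by (rule sum_nonneg) (use p in \<open>auto intro: less_imp_le\<close>)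
  show pos: "0 < jump F x" if "x \<in> jump_set F" for x
    using that JW p unfolding set by auto
  show rep: "F x = (\<Sum>a\<in>jump_set F. jump F a * indicator {a..} x)" for x
  proof -
    have "(\<Sum>a\<in>jump_set F. jump F a * indicator {a..} x) = (\<Sum>i<m. p i * indicator {W i..} x)"
      unfolding set sum.reindex[OF inj] by (intro sum.cong) (simp_all add: JW)
    also have "\<dots> = F x" by (subst F) simp
    finally show ?thesis by simp
  qed
  show "0 \<le> x" if "x \<in> jump_set F" for x
  proof (rule ccontr)
    assume "\<not> 0 \<le> x"
    then have "F x = 0" using sub by (auto simp: sub_df_def)
    moreover have "0 < F x"
      unfolding rep[of x]
      using that pos[OF that] \<open>finite (jump_set F)\<close>
      by (intro sum_pos2[of _ x] mult_nonneg_nonneg) (auto intro: less_imp_le pos)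
    ultimately show False by simp
  qed
  define b where "b = Max (insert 0 (jump_set F))"
  have "(\<Sum>a\<in>jump_set F. jump F a) = F b"
    unfolding rep[of b]
    by (intro sum.cong refl) (simp add: indicator_def b_def \<open>finite (jump_set F)\<close>)
  also have "\<dots> \<le> 1" using sub by (simp add: sub_df_def)
  finally show "(\<Sum>a\<in>jump_set F. jump F a) \<le> 1" .
qed

lemma
  assumes "step_df F"
  shows finite_borel_measure_step_df: "finite_borel_measure (interval_measure F)"
    and cdf_step_df: "cdf (interval_measure F) = F"
    and integral_step_df: "f \<in> borel_measurable borel \<Longrightarrow>
      integral\<^sup>L (interval_measure F) f = (\<Sum>a\<in>jump_set F. jump F a * f a :: real)"
    and total_mass_step_df: "total_mass F = (\<Sum>a\<in>jump_set F. jump F a)"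
    and subprob_space_step_df: "subprob_space (interval_measure F)"
proof -
  note step = step_df_representation[OF assms]
  define N where "N = distr (point_measure (jump_set F) (jump F)) borel (\<lambda>x::real. x)"
  have int: "integral\<^sup>L N f = (\<Sum>a\<in>jump_set F. jump F a * f a :: real)" if "f \<in> borel_measurable borel" for f
    unfolding N_def using step(1,2) that
    by (subst integral_distr) (auto simp: lebesgue_integral_point_measure_finite)
  have em: "emeasure N UNIV = ennreal (\<Sum>a\<in>jump_set F. jump F a)"
    unfolding N_def using step(1,2)
    by (subst emeasure_distr) (auto simp: space_point_measure emeasure_point_measure_finite sum_ennreal)
  have N: "space N = UNIV" "sets N = sets borel" by (simp_all add: N_def)
  have fbm: "finite_borel_measure N"
    by (intro finite_borel_measure.intro finite_borel_measure_axioms.intro finite_measureI) (simp_all add: N em)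
  then interpret N: finite_borel_measure N .
  have "cdf N x = F x" for x
  proof -
    have "cdf N x = integral\<^sup>L N (indicator {..x})" by (simp add: cdf_def N)
    also have "\<dots> = (\<Sum>a\<in>jump_set F. jump F a * indicator {..x} a)" by (rule int) auto
    also have "\<dots> = F x" unfolding step(4)[of x] by (intro sum.cong) (auto split: split_indicator)
    finally show ?thesis .
  qed
  then have cdf: "cdf N = F" by auto
  from interval_measure_cdf[OF fbm] have eq: "interval_measure F = N" by (simp add: cdf)
  show "finite_borel_measure (interval_measure F)" "cdf (interval_measure F) = F"
    using fbm cdf by (simp_all add: eq)
  show "f \<in> borel_measurable borel \<Longrightarrow>
      integral\<^sup>L (interval_measure F) f = (\<Sum>a\<in>jump_set F. jump F a * f a :: real)"
    using int by (simp add: eq)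
  show "total_mass F = (\<Sum>a\<in>jump_set F. jump F a)"
    using em step(2) by (simp add: total_mass_def eq measure_def sum_nonneg)
  show "subprob_space (interval_measure F)"
  proof
    show "emeasure (interval_measure F) (space (interval_measure F)) \<le> 1"
      using step(6) by (simp add: eq N em)
    show "space (interval_measure F) \<noteq> {}" by simp
  qed
qed

lemma stieltjes_integral_step_df:
  fixes h :: "real \<Rightarrow> real"
  assumes "step_df F" "(\<lambda>x. indicator {0..} x *\<^sub>R h x) \<in> borel_measurable borel"
  shows "stieltjes_integral h F = (\<Sum>a\<in>jump_set F. jump F a * h a)"
  unfolding stieltjes_integral_def set_lebesgue_integral_def integral_step_df[OF assms]
  using step_df_representation(5)[OF assms(1)] by (intro sum.cong) auto

text \<open>The integrand may depend on the point of the sample space as well: for each point, integrate over the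
section through it, by pushing the kernel forward to the product space.\<close>

lemma integral_measurable_subprob_kernel:
  fixes f :: "'a \<Rightarrow> 'b \<Rightarrow> real"
  assumes f[measurable]: "(\<lambda>(x, y). f x y) \<in> borel_measurable (M \<Otimes>\<^sub>M N)"
    and L[measurable]: "L \<in> measurable M (subprob_algebra N)"
  shows "(\<lambda>x. integral\<^sup>L (L x) (f x)) \<in> borel_measurable M"
proof -
  note integral_measurable_subprob_algebra[measurable]
  note measurable_distr2[measurable]
  have "(\<lambda>x. integral\<^sup>L (distr (L x) (M \<Otimes>\<^sub>M N) (\<lambda>y. (x, y))) (\<lambda>(x, y). f x y)) \<in> borel_measurable M"
    by measurable
  then show "(\<lambda>x. integral\<^sup>L (L x) (f x)) \<in> borel_measurable M"
    by (rule measurable_cong[THEN iffD1, rotated]) (simp add: integral_distr)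
qed

text \<open>Half-lines generate the Borel sets, so pointwise measurability of the distribution function makes the
random measure a kernel.\<close>

lemma step_df_kernel_measurable:
  assumes step: "\<And>\<omega>. \<omega> \<in> space M \<Longrightarrow> step_df (Fh \<omega>)"
    and meas: "\<And>x. (\<lambda>\<omega>. Fh \<omega> x) \<in> borel_measurable M"
  shows "(\<lambda>\<omega>. interval_measure (Fh \<omega>)) \<in> measurable M (subprob_algebra borel)"
proof (rule measurable_subprob_algebra_generated)
  show "sets (borel :: real measure) = sigma_sets UNIV (range (\<lambda>a. {..a}))"
    by (subst borel_eq_atMost) simp
  show "Int_stable (range (\<lambda>a::real. {..a}))" by (auto simp: Int_stable_def)
  show "subprob_space (interval_measure (Fh \<omega>))" if "\<omega> \<in> space M" for \<omega>
    by (rule subprob_space_step_df[OF step[OF that]])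
  have emeas: "emeasure (interval_measure (Fh \<omega>)) {..x} = ennreal (Fh \<omega> x)" if "\<omega> \<in> space M" for \<omega> x
  proof -
    interpret finite_borel_measure "interval_measure (Fh \<omega>)"
      by (rule finite_borel_measure_step_df[OF step[OF that]])
    show ?thesis using cdf_step_df[OF step[OF that]] by (metis cdf_def emeasure_eq_measure)
  qed
  have "(\<lambda>\<omega>. emeasure (interval_measure (Fh \<omega>)) {..x}) \<in> borel_measurable M" for x
    by (subst measurable_cong[OF emeas]) (use meas in auto)
  then show "\<And>A. A \<in> range (\<lambda>a. {..a}) \<Longrightarrow> (\<lambda>\<omega>. emeasure (interval_measure (Fh \<omega>)) A) \<in> borel_measurable M"
    by auto
  have "(\<lambda>k. ennreal (Fh \<omega> (real k))) \<longlonglongrightarrow> emeasure (interval_measure (Fh \<omega>)) UNIV" if "\<omega> \<in> space M" for \<omega>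
  proof -
    interpret finite_borel_measure "interval_measure (Fh \<omega>)"
      by (rule finite_borel_measure_step_df[OF step[OF that]])
    show ?thesis using cdf_lim_infty unfolding cdf_step_df[OF step[OF that]]
      by (simp add: emeasure_eq_measure tendsto_ennrealI)
  qed
  then show "(\<lambda>\<omega>. emeasure (interval_measure (Fh \<omega>)) UNIV) \<in> borel_measurable M"
    by (rule borel_measurable_LIMSEQ_order) (use meas in auto)
qed auto

lemma measurable_nonneg_part_of_monotone:
  fixes w :: "real \<Rightarrow> real"
  assumes "mono_on {0..} w \<or> antimono_on {0..} w"
  shows "(\<lambda>x. indicator {0..} x *\<^sub>R w x) \<in> borel_measurable borel"
proof -
  have A: "(\<lambda>x. indicator {0..} x *\<^sub>R v x) \<in> borel_measurable borel" if "mono_on {0..} v" for v :: "real \<Rightarrow> real"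
    using borel_measurable_mono_on_fnc[OF that] by (subst (asm) borel_measurable_restrict_space_iff) auto
  show ?thesis using assms
  proof
    assume "antimono_on {0..} w"
    then have "mono_on {0..} (\<lambda>x. - w x)" by (auto simp: monotone_on_def)
    from borel_measurable_uminus[OF A[OF this]] show ?thesis by simp
  qed (rule A)
qed

section \<open>The pooled sample\<close>

locale biased_weights =
  fixes w :: "real \<Rightarrow> real" and \<rho>0 \<rho>1 \<theta>0 :: real
  assumes w_nonneg: "\<And>x. 0 \<le> x \<Longrightarrow> 0 \<le> w x"
    and w_measurable: "(\<lambda>x. indicator {0..} x *\<^sub>R w x) \<in> borel_measurable borel"
    and rho_pos: "0 < \<rho>0" "0 < \<rho>1" and rho_sum: "\<rho>0 + \<rho>1 = 1" and theta_pos: "0 < \<theta>0"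
begin

text \<open>Nothing is known about \<open>w\<close> on the negative half-line, where it may fail to be measurable; all atoms of
the estimators are nonnegative, so the change does not matter for them.\<close>

definition w_plus :: "real \<Rightarrow> real" where
  "w_plus x = (if 0 \<le> x then w x else 0)"

lemma w_plus_measurable [measurable]: "w_plus \<in> borel_measurable borel"
proof -
  have "w_plus = (\<lambda>x. indicator {0..} x *\<^sub>R w x)" by (auto simp: w_plus_def fun_eq_iff)
  then show ?thesis using w_measurable by simp
qed

lemma comp_w_measurable:
  assumes "f \<in> borel_measurable borel"
  shows "(\<lambda>x. indicator {0..} x *\<^sub>R (f (w x) :: real)) \<in> borel_measurable borel"
proof -
  have "(\<lambda>x. indicator {0..} x *\<^sub>R (f (w x) :: real)) = (\<lambda>x. indicator {0..} x *\<^sub>R f (w_plus x))"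
    by (auto simp: w_plus_def fun_eq_iff indicator_def)
  moreover have "(\<lambda>x. indicator {0..} x *\<^sub>R f (w_plus x)) \<in> borel_measurable borel"
    using assms by measurable
  ultimately show ?thesis by simp
qed

text \<open>The probability under \<open>\<theta>0\<close> that an observation from the pooled population with weight \<open>v\<close> belongs to the
second sample.\<close>

definition bias :: "real \<Rightarrow> real" where
  "bias v = \<rho>1 * \<theta>0 * v / (\<rho>0 + \<rho>1 * \<theta>0 * v)"

lemma bias_measurable [measurable]: "bias \<in> borel_measurable borel"
  unfolding bias_def by measurable

lemma denominator_pos: "0 \<le> v \<Longrightarrow> 0 < \<theta> \<Longrightarrow> 0 < \<rho>0 + \<rho>1 * \<theta> * v"
  using rho_pos by (intro add_pos_nonneg mult_nonneg_nonneg) auto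

lemma bias_range: "0 \<le> v \<Longrightarrow> 0 \<le> bias v" "0 \<le> v \<Longrightarrow> bias v < 1"
  using denominator_pos[OF _ theta_pos] rho_pos theta_pos by (auto simp: bias_def)

lemma bias_denominator:
  assumes "0 \<le> v"
  shows "1 + bias v * (\<theta> / \<theta>0 - 1) = (\<rho>0 + \<rho>1 * \<theta> * v) / (\<rho>0 + \<rho>1 * \<theta>0 * v)"
proof -
  have p: "0 < \<rho>0 + \<rho>1 * \<theta>0 * v" using denominator_pos[OF assms theta_pos] .
  have eq: "bias v * (\<theta> / \<theta>0 - 1) = \<rho>1 * v * (\<theta> - \<theta>0) / (\<rho>0 + \<rho>1 * \<theta>0 * v)"
    using theta_pos by (simp add: bias_def divide_simps)
  show ?thesis unfolding eq using p by (simp add: field_simps)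
qed

lemma tilt_bias:
  assumes "0 \<le> v" "0 < \<theta>"
  shows "tilt (bias v) (\<theta> / \<theta>0) = \<rho>1 * \<theta> * v / (\<rho>0 + \<rho>1 * \<theta> * v)"
proof -
  have p: "0 < \<rho>0 + \<rho>1 * \<theta>0 * v" using denominator_pos[OF assms(1) theta_pos] .
  have "bias v * (\<theta> / \<theta>0) = \<rho>1 * \<theta> * v / (\<rho>0 + \<rho>1 * \<theta>0 * v)"
    using theta_pos by (simp add: bias_def)
  then show ?thesis unfolding tilt_def bias_denominator[OF assms(1)] using p by simp
qed

definition pool_size :: "(real \<Rightarrow> real) \<Rightarrow> (real \<Rightarrow> real) \<Rightarrow> nat" where
  "pool_size F G = length (pooled_points F G)"

definition pool_weight :: "(real \<Rightarrow> real) \<Rightarrow> (real \<Rightarrow> real) \<Rightarrow> nat \<Rightarrow> real" where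
  "pool_weight F G i = pooled_weights \<rho>0 \<rho>1 F G ! i"

definition pool_w :: "(real \<Rightarrow> real) \<Rightarrow> (real \<Rightarrow> real) \<Rightarrow> nat \<Rightarrow> real" where
  "pool_w F G i = w (pooled_points F G ! i)"

definition pool_bias :: "(real \<Rightarrow> real) \<Rightarrow> (real \<Rightarrow> real) \<Rightarrow> nat \<Rightarrow> real" where
  "pool_bias F G i = bias (pool_w F G i)"

definition pool_mass :: "(real \<Rightarrow> real) \<Rightarrow> (real \<Rightarrow> real) \<Rightarrow> real" where
  "pool_mass F G = (\<Sum>i<pool_size F G. pool_weight F G i)"

context
  fixes F G :: "real \<Rightarrow> real"
  assumes F: "step_df F" and G: "step_df G"
begin

lemma pool_sum:
  "(\<Sum>i<pool_size F G. pool_weight F G i * f (pooled_points F G ! i))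
    = \<rho>0 * (\<Sum>a\<in>jump_set F. jump F a * f a) + \<rho>1 * (\<Sum>a\<in>jump_set G. jump G a * f a)"
proof -
  let ?x = "jump_points F" and ?y = "jump_points G"
  have jp: "set (jump_points H) = jump_set H" "distinct (jump_points H)" if "step_df H" for H
    using step_df_representation(1)[OF that] by (simp_all add: jump_points_def jump_set_def)
  let ?L = "map (\<lambda>x. \<rho>0 * jump F x * f x) ?x @ map (\<lambda>x. \<rho>1 * jump G x * f x) ?y"
  have "(\<Sum>i<pool_size F G. pool_weight F G i * f (pooled_points F G ! i)) = (\<Sum>i<length ?L. ?L ! i)"
    unfolding pool_size_def pool_weight_def pooled_points_def pooled_weights_def
    by (intro sum.cong) (auto simp: nth_append)
  also have "\<dots> = sum_list ?L" by (simp only: sum_list_sum_nth atLeast0LessThan)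
  also have "\<dots> = (\<Sum>a\<in>jump_set F. \<rho>0 * jump F a * f a) + (\<Sum>a\<in>jump_set G. \<rho>1 * jump G a * f a)"
    using jp[OF F] jp[OF G] by (simp add: sum_list_distinct_conv_sum_set)
  finally show ?thesis by (simp add: sum_distrib_left mult.assoc)
qed

lemma pool_atom:
  assumes "i < pool_size F G"
  shows "0 < pool_weight F G i" "0 \<le> pooled_points F G ! i" "0 \<le> pool_w F G i"
    "0 \<le> pool_bias F G i" "pool_bias F G i < 1"
proof -
  have jp: "set (jump_points H) = jump_set H" if "step_df H" for H
    using step_df_representation(1)[OF that] by (simp add: jump_points_def jump_set_def)
  have nth: "jump_points H ! j \<in> jump_set H" if "step_df H" "j < length (jump_points H)" for H j
    using jp[OF that(1)] nth_mem[OF that(2)] by simp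
  show "0 < pool_weight F G i"
    using assms rho_pos step_df_representation(3)[OF F nth[OF F]] step_df_representation(3)[OF G nth[OF G]]
    by (auto simp: pool_size_def pool_weight_def pooled_points_def pooled_weights_def nth_append)
  show *: "0 \<le> pooled_points F G ! i"
    using assms step_df_representation(5)[OF F nth[OF F]] step_df_representation(5)[OF G nth[OF G]]
    by (auto simp: pool_size_def pooled_points_def nth_append)
  show "0 \<le> pool_w F G i" using w_nonneg[OF *] by (simp add: pool_w_def)
  then show "0 \<le> pool_bias F G i" "pool_bias F G i < 1" by (simp_all add: pool_bias_def bias_range)
qed

lemma pool_sum_w:
  assumes "f \<in> borel_measurable borel"
  shows "(\<Sum>i<pool_size F G. pool_weight F G i * f (pool_w F G i))
    = \<rho>0 * stieltjes_integral (\<lambda>x. f (w x)) F + \<rho>1 * stieltjes_integral (\<lambda>x. f (w x)) G"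
  unfolding pool_w_def pool_sum[of "\<lambda>x. f (w x)"]
  by (simp add: stieltjes_integral_step_df[OF F comp_w_measurable[OF assms]]
      stieltjes_integral_step_df[OF G comp_w_measurable[OF assms]])

lemma pool_sum_w_plus:
  assumes "f \<in> borel_measurable borel"
  shows "(\<Sum>i<pool_size F G. pool_weight F G i * f (pool_w F G i))
    = \<rho>0 * integral\<^sup>L (interval_measure F) (\<lambda>x. f (w_plus x))
    + \<rho>1 * integral\<^sup>L (interval_measure G) (\<lambda>x. f (w_plus x))"
proof -
  have m: "(\<lambda>x. f (w_plus x)) \<in> borel_measurable borel" using assms by measurable
  show ?thesis
    unfolding pool_w_def pool_sum[of "\<lambda>x. f (w x)"] integral_step_df[OF F m] integral_step_df[OF G m]
    by (intro arg_cong2[where f="(+)"] arg_cong2[where f="(*)"] sum.cong refl)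
      (auto simp: w_plus_def step_df_representation(5)[OF F] step_df_representation(5)[OF G])
qed

lemma pool_mass_eq: "pool_mass F G = \<rho>0 * total_mass F + \<rho>1 * total_mass G"
  unfolding pool_mass_def using pool_sum[of "\<lambda>_. 1"]
  by (simp add: total_mass_step_df[OF F] total_mass_step_df[OF G])

lemma pool_mass_le_1: "pool_mass F G \<le> 1"
proof -
  have "\<rho>0 * total_mass F + \<rho>1 * total_mass G \<le> \<rho>0 * 1 + \<rho>1 * 1"
    using rho_pos step_df_representation(6)[OF F] step_df_representation(6)[OF G]
    by (intro add_mono mult_left_mono) (auto simp: total_mass_step_df[OF F] total_mass_step_df[OF G])
  then show ?thesis using rho_sum by (simp add: pool_mass_eq)
qed

lemma pool_size_eq_0_iff: "pool_size F G = 0 \<longleftrightarrow> pool_mass F G = 0"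
proof
  assume "pool_mass F G = 0"
  then show "pool_size F G = 0"
    using sum_pos[of "{..<pool_size F G}" "pool_weight F G"] pool_atom(1) by (force simp: pool_mass_def)
qed (simp add: pool_mass_def)

text \<open>Multiply the estimating equation by \<open>\<rho>0 \<rho>1\<close> and rewrite the integral against \<open>G\<close> with
\<open>\<rho>0 / D = 1 - \<rho>1 \<theta> w / D\<close>, where \<open>D = \<rho>0 + \<rho>1 \<theta> w\<close>; this produces the total mass of \<open>G\<close>.\<close>

lemma theta_equation_iff:
  assumes "0 < \<theta>"
  shows "theta_equation \<rho>0 \<rho>1 w F G \<theta> \<longleftrightarrow>
    tilt_score (pool_size F G) (pool_weight F G) (pool_bias F G) (\<theta> / \<theta>0) = \<rho>1 * total_mass G"
proof -
  let ?D = "\<lambda>v. \<rho>0 + \<rho>1 * \<theta> * v"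
  let ?a = "\<Sum>a\<in>jump_set F. jump F a * (\<theta> * w a / ?D (w a))"
  let ?b = "\<Sum>a\<in>jump_set G. jump G a * (1 / ?D (w a))"
  have "(\<lambda>v. \<theta> * v / ?D v) \<in> borel_measurable borel" "(\<lambda>v. 1 / ?D v) \<in> borel_measurable borel"
    by measurable
  then have eq: "theta_equation \<rho>0 \<rho>1 w F G \<theta> \<longleftrightarrow> ?a - ?b = 0"
    unfolding theta_equation_def
    using stieltjes_integral_step_df[OF F comp_w_measurable[of "\<lambda>v. \<theta> * v / ?D v"]]
      stieltjes_integral_step_df[OF G comp_w_measurable[of "\<lambda>v. 1 / ?D v"]]
    by simp
  have "tilt_score (pool_size F G) (pool_weight F G) (pool_bias F G) (\<theta> / \<theta>0)
      = (\<Sum>i<pool_size F G. pool_weight F G i * (\<rho>1 * \<theta> * w (pooled_points F G ! i) / ?D (w (pooled_points F G ! i))))"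
    unfolding tilt_score_def pool_bias_def
    by (intro sum.cong refl) (use pool_atom(3) assms in \<open>auto simp: tilt_bias pool_w_def\<close>)
  also have "\<dots> = \<rho>0 * (\<Sum>a\<in>jump_set F. jump F a * (\<rho>1 * \<theta> * w a / ?D (w a)))
      + \<rho>1 * (\<Sum>a\<in>jump_set G. jump G a * (\<rho>1 * \<theta> * w a / ?D (w a)))"
    by (rule pool_sum)
  also have "(\<Sum>a\<in>jump_set F. jump F a * (\<rho>1 * \<theta> * w a / ?D (w a))) = \<rho>1 * ?a"
    unfolding sum_distrib_left by (intro sum.cong refl) simp
  also have "(\<Sum>a\<in>jump_set G. jump G a * (\<rho>1 * \<theta> * w a / ?D (w a))) = total_mass G - \<rho>0 * ?b"
    unfolding total_mass_step_df[OF G] sum_distrib_left sum_subtractf[symmetric]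
  proof (intro sum.cong refl)
    fix a assume "a \<in> jump_set G"
    then have "0 < ?D (w a)"
      using step_df_representation(5)[OF G] w_nonneg assms by (intro denominator_pos) auto
    then have "\<rho>1 * \<theta> * w a / ?D (w a) = 1 - \<rho>0 / ?D (w a)" by (simp add: field_simps)
    then show "jump G a * (\<rho>1 * \<theta> * w a / ?D (w a)) = jump G a - \<rho>0 * (jump G a * (1 / ?D (w a)))"
      by (simp add: right_diff_distrib)
  qed
  finally have "tilt_score (pool_size F G) (pool_weight F G) (pool_bias F G) (\<theta> / \<theta>0)
      = \<rho>0 * \<rho>1 * (?a - ?b) + \<rho>1 * total_mass G" by (simp add: algebra_simps)
  then show ?thesis unfolding eq using rho_pos by simp
qed

definition root_ratio :: real where
  "root_ratio = theta_tilde \<rho>0 \<rho>1 w F G / \<theta>0"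

abbreviation "unique_root \<equiv> \<exists>!x. 0 < x \<and>
  tilt_score (pool_size F G) (pool_weight F G) (pool_bias F G) x = \<rho>1 * total_mass G"

lemma unique_theta_iff: "(\<exists>!\<theta>. 0 < \<theta> \<and> theta_equation \<rho>0 \<rho>1 w F G \<theta>) \<longleftrightarrow> unique_root"
proof -
  define Q where "Q x \<longleftrightarrow> 0 < x \<and>
      tilt_score (pool_size F G) (pool_weight F G) (pool_bias F G) x = \<rho>1 * total_mass G" for x
  have 1: "0 < \<theta> \<and> theta_equation \<rho>0 \<rho>1 w F G \<theta> \<longleftrightarrow> Q (\<theta> / \<theta>0)" for \<theta>
    using theta_equation_iff[of \<theta>] theta_pos unfolding Q_def by (auto simp: zero_less_divide_iff)
  have "(\<exists>!\<theta>. Q (\<theta> / \<theta>0)) \<longleftrightarrow> (\<exists>!x. Q x)"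
  proof
    assume "\<exists>!\<theta>. Q (\<theta> / \<theta>0)"
    then obtain \<theta> where \<theta>: "Q (\<theta> / \<theta>0)" "\<And>\<theta>'. Q (\<theta>' / \<theta>0) \<Longrightarrow> \<theta>' = \<theta>" by blast
    show "\<exists>!x. Q x"
    proof (rule ex1I[of _ "\<theta> / \<theta>0"])
      fix x assume "Q x"
      then have "x * \<theta>0 = \<theta>" using theta_pos by (intro \<theta>(2)) simp
      then show "x = \<theta> / \<theta>0" using theta_pos by auto
    qed (rule \<theta>(1))
  next
    assume "\<exists>!x. Q x"
    then obtain x where x: "Q x" "\<And>y. Q y \<Longrightarrow> y = x" by blast
    show "\<exists>!\<theta>. Q (\<theta> / \<theta>0)"
    proof (rule ex1I[of _ "x * \<theta>0"])
      show "Q (x * \<theta>0 / \<theta>0)" using x(1) theta_pos by simp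
      fix \<theta> assume "Q (\<theta> / \<theta>0)"
      then show "\<theta> = x * \<theta>0" using x(2)[of "\<theta> / \<theta>0"] theta_pos by auto
    qed
  qed
  then show ?thesis unfolding 1 Q_def .
qed

text \<open>If the estimating equation has no unique positive solution, \<open>theta_tilde\<close> is 1 by convention, so the
ratio is \<open>1 / \<theta>0\<close>.\<close>

lemma root_ratio_pos: "0 < root_ratio"
  and root_ratio_root: "unique_root \<Longrightarrow>
    tilt_score (pool_size F G) (pool_weight F G) (pool_bias F G) root_ratio = \<rho>1 * total_mass G"
  and root_ratio_default: "\<not> unique_root \<Longrightarrow> root_ratio = 1 / \<theta>0"
proof -
  have U: "0 < theta_tilde \<rho>0 \<rho>1 w F G \<and> theta_equation \<rho>0 \<rho>1 w F G (theta_tilde \<rho>0 \<rho>1 w F G)" if unique_root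
  proof -
    have ex1: "\<exists>!\<theta>. 0 < \<theta> \<and> theta_equation \<rho>0 \<rho>1 w F G \<theta>" using that unfolding unique_theta_iff .
    have "theta_tilde \<rho>0 \<rho>1 w F G = (THE \<theta>. 0 < \<theta> \<and> theta_equation \<rho>0 \<rho>1 w F G \<theta>)"
      unfolding theta_tilde_def by (rule if_P[OF ex1])
    then show ?thesis using theI'[OF ex1] by (simp only:)
  qed
  have V: "theta_tilde \<rho>0 \<rho>1 w F G = 1" if "\<not> unique_root"
    using that unfolding theta_tilde_def unique_theta_iff by (rule if_not_P)
  have "0 < theta_tilde \<rho>0 \<rho>1 w F G"
  proof (cases unique_root)
    case True
    from U[OF True] show ?thesis by (rule conjunct1)
  next
    case False
    from V[OF False] show ?thesis by (simp only: zero_less_one)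
  qed
  then show "0 < root_ratio" unfolding root_ratio_def using theta_pos by (rule divide_pos_pos)
  show "root_ratio = 1 / \<theta>0" if "\<not> unique_root" unfolding root_ratio_def V[OF that] ..
  show "tilt_score (pool_size F G) (pool_weight F G) (pool_bias F G) root_ratio = \<rho>1 * total_mass G" if unique_root
    unfolding root_ratio_def using U[OF that] theta_equation_iff[of "theta_tilde \<rho>0 \<rho>1 w F G"] by (simp only:)
qed

text \<open>The constraints \<open>\<Sum>p = 1\<close> and \<open>\<Sum>p w = 1 / \<theta>0\<close> are linear combinations of \<open>\<Sum>p e = 1\<close> and \<open>\<Sum>p e \<phi> = 0\<close>,
where \<open>e = \<rho>0 + \<rho>1 \<theta>0 w\<close> and \<open>e \<phi> = \<theta>0 w - 1\<close>. In this form the multiplier that corresponds to the truth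
is \<open>\<tau> = 0\<close>.\<close>

lemma weighted_EL_ratio_dual:
  assumes "0 < n"
  shows "neg_two_ln (weighted_EL_ratio \<rho>0 \<rho>1 n w F G \<theta>0) =
    EL_dual_statistic \<rho>0 \<rho>1 (real n) (pool_size F G) (pool_weight F G) (pool_bias F G) (pool_mass F G) root_ratio"
proof -
  let ?m = "pool_size F G" and ?om = "pool_weight F G" and ?v = "pool_w F G"
  let ?th = "theta_tilde \<rho>0 \<rho>1 w F G"
  define \<phi> where "\<phi> = (\<lambda>i. (pool_bias F G i - \<rho>1) / (\<rho>0 * \<rho>1))"
  define e where "e = (\<lambda>i. \<rho>0 + \<rho>1 * \<theta>0 * ?v i)"
  define d where "d = (\<lambda>i. \<rho>0 + \<rho>1 * ?th * ?v i)"
  have th: "0 < ?th" using root_ratio_pos theta_pos by (simp add: root_ratio_def zero_less_divide_iff)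
  have v: "0 \<le> ?v i" if "i < ?m" for i using pool_atom(3)[OF that] .
  have e: "0 < e i" and d: "0 < d i" if "i < ?m" for i
    using denominator_pos[OF v[OF that]] th theta_pos by (auto simp: e_def d_def)
  have de: "d i / e i = 1 + pool_bias F G i * (root_ratio - 1)" if "i < ?m" for i
    using bias_denominator[OF v[OF that], of ?th] by (simp add: d_def e_def pool_bias_def root_ratio_def)
  have e\<phi>: "e i * \<phi> i = \<theta>0 * ?v i - 1" if "i < ?m" for i
  proof -
    have "e i * pool_bias F G i = \<rho>1 * \<theta>0 * ?v i"
      using e[OF that] by (simp add: pool_bias_def bias_def e_def)
    moreover have "\<phi> i * (\<rho>0 * \<rho>1) = pool_bias F G i - \<rho>1" using rho_pos by (simp add: \<phi>_def)
    ultimately have "e i * \<phi> i * (\<rho>0 * \<rho>1) = \<rho>1 * \<theta>0 * ?v i - \<rho>1 * e i"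
      by (simp only: mult.assoc[of "e i"] right_diff_distrib) (simp only: mult.commute)
    also have "\<dots> = (1 - \<rho>1) * \<rho>1 * \<theta>0 * ?v i - \<rho>0 * \<rho>1" by (simp add: e_def algebra_simps)
    also have "1 - \<rho>1 = \<rho>0" using rho_sum by simp
    finally have "e i * \<phi> i * (\<rho>0 * \<rho>1) = (\<theta>0 * ?v i - 1) * (\<rho>0 * \<rho>1)" by (simp add: algebra_simps)
    then show ?thesis using rho_pos by simp
  qed
  define P where "P = {p :: nat \<Rightarrow> real. (\<forall>i<?m. 0 \<le> p i) \<and> (\<Sum>i<?m. p i) = 1 \<and> (\<Sum>i<?m. p i * ?v i) = 1 / \<theta>0}"
  have P: "P = {p. (\<forall>i<?m. 0 \<le> p i) \<and> (\<Sum>i<?m. p i * e i) = 1 \<and> (\<Sum>i<?m. p i * e i * \<phi> i) = 0}"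
  proof -
    have "(\<Sum>i<?m. p i) = 1 \<and> (\<Sum>i<?m. p i * ?v i) = 1 / \<theta>0 \<longleftrightarrow>
        (\<Sum>i<?m. p i * e i) = 1 \<and> (\<Sum>i<?m. p i * e i * \<phi> i) = 0" for p
    proof -
      have a: "(\<Sum>i<?m. p i * e i) = \<rho>0 * (\<Sum>i<?m. p i) + \<rho>1 * (\<theta>0 * (\<Sum>i<?m. p i * ?v i))"
        by (simp add: e_def sum_distrib_left sum.distrib algebra_simps)
      have "(\<Sum>i<?m. p i * e i * \<phi> i) = (\<Sum>i<?m. \<theta>0 * (p i * ?v i) - p i)"
        by (intro sum.cong refl) (simp add: mult.assoc e\<phi> right_diff_distrib mult.left_commute)
      then have b: "(\<Sum>i<?m. p i * e i * \<phi> i) = \<theta>0 * (\<Sum>i<?m. p i * ?v i) - (\<Sum>i<?m. p i)"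
        by (simp add: sum_subtractf sum_distrib_left)
      have c: "(\<Sum>i<?m. p i * ?v i) = 1 / \<theta>0 \<longleftrightarrow> \<theta>0 * (\<Sum>i<?m. p i * ?v i) = 1"
        using theta_pos by (simp add: field_simps)
      have "\<rho>0 * s + \<rho>1 * s = s" for s :: real using rho_sum by (metis distrib_right mult_1)
      then show ?thesis unfolding a b c using rho_sum by auto
    qed
    then show ?thesis unfolding P_def by blast
  qed
  define K where "K = (\<theta>0 / ?th) powr (real n * \<rho>1)"
  have K: "0 < K" using th theta_pos by (simp add: K_def)
  have lnK: "- ln K = real n * (\<rho>1 * ln root_ratio)"
    using th theta_pos by (simp add: K_def ln_powr ln_div root_ratio_def algebra_simps)
  have "weighted_EL_ratio \<rho>0 \<rho>1 n w F G \<theta>0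
      = (SUP p\<in>P. ennreal (K * (\<Prod>i<?m. (p i * d i / ?om i) powr (real n * ?om i))))"
    unfolding weighted_EL_ratio_def Let_def P_def K_def p_tilde_def pool_size_def[symmetric]
      pool_weight_def[symmetric] pool_w_def[symmetric]
    by (simp add: d_def)
  then have "neg_two_ln (weighted_EL_ratio \<rho>0 \<rho>1 n w F G \<theta>0) = neg_two_ln \<dots>" by simp
  also have "\<dots> = (if ?m = 0 then \<infinity> else
        ereal (2 * (real n * (pool_mass F G * ln (pool_mass F G)) - ln K - real n * (\<Sum>i<?m. ?om i * ln (d i / e i))))
        + ereal (2 * real n) * (SUP \<tau>\<in>EL_dom ?m \<phi>. ereal (EL_gain ?m ?om \<phi> \<tau>)))"
    by (rule EL_duality) (use pool_atom(1) e d K assms pool_mass_def P in auto)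
  also have "2 * (real n * (pool_mass F G * ln (pool_mass F G)) - ln K - real n * (\<Sum>i<?m. ?om i * ln (d i / e i)))
      = 2 * real n * (pool_mass F G * ln (pool_mass F G) + \<rho>1 * ln root_ratio
        - (\<Sum>i<?m. ?om i * ln (1 + pool_bias F G i * (root_ratio - 1))))"
  proof -
    have "(\<Sum>i<?m. ?om i * ln (d i / e i)) = (\<Sum>i<?m. ?om i * ln (1 + pool_bias F G i * (root_ratio - 1)))"
      by (intro sum.cong refl) (simp add: de)
    then show ?thesis using lnK by (simp add: algebra_simps)
  qed
  finally show ?thesis by (simp add: \<phi>_def EL_dual_statistic_def)
qed

end

end

section \<open>Measurability of the likelihood ratio statistic\<close>

context biased_weights
begin

lemma stieltjes_measurable:
  assumes f: "f \<in> borel_measurable borel" and H: "\<And>\<omega>. \<omega> \<in> space M \<Longrightarrow> step_df (H \<omega>)" "\<And>x. (\<lambda>\<omega>. H \<omega> x) \<in> borel_measurable M"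
  shows "(\<lambda>\<omega>. stieltjes_integral (\<lambda>x. f (w x)) (H \<omega>)) \<in> borel_measurable M"
proof -
  have f': "(\<lambda>(\<omega>, x). indicator {0..} x *\<^sub>R (f (w x) :: real)) \<in> borel_measurable (M \<Otimes>\<^sub>M borel)"
    using measurable_compose[OF measurable_snd comp_w_measurable[OF f]] by (simp add: case_prod_beta')
  show ?thesis unfolding stieltjes_integral_def set_lebesgue_integral_def
    by (rule integral_measurable_subprob_kernel[OF f' step_df_kernel_measurable[OF H]])
qed

lemma total_mass_measurable:
  assumes H: "\<And>\<omega>. \<omega> \<in> space M \<Longrightarrow> step_df (H \<omega>)" "\<And>x. (\<lambda>\<omega>. H \<omega> x) \<in> borel_measurable M"
  shows "(\<lambda>\<omega>. total_mass (H \<omega>)) \<in> borel_measurable M"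
  unfolding total_mass_def
  by (rule measurable_compose[OF step_df_kernel_measurable[OF H] measurable_measure_subprob_algebra]) auto

context
  fixes M :: "'a measure" and Fh Gh :: "'a \<Rightarrow> real \<Rightarrow> real"
  assumes F: "\<And>\<omega>. step_df (Fh \<omega>)" and G: "\<And>\<omega>. step_df (Gh \<omega>)"
    and Fm: "\<And>x. (\<lambda>\<omega>. Fh \<omega> x) \<in> borel_measurable M" and Gm: "\<And>x. (\<lambda>\<omega>. Gh \<omega> x) \<in> borel_measurable M"
begin

text \<open>The number of atoms and their positions are random, but the sum is an integral against two random
measures, and these are kernels.\<close>

lemma pool_sum_measurable:
  assumes f: "(\<lambda>(\<omega>, v). f \<omega> v) \<in> borel_measurable (M \<Otimes>\<^sub>M borel)"
  shows "(\<lambda>\<omega>. \<Sum>i<pool_size (Fh \<omega>) (Gh \<omega>). pool_weight (Fh \<omega>) (Gh \<omega>) i * f \<omega> (pool_w (Fh \<omega>) (Gh \<omega>) i))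
    \<in> borel_measurable M"
proof -
  have fw: "f \<omega> \<in> borel_measurable borel" if "\<omega> \<in> space M" for \<omega>
    using measurable_Pair2[OF f that] by simp
  have "(\<lambda>(\<omega>, x). f \<omega> (w_plus x)) = (\<lambda>(\<omega>, v). f \<omega> v) \<circ> (\<lambda>(\<omega>, x). (\<omega>, w_plus x))"
    by (auto simp: fun_eq_iff)
  moreover have "(\<lambda>(\<omega>, x). (\<omega>, w_plus x)) \<in> M \<Otimes>\<^sub>M borel \<rightarrow>\<^sub>M M \<Otimes>\<^sub>M borel" by measurable
  ultimately have f': "(\<lambda>(\<omega>, x). f \<omega> (w_plus x)) \<in> borel_measurable (M \<Otimes>\<^sub>M borel)"
    using f measurable_comp by metis
  note k = integral_measurable_subprob_kernel[OF f' step_df_kernel_measurable]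
  have "(\<lambda>\<omega>. \<rho>0 * integral\<^sup>L (interval_measure (Fh \<omega>)) (\<lambda>x. f \<omega> (w_plus x))
    + \<rho>1 * integral\<^sup>L (interval_measure (Gh \<omega>)) (\<lambda>x. f \<omega> (w_plus x))) \<in> borel_measurable M"
    by (intro borel_measurable_add borel_measurable_times borel_measurable_const k F G Fm Gm)
  then show ?thesis
    by (subst measurable_cong[OF pool_sum_w_plus[OF F G fw]])
qed

lemma tilt_score_measurable:
  "(\<lambda>\<omega>. tilt_score (pool_size (Fh \<omega>) (Gh \<omega>)) (pool_weight (Fh \<omega>) (Gh \<omega>)) (pool_bias (Fh \<omega>) (Gh \<omega>)) x) \<in> borel_measurable M"
  unfolding tilt_score_def pool_bias_def
  by (rule pool_sum_measurable) (simp add: tilt_def)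

text \<open>The score is increasing, so where a unique root exists it is at most \<open>c\<close> if and only if \<open>c > 0\<close> and the
score at \<open>c\<close> is at least the target value.\<close>

lemma root_ratio_measurable: "(\<lambda>\<omega>. root_ratio (Fh \<omega>) (Gh \<omega>)) \<in> borel_measurable M"
proof (rule borel_measurable_iff_le[THEN iffD2], rule allI)
  fix c :: real
  define S where "S \<omega> = tilt_score (pool_size (Fh \<omega>) (Gh \<omega>)) (pool_weight (Fh \<omega>) (Gh \<omega>)) (pool_bias (Fh \<omega>) (Gh \<omega>))" for \<omega>
  define h where "h \<omega> = \<rho>1 * total_mass (Gh \<omega>)" for \<omega>
  have S [measurable]: "(\<lambda>\<omega>. S \<omega> x) \<in> borel_measurable M" for x
    unfolding S_def by (rule tilt_score_measurable)
  have h [measurable]: "h \<in> borel_measurable M"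
    unfolding h_def using total_mass_measurable[OF G Gm] by measurable
  define V where "V \<omega> \<longleftrightarrow> (\<exists>a\<in>\<rat>. \<exists>b\<in>\<rat>. 0 < a \<and> a < b \<and> S \<omega> a < h \<omega> \<and> h \<omega> < S \<omega> b)" for \<omega>
  have VU: "V \<omega> \<longleftrightarrow> (\<exists>!x. 0 < x \<and> S \<omega> x = h \<omega>)" for \<omega>
    unfolding V_def S_def
    using tilt_score_unique_root_iff[of "pool_size (Fh \<omega>) (Gh \<omega>)" "pool_weight (Fh \<omega>) (Gh \<omega>)" "pool_bias (Fh \<omega>) (Gh \<omega>)" "h \<omega>"]
      pool_atom[OF F G, of _ \<omega> \<omega>] by blast
  have "{\<omega> \<in> space M. V \<omega>} = (\<Union>a\<in>\<rat>. \<Union>b\<in>\<rat>. {\<omega> \<in> space M. 0 < a \<and> a < b \<and> S \<omega> a < h \<omega> \<and> h \<omega> < S \<omega> b})"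
    unfolding V_def by auto
  also have "\<dots> \<in> sets M"
    by (intro sets.countable_UN'' countable_rat) measurable
  finally have V: "{\<omega> \<in> space M. V \<omega>} \<in> sets M" .
  have le: "root_ratio (Fh \<omega>) (Gh \<omega>) \<le> c \<longleftrightarrow> 0 < c \<and> h \<omega> \<le> S \<omega> c" if "V \<omega>" for \<omega>
  proof -
    let ?r = "root_ratio (Fh \<omega>) (Gh \<omega>)"
    have U: "\<exists>!x. 0 < x \<and> S \<omega> x = h \<omega>" using that VU by simp
    have r: "0 < ?r" "S \<omega> ?r = h \<omega>"
      using root_ratio_pos[OF F G] root_ratio_root[OF F G U[unfolded S_def h_def]] by (simp_all add: S_def h_def)
    have mono: "S \<omega> x \<le> S \<omega> y" if "0 < x" "x < y" for x y
      unfolding S_def by (rule tilt_score_mono(1)) (use pool_atom[OF F G] that in auto)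
    show ?thesis
    proof
      assume "?r \<le> c"
      then show "0 < c \<and> h \<omega> \<le> S \<omega> c" using r mono[of ?r c] by (cases "?r = c") auto
    next
      assume c: "0 < c \<and> h \<omega> \<le> S \<omega> c"
      show "?r \<le> c"
      proof (rule ccontr)
        assume "\<not> ?r \<le> c"
        then have "S \<omega> c \<le> h \<omega>" using mono[of c ?r] r c by auto
        then have "0 < c \<and> S \<omega> c = h \<omega>" using c by auto
        then have "c = ?r" using U r by blast
        with \<open>\<not> ?r \<le> c\<close> show False by simp
      qed
    qed
  qed
  have nV: "root_ratio (Fh \<omega>) (Gh \<omega>) = 1 / \<theta>0" if "\<not> V \<omega>" for \<omega>
    using root_ratio_default[OF F G] that unfolding VU S_def h_def by blast
  have "{\<omega> \<in> space M. root_ratio (Fh \<omega>) (Gh \<omega>) \<le> c} =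
      ({\<omega> \<in> space M. V \<omega>} \<inter> {\<omega> \<in> space M. 0 < c \<and> h \<omega> \<le> S \<omega> c}) \<union> ({\<omega> \<in> space M. 1 / \<theta>0 \<le> c} - {\<omega> \<in> space M. V \<omega>})"
  proof (rule set_eqI)
    fix \<omega>
    show "\<omega> \<in> {\<omega> \<in> space M. root_ratio (Fh \<omega>) (Gh \<omega>) \<le> c} \<longleftrightarrow> \<omega> \<in>
      ({\<omega> \<in> space M. V \<omega>} \<inter> {\<omega> \<in> space M. 0 < c \<and> h \<omega> \<le> S \<omega> c}) \<union> ({\<omega> \<in> space M. 1 / \<theta>0 \<le> c} - {\<omega> \<in> space M. V \<omega>})"
      by (cases "V \<omega>") (auto simp add: le nV)
  qed
  also have "\<dots> \<in> sets M"
    by (intro sets.Un sets.Int sets.Diff V) measurable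
  finally show "{\<omega> \<in> space M. root_ratio (Fh \<omega>) (Gh \<omega>) \<le> c} \<in> sets M" .
qed

text \<open>Whether \<open>\<tau>\<close> lies in the random domain is decided by the total weight \<open>D\<close> of the atoms that violate the
constraint, which is again a measurable sum.\<close>

lemma EL_gain_SUP_measurable:
  "(\<lambda>\<omega>. SUP \<tau>\<in>EL_dom (pool_size (Fh \<omega>) (Gh \<omega>)) (\<lambda>i. (pool_bias (Fh \<omega>) (Gh \<omega>) i - \<rho>1) / (\<rho>0 * \<rho>1)).
      ereal (EL_gain (pool_size (Fh \<omega>) (Gh \<omega>)) (pool_weight (Fh \<omega>) (Gh \<omega>))
        (\<lambda>i. (pool_bias (Fh \<omega>) (Gh \<omega>) i - \<rho>1) / (\<rho>0 * \<rho>1)) \<tau>)) \<in> borel_measurable M"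
proof -
  let ?m = "\<lambda>\<omega>. pool_size (Fh \<omega>) (Gh \<omega>)" and ?om = "\<lambda>\<omega>. pool_weight (Fh \<omega>) (Gh \<omega>)"
  let ?\<phi> = "\<lambda>\<omega> i. (pool_bias (Fh \<omega>) (Gh \<omega>) i - \<rho>1) / (\<rho>0 * \<rho>1)"
  define D where "D \<tau> \<omega> = (\<Sum>i<?m \<omega>. ?om \<omega> i * (if 0 < 1 + \<tau> * ?\<phi> \<omega> i then 0 else 1))" for \<tau> \<omega>
  have Dm: "D \<tau> \<in> borel_measurable M" for \<tau>
    unfolding D_def pool_bias_def by (rule pool_sum_measurable) measurable
  have Lm: "(\<lambda>\<omega>. EL_gain (?m \<omega>) (?om \<omega>) (?\<phi> \<omega>) \<tau>) \<in> borel_measurable M" for \<tau>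
    unfolding EL_gain_def pool_bias_def by (rule pool_sum_measurable) measurable
  have D0: "\<tau> \<in> EL_dom (?m \<omega>) (?\<phi> \<omega>) \<longleftrightarrow> D \<tau> \<omega> = 0" for \<tau> \<omega>
  proof -
    have "D \<tau> \<omega> = 0 \<longleftrightarrow> (\<forall>i\<in>{..<?m \<omega>}. ?om \<omega> i * (if 0 < 1 + \<tau> * ?\<phi> \<omega> i then 0 else 1) = 0)"
      unfolding D_def using pool_atom(1)[OF F G]
      by (intro sum_nonneg_eq_0_iff) (auto intro: less_imp_le)
    also have "\<dots> \<longleftrightarrow> (\<forall>i<?m \<omega>. 0 < 1 + \<tau> * ?\<phi> \<omega> i)"
    proof -
      have "?om \<omega> i * (if 0 < 1 + \<tau> * ?\<phi> \<omega> i then 0 else 1) = 0 \<longleftrightarrow> 0 < 1 + \<tau> * ?\<phi> \<omega> i" if "i < ?m \<omega>" for i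
        using pool_atom(1)[OF F G that] by simp
      then show ?thesis by blast
    qed
    finally show ?thesis by (simp add: EL_dom_def)
  qed
  have "(SUP \<tau>\<in>EL_dom (?m \<omega>) (?\<phi> \<omega>). ereal (EL_gain (?m \<omega>) (?om \<omega>) (?\<phi> \<omega>) \<tau>))
      = (SUP \<tau>\<in>\<rat>. if D \<tau> \<omega> = 0 then ereal (EL_gain (?m \<omega>) (?om \<omega>) (?\<phi> \<omega>) \<tau>) else - \<infinity>)" for \<omega>
    unfolding EL_gain_SUP_Rats
  proof (rule antisym)
    show "(SUP \<tau>\<in>EL_dom (?m \<omega>) (?\<phi> \<omega>) \<inter> \<rat>. ereal (EL_gain (?m \<omega>) (?om \<omega>) (?\<phi> \<omega>) \<tau>))
      \<le> (SUP \<tau>\<in>\<rat>. if D \<tau> \<omega> = 0 then ereal (EL_gain (?m \<omega>) (?om \<omega>) (?\<phi> \<omega>) \<tau>) else - \<infinity>)"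
    proof (rule SUP_least)
      fix \<tau> assume "\<tau> \<in> EL_dom (?m \<omega>) (?\<phi> \<omega>) \<inter> \<rat>"
      then show "ereal (EL_gain (?m \<omega>) (?om \<omega>) (?\<phi> \<omega>) \<tau>)
        \<le> (SUP \<tau>\<in>\<rat>. if D \<tau> \<omega> = 0 then ereal (EL_gain (?m \<omega>) (?om \<omega>) (?\<phi> \<omega>) \<tau>) else - \<infinity>)"
        using D0[of \<tau> \<omega>] by (intro SUP_upper2[of \<tau>]) auto
    qed
    show "(SUP \<tau>\<in>\<rat>. if D \<tau> \<omega> = 0 then ereal (EL_gain (?m \<omega>) (?om \<omega>) (?\<phi> \<omega>) \<tau>) else - \<infinity>)
      \<le> (SUP \<tau>\<in>EL_dom (?m \<omega>) (?\<phi> \<omega>) \<inter> \<rat>. ereal (EL_gain (?m \<omega>) (?om \<omega>) (?\<phi> \<omega>) \<tau>))"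
    proof (rule SUP_least)
      fix \<tau> :: real assume "\<tau> \<in> \<rat>"
      then show "(if D \<tau> \<omega> = 0 then ereal (EL_gain (?m \<omega>) (?om \<omega>) (?\<phi> \<omega>) \<tau>) else - \<infinity>)
        \<le> (SUP \<tau>\<in>EL_dom (?m \<omega>) (?\<phi> \<omega>) \<inter> \<rat>. ereal (EL_gain (?m \<omega>) (?om \<omega>) (?\<phi> \<omega>) \<tau>))"
        using D0[of \<tau> \<omega>] by (cases "D \<tau> \<omega> = 0") (auto intro: SUP_upper)
    qed
  qed
  moreover have "(\<lambda>\<omega>. SUP \<tau>\<in>\<rat>. if D \<tau> \<omega> = 0 then ereal (EL_gain (?m \<omega>) (?om \<omega>) (?\<phi> \<omega>) \<tau>) else - \<infinity>) \<in> borel_measurable M"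
  proof (intro borel_measurable_SUP countable_rat measurable_If borel_measurable_ereal Lm borel_measurable_const)
    fix \<tau> :: real
    show "{\<omega> \<in> space M. D \<tau> \<omega> = 0} \<in> sets M" using Dm[of \<tau>] by measurable
  qed
  ultimately show ?thesis by simp
qed

lemma neg_two_ln_EL_ratio_measurable:
  assumes n: "0 < n"
  shows "(\<lambda>\<omega>. neg_two_ln (weighted_EL_ratio \<rho>0 \<rho>1 n w (Fh \<omega>) (Gh \<omega>) \<theta>0)) \<in> borel_measurable M"
proof -
  have mass [measurable]: "(\<lambda>\<omega>. pool_mass (Fh \<omega>) (Gh \<omega>)) \<in> borel_measurable M"
    unfolding pool_mass_eq[OF F G] using total_mass_measurable[OF F Fm] total_mass_measurable[OF G Gm] by measurable
  note root_ratio_measurable [measurable]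
  have ln [measurable]: "(\<lambda>\<omega>. \<Sum>i<pool_size (Fh \<omega>) (Gh \<omega>). pool_weight (Fh \<omega>) (Gh \<omega>) i *
      ln (1 + pool_bias (Fh \<omega>) (Gh \<omega>) i * (root_ratio (Fh \<omega>) (Gh \<omega>) - 1))) \<in> borel_measurable M"
    unfolding pool_bias_def by (rule pool_sum_measurable) measurable
  note EL_gain_SUP_measurable [measurable]
  show ?thesis
    unfolding weighted_EL_ratio_dual[OF F G n] EL_dual_statistic_def pool_size_eq_0_iff[OF F G] by measurable
qed

end

end

section \<open>Convergence in probability as a filter\<close>

text \<open>A property of the index and the sample point holds eventually if, for each \<open>\<delta>\<close>, it holds off a set of
probability less than \<open>\<delta>\<close> from some index on. Convergence along this filter is convergence in probability, and the
calculus of limits along filters applies to it. The exceptional set is measurable while the property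
need not be.\<close>

definition prob_filter :: "'a measure \<Rightarrow> (nat \<times> 'a) filter" where
  "prob_filter M = Abs_filter (\<lambda>P. \<forall>\<delta>>0. \<forall>\<^sub>F k in sequentially.
     \<exists>B\<in>sets M. measure M B < \<delta> \<and> (\<forall>\<omega>\<in>space M - B. P (k, \<omega>)))"

context prob_space
begin

lemma eventually_prob_filter:
  "eventually P (prob_filter M) \<longleftrightarrow> (\<forall>\<delta>>0. \<forall>\<^sub>F k in sequentially.
     \<exists>B\<in>sets M. measure M B < \<delta> \<and> (\<forall>\<omega>\<in>space M - B. P (k, \<omega>)))"
  unfolding prob_filter_def
proof (rule eventually_Abs_filter, rule is_filter.intro)
  let ?E = "\<lambda>P \<delta> k. \<exists>B\<in>sets M. measure M B < \<delta> \<and> (\<forall>\<omega>\<in>space M - B. P (k, \<omega>))"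
  show "\<forall>\<delta>>0. eventually (?E (\<lambda>_. True) \<delta>) sequentially"
    by (auto intro!: bexI[of _ "{}"])
  fix P Q :: "nat \<times> 'a \<Rightarrow> bool"
  assume P: "\<forall>\<delta>>0. eventually (?E P \<delta>) sequentially"
  {
    assume Q: "\<forall>\<delta>>0. eventually (?E Q \<delta>) sequentially"
    show "\<forall>\<delta>>0. eventually (?E (\<lambda>x. P x \<and> Q x) \<delta>) sequentially"
    proof (intro allI impI)
      fix \<delta> :: real assume "0 < \<delta>"
      then have "0 < \<delta> / 2" by simp
      from P[rule_format, OF this] Q[rule_format, OF this]
      show "eventually (?E (\<lambda>x. P x \<and> Q x) \<delta>) sequentially"
      proof eventually_elim
        case (elim k)
        then obtain A B where AB: "A \<in> sets M" "measure M A < \<delta> / 2" "\<forall>\<omega>\<in>space M - A. P (k, \<omega>)"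
          "B \<in> sets M" "measure M B < \<delta> / 2" "\<forall>\<omega>\<in>space M - B. Q (k, \<omega>)" by auto
        have "measure M (A \<union> B) \<le> measure M A + measure M B"
          using AB by (intro measure_Un_le)
        then show ?case using AB by (intro bexI[of _ "A \<union> B"]) auto
      qed
    qed
  next
    assume PQ: "\<forall>x. P x \<longrightarrow> Q x"
    show "\<forall>\<delta>>0. eventually (?E Q \<delta>) sequentially"
    proof (intro allI impI)
      fix \<delta> :: real assume "0 < \<delta>"
      from P[rule_format, OF this] show "eventually (?E Q \<delta>) sequentially"
        by (rule eventually_mono) (use PQ in blast)
    qed
  }
qed

lemma filterlim_fst_prob_filter: "filterlim fst sequentially (prob_filter M)"
  unfolding filterlim_iff eventually_prob_filter
proof (intro allI impI)
  fix P :: "nat \<Rightarrow> bool" and \<delta> :: real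
  assume P: "eventually P sequentially" and "0 < \<delta>"
  then show "\<forall>\<^sub>F k in sequentially. \<exists>B\<in>sets M. measure M B < \<delta> \<and> (\<forall>\<omega>\<in>space M - B. P (fst (k, \<omega>)))"
    by (intro eventually_mono[OF P]) (auto intro!: bexI[of _ "{}"])
qed

lemma tendsto_prob_filterI:
  fixes f :: "nat \<Rightarrow> 'a \<Rightarrow> real"
  assumes f [measurable]: "\<And>k. f k \<in> borel_measurable M"
    and lim: "\<And>e. 0 < e \<Longrightarrow> (\<lambda>k. measure M {\<omega> \<in> space M. e < \<bar>f k \<omega> - l\<bar>}) \<longlonglongrightarrow> 0"
  shows "((\<lambda>p. f (fst p) (snd p)) \<longlongrightarrow> l) (prob_filter M)"
proof (rule tendstoI)
  fix e :: real assume "0 < e"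
  then have "0 < e / 2" by simp
  show "\<forall>\<^sub>F p in prob_filter M. dist (f (fst p) (snd p)) l < e"
    unfolding eventually_prob_filter
  proof (intro allI impI)
    fix \<delta> :: real assume "0 < \<delta>"
    with lim[OF \<open>0 < e / 2\<close>] have "\<forall>\<^sub>F k in sequentially. measure M {\<omega> \<in> space M. e / 2 < \<bar>f k \<omega> - l\<bar>} < \<delta>"
      by (rule order_tendstoD)
    then show "\<forall>\<^sub>F k in sequentially. \<exists>B\<in>sets M. measure M B < \<delta> \<and>
        (\<forall>\<omega>\<in>space M - B. dist (f (fst (k, \<omega>)) (snd (k, \<omega>))) l < e)"
    proof eventually_elim
      case (elim k)
      have "{\<omega> \<in> space M. e / 2 < \<bar>f k \<omega> - l\<bar>} \<in> sets M" by measurable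
      then show ?case using elim \<open>0 < e\<close>
        by (intro bexI[of _ "{\<omega> \<in> space M. e / 2 < \<bar>f k \<omega> - l\<bar>}"]) (auto simp: dist_real_def)
    qed
  qed
qed

text \<open>Almost sure convergence implies convergence in probability: the indicators of the exceptional sets
converge to 0 almost surely and are dominated by 1.\<close>

lemma tendsto_prob_filter_AE:
  fixes f :: "nat \<Rightarrow> 'a \<Rightarrow> real"
  assumes f [measurable]: "\<And>k. f k \<in> borel_measurable M"
    and lim: "AE \<omega> in M. (\<lambda>k. f k \<omega>) \<longlonglongrightarrow> l"
  shows "((\<lambda>p. f (fst p) (snd p)) \<longlongrightarrow> l) (prob_filter M)"
proof (rule tendsto_prob_filterI[OF f])
  fix e :: real assume e: "0 < e"
  let ?A = "\<lambda>k. {\<omega> \<in> space M. e < \<bar>f k \<omega> - l\<bar>}"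
  have "(\<lambda>k. \<integral>\<omega>. indicator (?A k) \<omega> \<partial>M) \<longlonglongrightarrow> (\<integral>\<omega>. (0::real) \<partial>M)"
  proof (rule integral_dominated_convergence[where w="\<lambda>_. 1"])
    show "AE \<omega> in M. (\<lambda>k. indicator (?A k) \<omega> :: real) \<longlonglongrightarrow> 0"
      using lim
    proof eventually_elim
      case (elim \<omega>)
      from tendstoD[OF elim e] have "\<forall>\<^sub>F k in sequentially. indicator (?A k) \<omega> = (0::real)"
        by eventually_elim (auto simp: dist_real_def indicator_def)
      then show ?case by (rule tendsto_eventually)
    qed
  qed (auto simp: indicator_def)
  then show "(\<lambda>k. measure M (?A k)) \<longlonglongrightarrow> 0" by simp
qed

text \<open>A weakly convergent sequence is tight, so it stays bounded off a set of small probability, uniformly in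
the index; a null factor then makes the product small.\<close>

lemma weak_conv_bounded_in_probability:
  fixes x :: "nat \<Rightarrow> 'a \<Rightarrow> real"
  assumes x [measurable]: "\<And>k. x k \<in> borel_measurable M" and N: "real_distribution N"
    and conv: "weak_conv_m (\<lambda>k. distr M borel (x k)) N"
    and cont: "\<And>y. isCont (cdf N) y"
    and f: "(f \<longlongrightarrow> 0) (prob_filter M)"
  shows "((\<lambda>p. x (fst p) (snd p) * f p :: real) \<longlongrightarrow> 0) (prob_filter M)"
proof (rule tendstoI)
  interpret N: real_distribution N by fact
  fix e :: real assume e: "0 < e"
  show "\<forall>\<^sub>F p in prob_filter M. dist (x (fst p) (snd p) * f p) 0 < e"
    unfolding eventually_prob_filter
  proof (intro allI impI)
    fix \<delta> :: real assume \<delta>: "0 < \<delta>"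
    have "\<forall>\<^sub>F L in at_top. 1 - \<delta> / 4 < cdf N L"
      using N.cdf_lim_at_top_prob \<delta> by (intro order_tendstoD(1)) auto
    moreover have "\<forall>\<^sub>F L in at_top. cdf N (- L) < \<delta> / 4"
      using filterlim_compose[OF N.cdf_lim_at_bot filterlim_uminus_at_bot_at_top] \<delta> by (intro order_tendstoD(2)) auto
    moreover have "\<forall>\<^sub>F L in at_top. (0::real) < L" by (rule eventually_gt_at_top)
    ultimately have "\<forall>\<^sub>F L in at_top. 1 - \<delta> / 4 < cdf N L \<and> cdf N (- L) < \<delta> / 4 \<and> 0 < L"
      by eventually_elim auto
    then obtain L where L: "1 - \<delta> / 4 < cdf N L" "cdf N (- L) < \<delta> / 4" "0 < L"
      using eventually_happens'[OF trivial_limit_at_top_linorder] by blast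
    have cdf: "(\<lambda>k. cdf (distr M borel (x k)) y) \<longlonglongrightarrow> cdf N y" for y
      using conv cont by (auto simp: weak_conv_m_def weak_conv_def)
    have 1: "\<forall>\<^sub>F k in sequentially. 1 - \<delta> / 4 < cdf (distr M borel (x k)) L"
      using cdf[of L] L(1) by (rule order_tendstoD(1))
    have 2: "\<forall>\<^sub>F k in sequentially. cdf (distr M borel (x k)) (- L) < \<delta> / 4"
      using cdf[of "- L"] L(2) by (rule order_tendstoD(2))
    have "0 < e / L" using e L by simp
    from tendstoD[OF f this] have "\<forall>\<^sub>F p in prob_filter M. \<bar>f p\<bar> < e / L" by (simp add: dist_real_def)
    then have 3: "\<forall>\<^sub>F k in sequentially. \<exists>B\<in>sets M. measure M B < \<delta> / 2 \<and> (\<forall>\<omega>\<in>space M - B. \<bar>f (k, \<omega>)\<bar> < e / L)"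
      unfolding eventually_prob_filter using half_gt_zero[OF \<delta>] by blast
    from 1 2 3 show "\<forall>\<^sub>F k in sequentially. \<exists>B\<in>sets M. measure M B < \<delta> \<and>
        (\<forall>\<omega>\<in>space M - B. dist (x (fst (k, \<omega>)) (snd (k, \<omega>)) * f (k, \<omega>)) 0 < e)"
    proof eventually_elim
      case (elim k)
      obtain B where B: "B \<in> sets M" "measure M B < \<delta> / 2" "\<forall>\<omega>\<in>space M - B. \<bar>f (k, \<omega>)\<bar> < e / L"
        using elim(3) by blast
      let ?U = "{\<omega> \<in> space M. x k \<omega> \<le> - L}" and ?V = "{\<omega> \<in> space M. x k \<omega> \<le> L}"
      have U: "measure M ?U < \<delta> / 4" and V: "1 - \<delta> / 4 < measure M ?V"
      proof -
        have "cdf (distr M borel (x k)) y = measure M {\<omega> \<in> space M. x k \<omega> \<le> y}" for y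
          unfolding cdf_def by (subst measure_distr) (auto intro!: arg_cong[where f="measure M"])
        then show "measure M ?U < \<delta> / 4" "1 - \<delta> / 4 < measure M ?V" using elim(1,2) by simp_all
      qed
      have V': "measure M (space M - ?V) < \<delta> / 4"
        using V by (subst prob_compl) auto
      let ?C = "?U \<union> (space M - ?V) \<union> B"
      have "measure M ?C \<le> measure M (?U \<union> (space M - ?V)) + measure M B"
        using B(1) by (intro measure_Un_le) auto
      also have "measure M (?U \<union> (space M - ?V)) \<le> measure M ?U + measure M (space M - ?V)"
        by (intro measure_Un_le) auto
      finally have "measure M ?C < \<delta>" using U V' B(2) by simp
      moreover have "dist (x (fst (k, \<omega>)) (snd (k, \<omega>)) * f (k, \<omega>)) 0 < e" if "\<omega> \<in> space M - ?C" for \<omega>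
      proof -
        have "\<bar>x k \<omega>\<bar> \<le> L" using that by auto
        moreover have f: "\<bar>f (k, \<omega>)\<bar> < e / L" using that B(3) by auto
        ultimately have "\<bar>x k \<omega>\<bar> * \<bar>f (k, \<omega>)\<bar> \<le> L * \<bar>f (k, \<omega>)\<bar>" by (intro mult_right_mono) auto
        moreover have "L * \<bar>f (k, \<omega>)\<bar> < L * (e / L)" using f L(3) by (rule mult_strict_left_mono)
        ultimately show ?thesis using L(3) by (simp add: abs_mult dist_real_def)
      qed
      moreover have "?C \<in> sets M" using B(1) by simp
      ultimately show ?case by blast
    qed
  qed
qed

text \<open>This is Slutsky's theorem for extended real statistics: the event \<open>Z \<le> x\<close> lies between \<open>Q \<le> x - d\<close> and
\<open>Q \<le> x + d\<close> up to an exceptional set, and \<open>d\<close> is chosen by continuity of \<open>H\<close> at \<open>x\<close>. The lower bound uses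
that \<open>Z\<close> is measurable.\<close>

lemma cdf_limit_of_approximation:
  fixes Z :: "nat \<Rightarrow> 'a \<Rightarrow> ereal" and Q :: "nat \<Rightarrow> 'a \<Rightarrow> real"
  assumes Z [measurable]: "\<And>k. Z k \<in> borel_measurable M" and Q [measurable]: "\<And>k. Q k \<in> borel_measurable M"
    and fin: "\<forall>\<^sub>F p in prob_filter M. \<bar>Z (fst p) (snd p)\<bar> \<noteq> \<infinity>"
    and appr: "((\<lambda>p. real_of_ereal (Z (fst p) (snd p)) - Q (fst p) (snd p)) \<longlongrightarrow> 0) (prob_filter M)"
    and Qlim: "\<And>y. (\<lambda>k. measure M {\<omega> \<in> space M. Q k \<omega> \<le> y}) \<longlonglongrightarrow> H y"
  shows "weak_conv (\<lambda>k x. measure M {\<omega> \<in> space M. Z k \<omega> \<le> ereal x}) H"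
  unfolding weak_conv_def
proof (intro allI impI tendstoI)
  fix x e :: real assume cont: "isCont H x" and e: "0 < e"
  have "0 < e / 3" using e by simp
  from cont[unfolded continuous_at_eps_delta, rule_format, OF this]
  obtain d0 where d0: "0 < d0" "\<And>y. dist y x < d0 \<Longrightarrow> dist (H y) (H x) < e / 3" by blast
  define d where "d = d0 / 2"
  have d: "0 < d" "\<bar>H (x + d) - H x\<bar> < e / 3" "\<bar>H (x - d) - H x\<bar> < e / 3"
    using d0(1) d0(2)[of "x + d"] d0(2)[of "x - d"] by (simp_all add: d_def dist_real_def)
  have "\<forall>\<^sub>F p in prob_filter M. \<bar>real_of_ereal (Z (fst p) (snd p)) - Q (fst p) (snd p)\<bar> < d"
    using tendstoD[OF appr d(1)] by (simp only: dist_real_def diff_0_right)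
  note ev = eventually_conj[OF fin this]
  have 1: "\<forall>\<^sub>F k in sequentially. \<exists>B\<in>sets M. measure M B < e / 3 \<and> (\<forall>\<omega>\<in>space M - B.
      \<bar>Z k \<omega>\<bar> \<noteq> \<infinity> \<and> \<bar>real_of_ereal (Z k \<omega>) - Q k \<omega>\<bar> < d)"
    using ev[unfolded eventually_prob_filter, rule_format, OF \<open>0 < e / 3\<close>] by (simp only: fst_conv snd_conv)
  have 2: "\<forall>\<^sub>F k in sequentially. dist (measure M {\<omega> \<in> space M. Q k \<omega> \<le> x + d}) (H (x + d)) < e / 3"
    and 3: "\<forall>\<^sub>F k in sequentially. dist (measure M {\<omega> \<in> space M. Q k \<omega> \<le> x - d}) (H (x - d)) < e / 3"
    by (rule tendstoD[OF Qlim \<open>0 < e / 3\<close>])+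
  from 1 2 3 show "\<forall>\<^sub>F k in sequentially. dist (measure M {\<omega> \<in> space M. Z k \<omega> \<le> ereal x}) (H x) < e"
  proof eventually_elim
    case (elim k)
    from elim(1) obtain B where "B \<in> sets M" and *: "measure M B < e / 3 \<and>
      (\<forall>\<omega>\<in>space M - B. \<bar>Z k \<omega>\<bar> \<noteq> \<infinity> \<and> \<bar>real_of_ereal (Z k \<omega>) - Q k \<omega>\<bar> < d)"
      by (rule bexE) (rule that)
    note B = \<open>B \<in> sets M\<close> conjunct1[OF *] bspec[OF conjunct2[OF *]]
    have ZQ: "\<exists>z. Z k \<omega> = ereal z \<and> \<bar>z - Q k \<omega>\<bar> < d" if "\<omega> \<in> space M - B" for \<omega>
    proof -
      note fin = conjunct1[OF B(3)[OF that]] and lt = conjunct2[OF B(3)[OF that]]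
      from fin obtain z where "Z k \<omega> = ereal z" by (cases "Z k \<omega>") auto
      with lt show ?thesis by simp
    qed
    let ?Z = "{\<omega> \<in> space M. Z k \<omega> \<le> ereal x}" and ?Q = "\<lambda>y. {\<omega> \<in> space M. Q k \<omega> \<le> y}"
    have [measurable]: "?Z \<in> sets M" by measurable
    have [measurable]: "?Q y \<in> sets M" for y by measurable
    have "?Z \<subseteq> ?Q (x + d) \<union> B"
    proof
      fix \<omega> assume \<omega>: "\<omega> \<in> ?Z"
      show "\<omega> \<in> ?Q (x + d) \<union> B"
      proof (cases "\<omega> \<in> B")
        case False
        then obtain z where "Z k \<omega> = ereal z" "\<bar>z - Q k \<omega>\<bar> < d" using ZQ[of \<omega>] \<omega> by auto
        then show ?thesis using \<omega> by auto
      qed simp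
    qed
    then have "measure M ?Z \<le> measure M (?Q (x + d) \<union> B)"
      using B(1) by (intro finite_measure_mono) simp_all
    also have "\<dots> \<le> measure M (?Q (x + d)) + measure M B" using B(1) by (intro measure_Un_le) auto
    finally have up: "measure M ?Z < measure M (?Q (x + d)) + e / 3" using B(2) by simp
    have "?Q (x - d) \<subseteq> ?Z \<union> B"
    proof
      fix \<omega> assume \<omega>: "\<omega> \<in> ?Q (x - d)"
      show "\<omega> \<in> ?Z \<union> B"
      proof (cases "\<omega> \<in> B")
        case False
        then obtain z where "Z k \<omega> = ereal z" "\<bar>z - Q k \<omega>\<bar> < d" using ZQ[of \<omega>] \<omega> by auto
        then show ?thesis using \<omega> by auto
      qed simp
    qed
    then have "measure M (?Q (x - d)) \<le> measure M (?Z \<union> B)"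
      using B(1) by (intro finite_measure_mono) simp_all
    also have "\<dots> \<le> measure M ?Z + measure M B" using B(1) by (intro measure_Un_le) auto
    finally have lo: "measure M (?Q (x - d)) < measure M ?Z + e / 3" using B(2) by simp
    show ?case using up lo elim(2,3) d unfolding dist_real_def by linarith
  qed
qed

end

section \<open>Normal limits\<close>

lemma normal_as_scaled_standard:
  assumes "0 < \<sigma>"
  shows "density lborel (normal_density 0 \<sigma>) = distr std_normal_distribution borel (\<lambda>z. \<sigma> * z)"
proof -
  interpret std: prob_space std_normal_distribution by (rule prob_space_normal_density) simp
  have "distributed std_normal_distribution lborel (\<lambda>x. x) std_normal_density"
    by (simp add: distributed_def) (auto intro!: measure_eqI simp: emeasure_distr)
  from std.normal_density_affine[OF this, of \<sigma> 0] assms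
  have "distributed std_normal_distribution lborel (\<lambda>x. \<sigma> * x) (normal_density 0 \<sigma>)" by simp
  then have "density lborel (normal_density 0 \<sigma>) = distr std_normal_distribution lborel (\<lambda>z. \<sigma> * z)"
    by (simp add: distributed_distr_eq_density)
  also have "\<dots> = distr std_normal_distribution borel (\<lambda>z. \<sigma> * z)" by (rule distr_cong) auto
  finally show ?thesis .
qed

lemma char_normal:
  assumes "0 < \<sigma>"
  shows "char (density lborel (normal_density 0 \<sigma>)) t = exp (- ((\<sigma> * t)\<^sup>2 / 2))"
proof -
  have "char (density lborel (normal_density 0 \<sigma>)) t = char std_normal_distribution (\<sigma> * t)"
    unfolding normal_as_scaled_standard[OF assms] char_def
    by (subst integral_distr) (auto simp: mult_ac)
  then show ?thesis by (simp add: char_std_normal_distribution)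
qed

lemma real_distribution_normal:
  assumes "0 < \<sigma>" shows "real_distribution (density lborel (normal_density 0 \<sigma>))"
  unfolding real_distribution_def real_distribution_axioms_def
  using prob_space_normal_density[OF assms] by simp

lemma null_sets_density_lborel:
  fixes f :: "real \<Rightarrow> ennreal"
  assumes "f \<in> borel_measurable borel" "A \<in> null_sets lborel"
  shows "A \<in> null_sets (density lborel f)"
proof -
  have "AE x in lborel. x \<in> A \<longrightarrow> f x = 0" using AE_not_in[OF assms(2)] by eventually_elim simp
  then show ?thesis using assms by (subst null_sets_density_iff) auto
qed

lemma isCont_cdf_density:
  fixes f :: "real \<Rightarrow> ennreal"
  assumes "real_distribution (density lborel f)" "f \<in> borel_measurable borel"
  shows "isCont (cdf (density lborel f)) x"
proof -
  interpret real_distribution "density lborel f" by fact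
  have "{x} \<in> null_sets (density lborel f)"
    using assms(2) by (intro null_sets_density_lborel countable_imp_null_set_lborel) auto
  then show ?thesis unfolding isCont_cdf by (simp add: measure_eq_0_null_sets)
qed

text \<open>By independence the characteristic function of the sum is a product; each factor converges, and the
product of the limits is the characteristic function of a centred normal law.\<close>

lemma (in prob_space) weak_conv_indep_normal_combination:
  assumes ind: "\<And>k. indep_var borel (A k) borel (B k)"
    and \<sigma>: "0 < \<sigma>" "0 < \<tau>" and ab: "\<alpha> \<noteq> 0" "\<beta> \<noteq> (0::real)"
    and A: "weak_conv_m (\<lambda>k. distr M borel (A k)) (density lborel (normal_density 0 \<sigma>))"
    and B: "weak_conv_m (\<lambda>k. distr M borel (B k)) (density lborel (normal_density 0 \<tau>))"
  shows "weak_conv_m (\<lambda>k. distr M borel (\<lambda>\<omega>. \<alpha> * A k \<omega> + \<beta> * B k \<omega>))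
    (density lborel (normal_density 0 (sqrt ((\<alpha> * \<sigma>)\<^sup>2 + (\<beta> * \<tau>)\<^sup>2))))"
proof (rule levy_continuity)
  have Am [measurable]: "random_variable borel (A k)" and Bm [measurable]: "random_variable borel (B k)" for k
    using indep_var_rv1[OF ind] indep_var_rv2[OF ind] by auto
  show "real_distribution (distr M borel (\<lambda>\<omega>. \<alpha> * A k \<omega> + \<beta> * B k \<omega>))" for k by simp
  have pos: "0 < sqrt ((\<alpha> * \<sigma>)\<^sup>2 + (\<beta> * \<tau>)\<^sup>2)" using \<sigma> ab by (simp add: add_pos_nonneg)
  then show "real_distribution (density lborel (normal_density 0 (sqrt ((\<alpha> * \<sigma>)\<^sup>2 + (\<beta> * \<tau>)\<^sup>2))))"
    by (rule real_distribution_normal)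
  fix t
  have scale: "char (distr M borel (\<lambda>\<omega>. c * C \<omega>)) t = char (distr M borel C) (c * t)"
    if [measurable]: "random_variable borel C" for c :: real and C
    unfolding char_def by (simp add: integral_distr mult_ac)
  have "char (distr M borel (\<lambda>\<omega>. \<alpha> * A k \<omega> + \<beta> * B k \<omega>)) t
      = char (distr M borel (A k)) (\<alpha> * t) * char (distr M borel (B k)) (\<beta> * t)" for k
  proof -
    have "indep_var borel ((\<lambda>x. \<alpha> * x) \<circ> A k) borel ((\<lambda>x. \<beta> * x) \<circ> B k)"
      by (rule indep_var_compose[OF ind]) auto
    then have "indep_var borel (\<lambda>\<omega>. \<alpha> * A k \<omega>) borel (\<lambda>\<omega>. \<beta> * B k \<omega>)" by (simp add: comp_def)
    from char_distr_add[OF this, of t] show ?thesis by (simp add: scale)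
  qed
  moreover have "(\<lambda>k. char (distr M borel (A k)) (\<alpha> * t) * char (distr M borel (B k)) (\<beta> * t)) \<longlonglongrightarrow>
      char (density lborel (normal_density 0 \<sigma>)) (\<alpha> * t) * char (density lborel (normal_density 0 \<tau>)) (\<beta> * t)"
    by (intro tendsto_mult levy_continuity1 A B real_distribution_normal \<sigma>) auto
  moreover have "char (density lborel (normal_density 0 \<sigma>)) (\<alpha> * t) * char (density lborel (normal_density 0 \<tau>)) (\<beta> * t)
      = char (density lborel (normal_density 0 (sqrt ((\<alpha> * \<sigma>)\<^sup>2 + (\<beta> * \<tau>)\<^sup>2)))) t"
  proof -
    have "- ((\<sigma> * (\<alpha> * t))\<^sup>2 / 2) + - ((\<tau> * (\<beta> * t))\<^sup>2 / 2) = - ((sqrt ((\<alpha> * \<sigma>)\<^sup>2 + (\<beta> * \<tau>)\<^sup>2) * t)\<^sup>2 / 2)"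
      by (simp add: power_mult_distrib field_simps)
    then show ?thesis
      unfolding char_normal[OF \<sigma>(1)] char_normal[OF \<sigma>(2)] char_normal[OF pos]
      by (metis exp_add of_real_mult)
  qed
  ultimately show "(\<lambda>k. char (distr M borel (\<lambda>\<omega>. \<alpha> * A k \<omega> + \<beta> * B k \<omega>)) t) \<longlonglongrightarrow>
      char (density lborel (normal_density 0 (sqrt ((\<alpha> * \<sigma>)\<^sup>2 + (\<beta> * \<tau>)\<^sup>2)))) t" by simp
qed

text \<open>The set \<open>{x. c x\<^sup>2 \<le> y}\<close> has at most two boundary points, so it is a continuity set of the normal
law.\<close>

lemma (in prob_space) square_of_asymptotically_normal:
  assumes x [measurable]: "\<And>k. x k \<in> borel_measurable M" and c: "0 < c" "0 < \<tau>"
    and conv: "weak_conv_m (\<lambda>k. distr M borel (x k)) (density lborel (normal_density 0 \<tau>))"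
  shows "(\<lambda>k. measure M {\<omega> \<in> space M. c * (x k \<omega>)\<^sup>2 \<le> y}) \<longlonglongrightarrow> cdf (scaled_chi_square_1 (c * \<tau>\<^sup>2)) y"
proof -
  let ?N = "density lborel (normal_density 0 \<tau>)"
  let ?A = "{x :: real. c * x\<^sup>2 \<le> y}"
  have A [measurable]: "?A \<in> sets borel" by measurable
  have "open {x :: real. c * x\<^sup>2 < y}" by (intro open_Collect_less continuous_intros)
  then have "{x :: real. c * x\<^sup>2 < y} \<subseteq> interior ?A" by (intro interior_maximal) auto
  moreover have "closed ?A" by (intro closed_Collect_le continuous_intros)
  ultimately have "frontier ?A \<subseteq> ?A - {x. c * x\<^sup>2 < y}" by (auto simp only: frontier_def closure_closed)
  also have "\<dots> \<subseteq> {x. c * x\<^sup>2 = y}" by auto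
  also have "\<dots> \<subseteq> {sqrt (y / c), - sqrt (y / c)}"
  proof
    fix x assume "x \<in> {x. c * x\<^sup>2 = y}"
    then have "y / c = x\<^sup>2" using c by auto
    then have "sqrt (y / c) = \<bar>x\<bar>" by simp
    then show "x \<in> {sqrt (y / c), - sqrt (y / c)}" by auto
  qed
  finally have "countable (frontier ?A)" by (rule countable_subset) simp
  then have "frontier ?A \<in> null_sets lborel" by (rule countable_imp_null_set_lborel)
  then have fr: "emeasure ?N (frontier ?A) = 0"
    by (intro null_setsD1 null_sets_density_lborel) auto
  have "(\<lambda>k. measure (distr M borel (x k)) ?A) \<longlonglongrightarrow> measure ?N ?A"
    by (rule weak_conv_imp_continuity_set_conv[OF _ real_distribution_normal[OF c(2)] conv A fr]) simp
  moreover have "measure (distr M borel (x k)) ?A = measure M {\<omega> \<in> space M. c * (x k \<omega>)\<^sup>2 \<le> y}" for k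
    by (subst measure_distr) (auto intro!: arg_cong[where f="measure M"])
  moreover have "measure ?N ?A = cdf (scaled_chi_square_1 (c * \<tau>\<^sup>2)) y"
    unfolding normal_as_scaled_standard[OF c(2)] scaled_chi_square_1_def cdf_def
    by (subst (1 2) measure_distr) (auto intro!: arg_cong[where f="measure std_normal_distribution"] simp: power_mult_distrib mult_ac)
  ultimately show ?thesis by simp
qed

section \<open>Measurability and independence of the observed samples\<close>

lemma time_measurable [measurable]: "(\<lambda>t. t j) \<in> borel_measurable times_space"
  unfolding times_space_def by (rule measurable_component_singleton) simp

lemma times_space_measurableI:
  assumes "\<And>j. (\<lambda>z. f z j) \<in> borel_measurable N"
  shows "f \<in> measurable N times_space"
  unfolding times_space_def using assms by (intro measurable_PiM_single') (auto simp: PiE_def)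

lemma obs_measurableI:
  assumes "\<And>j. (\<lambda>z. f z j) \<in> borel_measurable N" "d \<in> measurable N (count_space UNIV)"
  shows "(\<lambda>z. (f z, d z)) \<in> measurable N obs_space"
  unfolding obs_space_def by (intro measurable_Pair times_space_measurableI assms)

lemma observe_measurable:
  assumes x [measurable]: "x \<in> borel_measurable N" and t: "t \<in> measurable N times_space"
  shows "(\<lambda>z. observe S n i (x z) (t z)) \<in> measurable N obs_space"
proof -
  have tj [measurable]: "(\<lambda>z. t z j) \<in> borel_measurable N" for j
    by (rule measurable_compose[OF t time_measurable])
  have one: "(\<lambda>z. one_time (u z) j) \<in> borel_measurable N" if [measurable]: "u \<in> borel_measurable N" for u j
    unfolding one_time_def by measurable
  have two: "(\<lambda>z. two_times (u z) (v z) j) \<in> borel_measurable N"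
    if [measurable]: "u \<in> borel_measurable N" "v \<in> borel_measurable N" for u v j
    unfolding two_times_def by measurable
  have many: "(\<lambda>z. if j < m then t z j else 0) \<in> borel_measurable N" for j m
    by (cases "j < m") (simp_all add: tj)
  have card: "(\<lambda>z. card {j. j < m \<and> t z j < x z}) \<in> measurable N (count_space UNIV)" for m :: nat
  proof (rule measurable_card)
    fix i
    have "{z \<in> space N. t z i < x z} \<in> sets N" by measurable
    then show "{z \<in> space N. i \<in> {j. j < m \<and> t z j < x z}} \<in> sets N" by (cases "i < m") simp_all
  qed
  have le: "{z \<in> space N. x z \<le> t z j} \<in> sets N" and gt: "{z \<in> space N. t z j < x z} \<in> sets N"
    and between: "{z \<in> space N. t z j < x z \<and> x z \<le> t z k} \<in> sets N" for j k by measurable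
  have const: "(\<lambda>z. c) \<in> measurable N (count_space UNIV)" for c :: nat by simp
  note rules = obs_measurableI one two many card x tj const le gt between
  show ?thesis
  proof (cases S)
    case (Partly_Case1 \<kappa>)
    then show ?thesis by (cases "i < \<kappa> n") (simp_all add: rules measurable_If)
  next
    case (Partly_General \<kappa> m)
    then show ?thesis by (cases "i < \<kappa> n") (simp_all add: rules)
  qed (simp_all add: rules measurable_If)
qed

lemma observed_sample_measurable:
  assumes "\<And>i. i < n \<Longrightarrow> X i \<in> borel_measurable N" "\<And>i. i < n \<Longrightarrow> T i \<in> measurable N times_space"
  shows "observed_sample S n X T \<in> measurable N (\<Pi>\<^sub>M i\<in>{..<n}. obs_space)"
  unfolding observed_sample_def
  by (rule measurable_restrict) (use assms in \<open>auto intro!: observe_measurable\<close>)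

lemma observed_sample_in_space: "observed_sample S n X T \<omega> \<in> space (\<Pi>\<^sub>M i\<in>{..<n}. obs_space)"
  unfolding space_PiM observed_sample_def
  by (auto simp: obs_space_def times_space_def space_pair_measure space_PiM)

text \<open>The two statistics depend on disjoint groups of subjects, and the family of all subjects is
independent.\<close>

lemma (in prob_space) indep_var_observed_samples:
  assumes ind: "indep_vars (\<lambda>_. borel \<Otimes>\<^sub>M times_space)
      (\<lambda>s \<omega>. case s of Inl i \<Rightarrow> (X i \<omega>, T i \<omega>) | Inr i \<Rightarrow> (Y i \<omega>, U i \<omega>)) (UNIV :: (nat + nat) set)"
    and f: "f \<in> borel_measurable (\<Pi>\<^sub>M i\<in>{..<n0}. obs_space)" and g: "g \<in> borel_measurable (\<Pi>\<^sub>M i\<in>{..<n1}. obs_space)"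
  shows "indep_var borel (\<lambda>\<omega>. f (observed_sample SX n0 X T \<omega>)) borel (\<lambda>\<omega>. g (observed_sample SY n1 Y U \<omega>))"
proof -
  define V where "V = (\<lambda>s \<omega>. case s of Inl i \<Rightarrow> (X i \<omega>, T i \<omega>) | Inr i \<Rightarrow> (Y i \<omega>, U i \<omega>))"
  define I J :: "(nat + nat) set" where "I = Inl ` {..<n0}" and "J = Inr ` {..<n1}"
  let ?B = "\<lambda>_ :: nat + nat. (borel :: real measure) \<Otimes>\<^sub>M times_space"
  have "indep_var (PiM I ?B) (\<lambda>\<omega>. restrict (\<lambda>s. V s \<omega>) I) (PiM J ?B) (\<lambda>\<omega>. restrict (\<lambda>s. V s \<omega>) J)"
    by (rule indep_var_restrict[OF ind[folded V_def]]) (auto simp: I_def J_def)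
  moreover have "(\<lambda>z. f (observed_sample SX n0 (\<lambda>i z. fst (z (Inl i))) (\<lambda>i z. snd (z (Inl i))) z)) \<in> borel_measurable (PiM I ?B)"
  proof (rule measurable_compose[OF observed_sample_measurable f])
    fix i assume "i < n0"
    then have c: "(\<lambda>z. z (Inl i)) \<in> measurable (PiM I ?B) (borel \<Otimes>\<^sub>M times_space)"
      by (intro measurable_component_singleton) (auto simp: I_def)
    show "(\<lambda>z. fst (z (Inl i))) \<in> borel_measurable (PiM I ?B)" "(\<lambda>z. snd (z (Inl i))) \<in> measurable (PiM I ?B) times_space"
      by (rule measurable_compose[OF c]; simp)+
  qed
  moreover have "(\<lambda>z. g (observed_sample SY n1 (\<lambda>i z. fst (z (Inr i))) (\<lambda>i z. snd (z (Inr i))) z)) \<in> borel_measurable (PiM J ?B)"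
  proof (rule measurable_compose[OF observed_sample_measurable g])
    fix i assume "i < n1"
    then have c: "(\<lambda>z. z (Inr i)) \<in> measurable (PiM J ?B) (borel \<Otimes>\<^sub>M times_space)"
      by (intro measurable_component_singleton) (auto simp: J_def)
    show "(\<lambda>z. fst (z (Inr i))) \<in> borel_measurable (PiM J ?B)" "(\<lambda>z. snd (z (Inr i))) \<in> measurable (PiM J ?B) times_space"
      by (rule measurable_compose[OF c]; simp)+
  qed
  ultimately have "indep_var
      borel ((\<lambda>z. f (observed_sample SX n0 (\<lambda>i z. fst (z (Inl i))) (\<lambda>i z. snd (z (Inl i))) z)) \<circ> (\<lambda>\<omega>. restrict (\<lambda>s. V s \<omega>) I))
      borel ((\<lambda>z. g (observed_sample SY n1 (\<lambda>i z. fst (z (Inr i))) (\<lambda>i z. snd (z (Inr i))) z)) \<circ> (\<lambda>\<omega>. restrict (\<lambda>s. V s \<omega>) J))"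
    by (rule indep_var_compose)
  moreover have "observed_sample SX n0 (\<lambda>i z. fst (z (Inl i))) (\<lambda>i z. snd (z (Inl i))) (restrict (\<lambda>s. V s \<omega>) I)
      = observed_sample SX n0 X T \<omega>" for \<omega>
    unfolding observed_sample_def by (intro restrict_ext) (auto simp: I_def V_def)
  moreover have "observed_sample SY n1 (\<lambda>i z. fst (z (Inr i))) (\<lambda>i z. snd (z (Inr i))) (restrict (\<lambda>s. V s \<omega>) J)
      = observed_sample SY n1 Y U \<omega>" for \<omega>
    unfolding observed_sample_def by (intro restrict_ext) (auto simp: J_def V_def)
  ultimately show ?thesis by (simp add: comp_def)
qed

section \<open>Consistency of Stieltjes integrals\<close>

context biased_weights
begin

lemma stieltjes_cdf:
  assumes \<mu>: "real_distribution \<mu>" and nonneg: "AE x in \<mu>. 0 \<le> x" and \<phi>: "\<phi> \<in> borel_measurable borel"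
  shows "stieltjes_integral (\<lambda>x. \<phi> (w x)) (cdf \<mu>) = (\<integral>x. \<phi> (w_plus x) \<partial>\<mu>)"
proof -
  interpret real_distribution \<mu> by fact
  have m: "(\<lambda>x. indicator {0..} x *\<^sub>R \<phi> (w x)) \<in> borel_measurable \<mu>" "(\<lambda>x. \<phi> (w_plus x)) \<in> borel_measurable \<mu>"
    using comp_w_measurable[OF \<phi>] measurable_compose[OF w_plus_measurable \<phi>] by simp_all
  show ?thesis
    unfolding stieltjes_integral_def set_lebesgue_integral_def interval_measure_cdf[OF finite_borel_measure_M]
  proof (rule integral_cong_AE[OF m])
    show "AE x in \<mu>. indicator {0..} x *\<^sub>R \<phi> (w x) = \<phi> (w_plus x)"
      using nonneg by eventually_elim (simp add: w_plus_def)
  qed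
qed

text \<open>A monotone function has only countably many discontinuities. The cutoff adds the point 0.\<close>

lemma discontinuities_countable:
  assumes w: "mono_on {0..} w \<or> antimono_on {0..} w" and \<phi>: "\<And>v. 0 \<le> v \<Longrightarrow> isCont \<phi> v"
  shows "countable {x. \<not> isCont (\<lambda>x. indicator {0..} x *\<^sub>R (\<phi> (w x) :: real)) x}"
proof (rule countable_subset)
  let ?g = "\<lambda>x. indicator {0..} x *\<^sub>R \<phi> (w x)"
  show "{x. \<not> isCont ?g x} \<subseteq> insert 0 {x\<in>{0<..}. \<not> isCont w x}"
  proof (rule subsetI, rule ccontr)
    fix x assume x: "x \<in> {x. \<not> isCont ?g x}" and "x \<notin> insert 0 {x\<in>{0<..}. \<not> isCont w x}"
    then consider "x < 0" | "0 < x" "isCont w x" by fastforce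
    then have "isCont ?g x"
    proof cases
      case 1
      then have "\<forall>\<^sub>F y in nhds x. y \<in> {..<0}" by (intro eventually_nhds_in_open) auto
      then have "\<forall>\<^sub>F y in nhds x. ?g y = 0" by eventually_elim simp
      from isCont_cong[OF this] show ?thesis by simp
    next
      case 2
      then have "\<forall>\<^sub>F y in nhds x. y \<in> {0<..}" by (intro eventually_nhds_in_open) auto
      then have "\<forall>\<^sub>F y in nhds x. ?g y = \<phi> (w y)" by eventually_elim simp
      moreover have "isCont (\<lambda>y. \<phi> (w y)) x" using 2 w_nonneg[of x] by (intro isCont_o2[OF _ \<phi>]) auto
      ultimately show ?thesis by (rule isCont_cong[THEN iffD2])
    qed
    with x show False by simp
  qed
  have c: "countable {x\<in>{0<..}. \<not> isCont v x}" if "mono_on {0..} v" for v :: "real \<Rightarrow> real"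
    by (rule mono_on_ctble_discont_open) (use that in \<open>auto simp: monotone_on_def\<close>)
  have "countable {x\<in>{0<..}. \<not> isCont w x}"
    using w
  proof
    assume "antimono_on {0..} w"
    then have "mono_on {0..} (\<lambda>x. - w x)" by (auto simp: monotone_on_def)
    moreover have "isCont (\<lambda>x. - w x) x \<longleftrightarrow> isCont w x" for x
      using continuous_minus[of "at x" w] continuous_minus[of "at x" "\<lambda>x. - w x"] by auto
    ultimately show ?thesis using c[of "\<lambda>x. - w x"] by simp
  qed (rule c)
  then show "countable (insert 0 {x\<in>{0<..}. \<not> isCont w x})" by simp
qed

text \<open>The limit law has a density, so the countably many discontinuities of the integrand are null and weak
convergence of the measures is enough. The estimators may miss mass; their masses tend to 1 because the
limit is a proper distribution, and \<open>u k\<close> is the estimator normalized to a probability measure.\<close>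

lemma stieltjes_limit:
  fixes Fk :: "nat \<Rightarrow> real \<Rightarrow> real" and f :: "real \<Rightarrow> ennreal"
  assumes w: "mono_on {0..} w \<or> antimono_on {0..} w"
    and step: "\<And>k. step_df (Fk k)"
    and \<mu>: "real_distribution (density lborel f)" and f: "f \<in> borel_measurable borel"
    and lim: "\<And>x. (\<lambda>k. Fk k x) \<longlonglongrightarrow> cdf (density lborel f) x"
    and \<phi>: "\<And>v. 0 \<le> v \<Longrightarrow> isCont \<phi> v" "\<And>v. 0 \<le> v \<Longrightarrow> \<bar>\<phi> v\<bar> \<le> B" "\<phi> \<in> borel_measurable borel" and B: "0 \<le> B"
  shows "(\<lambda>k. stieltjes_integral (\<lambda>x. \<phi> (w x)) (Fk k)) \<longlonglongrightarrow> stieltjes_integral (\<lambda>x. \<phi> (w x)) (cdf (density lborel f))"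
proof -
  define \<mu> where "\<mu> = density lborel f"
  interpret \<mu>: real_distribution \<mu> using assms(3) by (simp add: \<mu>_def)
  define mass where "mass k = total_mass (Fk k)" for k
  have fin: "finite_borel_measure (interval_measure (Fk k))" for k by (rule finite_borel_measure_step_df[OF step])
  have mass_le: "mass k \<le> 1" and mass_ge: "Fk k x \<le> mass k" for k x
  proof -
    show "mass k \<le> 1" using step_df_representation(6)[OF step, of k] by (simp add: mass_def total_mass_step_df[OF step])
    show "Fk k x \<le> mass k"
      using finite_borel_measure.cdf_bounded[OF fin, of k x] by (simp add: cdf_step_df[OF step] mass_def total_mass_def)
  qed
  have mass: "mass \<longlonglongrightarrow> 1"
  proof (rule order_tendstoI)
    fix a :: real assume "a < 1"
    then have "\<forall>\<^sub>F x in at_top. a < cdf \<mu> x" using \<mu>.cdf_lim_at_top_prob by (intro order_tendstoD(1)) auto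
    then obtain x where "a < cdf \<mu> x" using eventually_happens'[OF trivial_limit_at_top_linorder] by blast
    from order_tendstoD(1)[OF lim[of x, folded \<mu>_def] this]
    show "\<forall>\<^sub>F k in sequentially. a < mass k" by eventually_elim (rule less_le_trans[OF _ mass_ge])
  next
    fix a :: real assume "1 < a"
    then show "\<forall>\<^sub>F k in sequentially. mass k < a" using mass_le by (auto intro!: always_eventually intro: le_less_trans)
  qed
  define u where "u k = (if 0 < mass k then density (interval_measure (Fk k)) (\<lambda>_. ennreal (1 / mass k)) else \<mu>)" for k
  have pos: "\<forall>\<^sub>F k in sequentially. 0 < mass k" using mass by (rule order_tendstoD(1)) simp
  have u_meas: "measure (u k) A = measure (interval_measure (Fk k)) A / mass k" if "0 < mass k" "A \<in> sets borel" for k A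
    using that by (simp add: u_def measure_density_const)
  have u: "real_distribution (u k)" for k
  proof (cases "0 < mass k")
    case True
    interpret fk: finite_borel_measure "interval_measure (Fk k)" by (rule fin)
    have "emeasure (interval_measure (Fk k)) UNIV = ennreal (mass k)"
      by (simp add: fk.emeasure_eq_measure mass_def total_mass_def)
    then have "emeasure (u k) (space (u k)) = ennreal (1 / mass k) * ennreal (mass k)"
      using True by (simp add: u_def emeasure_density_const)
    also have "\<dots> = 1" using True by (simp add: ennreal_mult[symmetric])
    finally have "prob_space (u k)" by (rule prob_spaceI)
    then show ?thesis using True
      by (simp add: real_distribution_def real_distribution_axioms_def u_def)
  qed (simp add: u_def \<mu>.real_distribution_axioms)
  have "weak_conv_m u \<mu>"
    unfolding weak_conv_m_def weak_conv_def
  proof (intro allI impI)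
    fix x
    have "(\<lambda>k. Fk k x / mass k) \<longlonglongrightarrow> cdf \<mu> x / 1" using lim[of x] mass by (intro tendsto_divide) (auto simp: \<mu>_def)
    moreover have "\<forall>\<^sub>F k in sequentially. Fk k x / mass k = cdf (u k) x"
      using pos
    proof eventually_elim
      case (elim k)
      have "cdf (interval_measure (Fk k)) x = Fk k x" by (simp add: cdf_step_df[OF step])
      then show ?case using u_meas[OF elim, of "{..x}"] by (simp add: cdf_def)
    qed
    ultimately show "(\<lambda>k. cdf (u k) x) \<longlonglongrightarrow> cdf \<mu> x" by (simp add: tendsto_cong)
  qed
  let ?g = "\<lambda>x. indicator {0..} x *\<^sub>R \<phi> (w x)"
  have g: "?g \<in> borel_measurable borel" by (rule comp_w_measurable[OF \<phi>(3)])
  have "(\<lambda>k. integral\<^sup>L (u k) ?g) \<longlonglongrightarrow> integral\<^sup>L \<mu> ?g"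
  proof (rule weak_conv_imp_bdd_ae_continuous_conv[OF u \<mu>.real_distribution_axioms \<open>weak_conv_m u \<mu>\<close> _ _ g])
    show "emeasure \<mu> {x. \<not> isCont ?g x} = 0"
      unfolding \<mu>_def
      by (intro null_setsD1 null_sets_density_lborel f countable_imp_null_set_lborel discontinuities_countable w \<phi>)
    show "norm (?g x) \<le> B" for x using \<phi>(2)[of "w x"] w_nonneg[of x] B by (cases "0 \<le> x") auto
  qed
  from tendsto_mult[OF mass this] have "(\<lambda>k. mass k * integral\<^sup>L (u k) ?g) \<longlonglongrightarrow> integral\<^sup>L \<mu> ?g" by simp
  moreover have "\<forall>\<^sub>F k in sequentially. mass k * integral\<^sup>L (u k) ?g = stieltjes_integral (\<lambda>x. \<phi> (w x)) (Fk k)"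
    using pos
  proof eventually_elim
    case (elim k)
    have "integral\<^sup>L (u k) ?g = (1 / mass k) * integral\<^sup>L (interval_measure (Fk k)) ?g"
    proof -
      have "integral\<^sup>L (u k) ?g = (\<integral>x. (1 / mass k) *\<^sub>R ?g x \<partial>interval_measure (Fk k))"
        unfolding u_def if_P[OF elim] using elim g
        by (intro integral_density) (auto simp: measurable_cong_sets[OF sets_interval_measure refl])
      then show ?thesis by simp
    qed
    then show ?case using elim by (simp add: stieltjes_integral_def set_lebesgue_integral_def)
  qed
  moreover have "integral\<^sup>L \<mu> ?g = stieltjes_integral (\<lambda>x. \<phi> (w x)) (cdf (density lborel f))"
    unfolding stieltjes_integral_def set_lebesgue_integral_def \<mu>_def[symmetric]
      interval_measure_cdf[OF \<mu>.finite_borel_measure_M] ..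
  ultimately show ?thesis by (simp add: tendsto_cong)
qed

end

section \<open>Population moments\<close>

lemma integral_pos_if_not_AE_zero:
  fixes f :: "'a \<Rightarrow> real"
  assumes "integrable M f" "\<And>x. 0 \<le> f x" "\<not> (AE x in M. f x = 0)"
  shows "0 < integral\<^sup>L M f"
proof -
  have "0 \<le> integral\<^sup>L M f" using assms(2) by (intro integral_nonneg_AE) simp
  moreover have "integral\<^sup>L M f \<noteq> 0"
    using integral_nonneg_eq_0_iff_AE[OF assms(1)] assms(2,3) by simp
  ultimately show ?thesis by simp
qed

context biased_weights
begin

text \<open>The first identity holds because \<open>g0 = \<theta>0 w f0\<close>, and it is equivalent to the second, since both integrands
are affine functions of \<open>bias\<close>. The pooled population \<open>\<rho>0 F0 + \<rho>1 G0\<close> therefore gives \<open>bias\<close> the mean \<open>\<rho>1\<close>. The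
two inequalities are positivity of its variance, which fails only if \<open>w\<close> is almost
everywhere constant, and of the mean of \<open>bias (1 - bias)\<close>, which vanishes only if \<open>w\<close> is almost everywhere 0.\<close>

lemma population_moments:
  fixes f0 g0 :: "real \<Rightarrow> real"
  assumes f0 [measurable]: "f0 \<in> borel_measurable borel" and f0_nonneg: "\<And>x. 0 \<le> f0 x"
    and f0_support: "\<And>x. x < 0 \<Longrightarrow> f0 x = 0" and g0: "\<And>x. g0 x = \<theta>0 * w x * f0 x"
    and PF: "prob_space (density lborel f0)" and PG: "prob_space (density lborel g0)"
    and nonconst: "\<not> (\<exists>c. AE x in density lborel f0. w x = c)"
  defines "EF \<equiv> \<lambda>\<phi> :: real \<Rightarrow> real. \<integral>x. \<phi> (w_plus x) \<partial>density lborel f0"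
    and "EG \<equiv> \<lambda>\<phi> :: real \<Rightarrow> real. \<integral>x. \<phi> (w_plus x) \<partial>density lborel g0"
  shows "EF (\<lambda>v. \<theta>0 * v / (\<rho>0 + \<rho>1 * \<theta>0 * v)) = EG (\<lambda>v. 1 / (\<rho>0 + \<rho>1 * \<theta>0 * v))"
    and "\<rho>0 * EF bias + \<rho>1 * EG bias = \<rho>1"
    and "\<rho>1\<^sup>2 < \<rho>0 * EF (\<lambda>v. (bias v)\<^sup>2) + \<rho>1 * EG (\<lambda>v. (bias v)\<^sup>2)"
    and "\<rho>0 * EF (\<lambda>v. (bias v)\<^sup>2) + \<rho>1 * EG (\<lambda>v. (bias v)\<^sup>2) < \<rho>1"
    and "AE x in density lborel f0. 0 \<le> x" "AE x in density lborel g0. 0 \<le> x"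
proof -
  interpret PF: prob_space "density lborel f0" by fact
  interpret PG: prob_space "density lborel g0" by fact
  have prob_UNIV: "measure (density lborel f0) UNIV = 1" "measure (density lborel g0) UNIV = 1"
    using PF.prob_space PG.prob_space by simp_all
  have g0_plus: "g0 x = \<theta>0 * w_plus x * f0 x" for x
    using f0_support[of x] by (cases "0 \<le> x") (auto simp: g0 w_plus_def)
  then have g0_eq: "g0 = (\<lambda>x. \<theta>0 * w_plus x * f0 x)" by auto
  have g0m [measurable]: "g0 \<in> borel_measurable borel" unfolding g0_eq by measurable
  have wp: "0 \<le> w_plus x" for x using w_nonneg[of x] by (simp add: w_plus_def)
  have g0_nonneg: "0 \<le> g0 x" for x unfolding g0_plus using theta_pos wp f0_nonneg by simp
  have D: "0 < \<rho>0 + \<rho>1 * \<theta>0 * w_plus x" for x by (rule denominator_pos[OF wp theta_pos])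
  have "0 \<le> x" if "0 < ennreal (f0 x)" for x using that f0_support[of x] by (cases "x < 0") auto
  then show posF: "AE x in density lborel f0. 0 \<le> x" by (simp add: AE_density)
  have "0 \<le> x" if "0 < ennreal (g0 x)" for x using that f0_support[of x] g0[of x] by (cases "x < 0") auto
  then show "AE x in density lborel g0. 0 \<le> x" by (simp add: AE_density)
  show one: "EF (\<lambda>v. \<theta>0 * v / (\<rho>0 + \<rho>1 * \<theta>0 * v)) = EG (\<lambda>v. 1 / (\<rho>0 + \<rho>1 * \<theta>0 * v))"
  proof -
    have "EF (\<lambda>v. \<theta>0 * v / (\<rho>0 + \<rho>1 * \<theta>0 * v)) = (\<integral>x. f0 x *\<^sub>R (\<theta>0 * w_plus x / (\<rho>0 + \<rho>1 * \<theta>0 * w_plus x)) \<partial>lborel)"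
      unfolding EF_def by (rule integral_density) (simp_all add: f0_nonneg)
    also have "\<dots> = (\<integral>x. g0 x *\<^sub>R (1 / (\<rho>0 + \<rho>1 * \<theta>0 * w_plus x)) \<partial>lborel)"
      by (intro arg_cong[where f="integral\<^sup>L lborel"] ext) (simp add: g0_plus)
    also have "\<dots> = EG (\<lambda>v. 1 / (\<rho>0 + \<rho>1 * \<theta>0 * v))"
      unfolding EG_def by (rule integral_density[symmetric]) (simp_all add: g0_nonneg)
    finally show ?thesis .
  qed
  have q: "0 \<le> bias (w_plus x)" "bias (w_plus x) < 1" for x using bias_range[OF wp] by auto
  have int: "integrable (density lborel f) (\<lambda>x. \<phi> (bias (w_plus x)))"
    if "prob_space (density lborel f)" "\<phi> \<in> borel_measurable borel" "\<And>q. 0 \<le> q \<Longrightarrow> q < 1 \<Longrightarrow> \<bar>\<phi> q\<bar> \<le> 4" for f and \<phi> :: "real \<Rightarrow> real"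
  proof -
    interpret prob_space "density lborel f" by (rule that(1))
    have [measurable]: "\<phi> \<in> borel_measurable borel" by (rule that(2))
    show ?thesis using q by (intro integrable_const_bound[where B=4]) (auto intro!: AE_I2 that(3))
  qed
  have i1: "integrable (density lborel f) (\<lambda>x. bias (w_plus x))"
    and i2: "integrable (density lborel f) (\<lambda>x. (bias (w_plus x))\<^sup>2)" if "prob_space (density lborel f)" for f
  proof -
    have sq: "q\<^sup>2 \<le> 4" if "0 \<le> q" "q < 1" for q :: real using that power_le_one[of q 2] by linarith
    show "integrable (density lborel f) (\<lambda>x. bias (w_plus x))" by (rule int[OF that, of "\<lambda>q. q"]) auto
    show "integrable (density lborel f) (\<lambda>x. (bias (w_plus x))\<^sup>2)" by (rule int[OF that, of "\<lambda>q. q\<^sup>2"]) (auto simp: sq)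
  qed
  have h1: "\<theta>0 * w_plus x / (\<rho>0 + \<rho>1 * \<theta>0 * w_plus x) = bias (w_plus x) / \<rho>1" for x
    using rho_pos by (simp add: bias_def)
  have h0: "1 / (\<rho>0 + \<rho>1 * \<theta>0 * w_plus x) = (1 - bias (w_plus x)) / \<rho>0" for x
  proof -
    have "bias (w_plus x) = 1 - \<rho>0 / (\<rho>0 + \<rho>1 * \<theta>0 * w_plus x)"
      using D[of x] by (simp add: bias_def field_simps)
    then show ?thesis using rho_pos by simp
  qed
  have "EF bias / \<rho>1 = (1 - EG bias) / \<rho>0"
    using one unfolding EF_def EG_def h1 h0 by (simp add: i1[OF PG] prob_UNIV)
  then show mean: "\<rho>0 * EF bias + \<rho>1 * EG bias = \<rho>1" using rho_pos by (simp add: field_simps)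
  define lam where "lam = \<rho>0 * EF (\<lambda>v. (bias v)\<^sup>2) + \<rho>1 * EG (\<lambda>v. (bias v)\<^sup>2)"
  have varF: "(\<integral>x. (bias (w_plus x) - \<rho>1)\<^sup>2 \<partial>density lborel f0) = EF (\<lambda>v. (bias v)\<^sup>2) - 2 * \<rho>1 * EF bias + \<rho>1\<^sup>2"
    unfolding EF_def power2_diff using i1[OF PF] i2[OF PF] by (simp add: prob_UNIV)
  have varG: "(\<integral>x. (bias (w_plus x) - \<rho>1)\<^sup>2 \<partial>density lborel g0) = EG (\<lambda>v. (bias v)\<^sup>2) - 2 * \<rho>1 * EG bias + \<rho>1\<^sup>2"
    unfolding EG_def power2_diff using i1[OF PG] i2[OF PG] by (simp add: prob_UNIV)
  have binF: "(\<integral>x. bias (w_plus x) - (bias (w_plus x))\<^sup>2 \<partial>density lborel f0) = EF bias - EF (\<lambda>v. (bias v)\<^sup>2)"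
    unfolding EF_def using i1[OF PF] i2[OF PF] by simp
  have binG: "(\<integral>x. bias (w_plus x) - (bias (w_plus x))\<^sup>2 \<partial>density lborel g0) = EG bias - EG (\<lambda>v. (bias v)\<^sup>2)"
    unfolding EG_def using i1[OF PG] i2[OF PG] by simp
  have "lam - \<rho>1\<^sup>2 = \<rho>0 * (EF (\<lambda>v. (bias v)\<^sup>2) - 2 * \<rho>1 * EF bias + \<rho>1\<^sup>2)
      + \<rho>1 * (EG (\<lambda>v. (bias v)\<^sup>2) - 2 * \<rho>1 * EG bias + \<rho>1\<^sup>2)"
  proof -
    have "\<rho>0 * (EF (\<lambda>v. (bias v)\<^sup>2) - 2 * \<rho>1 * EF bias + \<rho>1\<^sup>2)
      + \<rho>1 * (EG (\<lambda>v. (bias v)\<^sup>2) - 2 * \<rho>1 * EG bias + \<rho>1\<^sup>2)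
      = lam - 2 * \<rho>1 * (\<rho>0 * EF bias + \<rho>1 * EG bias) + (\<rho>0 + \<rho>1) * \<rho>1\<^sup>2"
      by (simp add: lam_def algebra_simps)
    also have "\<dots> = lam - \<rho>1\<^sup>2" unfolding mean rho_sum by (simp add: power2_eq_square)
    finally show ?thesis by simp
  qed
  moreover have "0 < (\<integral>x. (bias (w_plus x) - \<rho>1)\<^sup>2 \<partial>density lborel f0)"
  proof -
    have "integrable (density lborel f0) (\<lambda>x. (bias (w_plus x) - \<rho>1)\<^sup>2)"
      unfolding power2_diff using i1[OF PF] i2[OF PF] by simp
    moreover have "\<not> (AE x in density lborel f0. (bias (w_plus x) - \<rho>1)\<^sup>2 = 0)"
    proof
      assume "AE x in density lborel f0. (bias (w_plus x) - \<rho>1)\<^sup>2 = 0"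
      with posF have "AE x in density lborel f0. w x = 1 / \<theta>0"
      proof eventually_elim
        case (elim x)
        then have "bias (w x) = \<rho>1" by (simp add: w_plus_def)
        then have "\<rho>1 * (\<theta>0 * w x) = \<rho>1 * (\<rho>0 + \<rho>1 * \<theta>0 * w x)"
          using D[of x] elim by (simp add: bias_def w_plus_def field_simps)
        then have "\<theta>0 * w x = \<rho>0 + \<rho>1 * (\<theta>0 * w x)" using rho_pos by (simp add: mult.assoc)
        moreover have "\<rho>1 = 1 - \<rho>0" using rho_sum by simp
        ultimately have "\<rho>0 * (\<theta>0 * w x) = \<rho>0" by (simp add: algebra_simps)
        then show ?case using rho_pos theta_pos by (simp add: field_simps)
      qed
      with nonconst show False by blast
    qed
    ultimately show ?thesis by (intro integral_pos_if_not_AE_zero) auto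
  qed
  moreover have "0 \<le> (\<integral>x. (bias (w_plus x) - \<rho>1)\<^sup>2 \<partial>density lborel g0)" by simp
  ultimately have "0 < lam - \<rho>1\<^sup>2"
    unfolding varF varG using rho_pos by (simp add: add_pos_nonneg)
  then show "\<rho>1\<^sup>2 < \<rho>0 * EF (\<lambda>v. (bias v)\<^sup>2) + \<rho>1 * EG (\<lambda>v. (bias v)\<^sup>2)" by (simp add: lam_def)
  have "\<rho>1 - lam = \<rho>0 * (EF bias - EF (\<lambda>v. (bias v)\<^sup>2)) + \<rho>1 * (EG bias - EG (\<lambda>v. (bias v)\<^sup>2))"
    unfolding lam_def using mean by (simp add: algebra_simps)
  moreover have bin_nonneg: "0 \<le> bias (w_plus x) - (bias (w_plus x))\<^sup>2" for x
    using q[of x] by (simp add: power2_eq_square mult_left_le)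
  moreover have "0 < (\<integral>x. bias (w_plus x) - (bias (w_plus x))\<^sup>2 \<partial>density lborel f0)"
  proof -
    have "integrable (density lborel f0) (\<lambda>x. bias (w_plus x) - (bias (w_plus x))\<^sup>2)"
      using i1[OF PF] i2[OF PF] by simp
    moreover have "\<not> (AE x in density lborel f0. bias (w_plus x) - (bias (w_plus x))\<^sup>2 = 0)"
    proof
      assume "AE x in density lborel f0. bias (w_plus x) - (bias (w_plus x))\<^sup>2 = 0"
      with posF have "AE x in density lborel f0. w x = 0"
      proof eventually_elim
        case (elim x)
        then have "bias (w x) * (1 - bias (w x)) = 0" by (simp add: w_plus_def power2_eq_square algebra_simps)
        then have "bias (w x) = 0" using q(2)[of x] elim by (simp add: w_plus_def)
        then show ?case using D[of x] rho_pos theta_pos elim by (simp add: bias_def w_plus_def)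
      qed
      with nonconst show False by blast
    qed
    ultimately show ?thesis using bin_nonneg by (intro integral_pos_if_not_AE_zero)
  qed
  moreover have "0 \<le> (\<integral>x. bias (w_plus x) - (bias (w_plus x))\<^sup>2 \<partial>density lborel g0)"
    using bin_nonneg by (intro integral_nonneg_AE) simp
  ultimately have "0 < \<rho>1 - lam"
    unfolding binF binG using rho_pos by (simp add: add_pos_nonneg)
  then show "\<rho>0 * EF (\<lambda>v. (bias v)\<^sup>2) + \<rho>1 * EG (\<lambda>v. (bias v)\<^sup>2) < \<rho>1" by (simp add: lam_def)
qed

text \<open>The score at \<open>\<theta>0\<close> is a multiple of the left side of the estimating equation at \<open>\<theta>0\<close>, to which the central limit
theorem for the NPMLEs applies.\<close>

lemma pool_score_at_truth:
  assumes F: "step_df F" and G: "step_df G"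
  shows "(\<Sum>i<pool_size F G. pool_weight F G i * pool_bias F G i) - \<rho>1 * total_mass G
    = \<rho>0 * \<rho>1 * (stieltjes_integral (\<lambda>x. \<theta>0 * w x / (\<rho>0 + \<rho>1 * \<theta>0 * w x)) F
        - stieltjes_integral (\<lambda>x. 1 / (\<rho>0 + \<rho>1 * \<theta>0 * w x)) G)"
proof -
  let ?D = "\<lambda>v. \<rho>0 + \<rho>1 * \<theta>0 * v"
  have "(\<lambda>v. \<theta>0 * v / ?D v) \<in> borel_measurable borel" "(\<lambda>v. 1 / ?D v) \<in> borel_measurable borel" by measurable
  note m = comp_w_measurable[OF this(1)] comp_w_measurable[OF this(2)]
  have "(\<Sum>i<pool_size F G. pool_weight F G i * pool_bias F G i)
      = \<rho>0 * (\<Sum>a\<in>jump_set F. jump F a * bias (w a)) + \<rho>1 * (\<Sum>a\<in>jump_set G. jump G a * bias (w a))"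
    unfolding pool_bias_def pool_w_def by (rule pool_sum[OF F G, of "\<lambda>x. bias (w x)"])
  also have "(\<Sum>a\<in>jump_set F. jump F a * bias (w a)) = \<rho>1 * (\<Sum>a\<in>jump_set F. jump F a * (\<theta>0 * w a / ?D (w a)))"
    unfolding sum_distrib_left by (intro sum.cong refl) (simp add: bias_def)
  also have "(\<Sum>a\<in>jump_set G. jump G a * bias (w a)) = total_mass G - \<rho>0 * (\<Sum>a\<in>jump_set G. jump G a * (1 / ?D (w a)))"
    unfolding total_mass_step_df[OF G] sum_distrib_left sum_subtractf[symmetric]
  proof (intro sum.cong refl)
    fix a assume "a \<in> jump_set G"
    then have "0 < ?D (w a)" using step_df_representation(5)[OF G] w_nonneg theta_pos by (intro denominator_pos) auto
    then have "bias (w a) = 1 - \<rho>0 / ?D (w a)" by (simp add: bias_def field_simps)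
    then show "jump G a * bias (w a) = jump G a - \<rho>0 * (jump G a * (1 / ?D (w a)))"
      by (simp add: right_diff_distrib)
  qed
  finally show ?thesis
    unfolding stieltjes_integral_step_df[OF F m(1)] stieltjes_integral_step_df[OF G m(2)]
    by (simp add: algebra_simps)
qed

end

text \<open>Uniform convergence on the nonnegative half-line suffices, since all distribution functions vanish on the
negative half-line.\<close>

lemma pointwise_of_uniform:
  fixes F :: "real \<Rightarrow> real"
  assumes "\<And>k. step_df (Fk k)" and \<mu>: "real_distribution \<mu>" "AE x in \<mu>. 0 \<le> x"
    and lim: "(\<lambda>k. SUP x\<in>{0..}. \<bar>Fk k x - cdf \<mu> x\<bar>) \<longlonglongrightarrow> 0"
  shows "(\<lambda>k. Fk k x) \<longlonglongrightarrow> cdf \<mu> x"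
proof -
  interpret real_distribution \<mu> by fact
  have sub: "sub_df (Fk k)" for k using assms(1)[of k] by (simp add: step_df_def)
  show ?thesis
  proof (cases "0 \<le> x")
    case True
    have "\<bar>Fk k y - cdf \<mu> y\<bar> \<le> 2" for k y
    proof -
      have "0 \<le> Fk k y"
        using finite_borel_measure.cdf_nonneg[OF finite_borel_measure_step_df[OF assms(1)[of k]], of y]
        by (simp add: cdf_step_df[OF assms(1)])
      moreover have "Fk k y \<le> 1" using sub[of k] by (simp add: sub_df_def)
      ultimately show ?thesis using cdf_nonneg[of y] cdf_bounded_prob[of y] by (simp add: abs_le_iff)
    qed
    then have "\<bar>Fk k x - cdf \<mu> x\<bar> \<le> (SUP x\<in>{0..}. \<bar>Fk k x - cdf \<mu> x\<bar>)" for k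
      using True by (intro cSUP_upper bdd_aboveI2[where M=2]) auto
    then have "(\<lambda>k. Fk k x - cdf \<mu> x) \<longlonglongrightarrow> 0"
      by (intro Lim_null_comparison[OF _ lim] always_eventually) auto
    then show ?thesis by (rule LIM_zero_cancel)
  next
    case False
    have "measure \<mu> {..x} = 0"
    proof (rule measure_eq_0_null_sets)
      show "{..x} \<in> null_sets \<mu>"
        using \<mu>(2) False by (intro AE_iff_null_sets[THEN iffD2]) (auto elim!: eventually_mono)
    qed
    moreover have "Fk k x = 0" for k using sub[of k] False by (simp add: sub_df_def)
    ultimately show ?thesis by (simp add: cdf_def)
  qed
qed

section \<open>The limit law of the likelihood ratio\<close>

theorem theorem3:
  fixes M :: "'a measure"
    and f0 g0 w :: "real \<Rightarrow> real"
    and \<theta>0 \<rho>0 \<rho>1 \<sigma>F \<sigma>G :: real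
    and X Y :: "nat \<Rightarrow> 'a \<Rightarrow> real"
    and T U :: "nat \<Rightarrow> 'a \<Rightarrow> nat \<Rightarrow> real"
    and SX SY :: censoring
    and n0 n1 n :: "nat \<Rightarrow> nat"
    and \<Phi> \<Psi> :: "nat \<Rightarrow> (nat \<Rightarrow> obs) \<Rightarrow> real \<Rightarrow> real"
    and F0 G0 :: "real \<Rightarrow> real"
    and Fhat Ghat :: "nat \<Rightarrow> 'a \<Rightarrow> real \<Rightarrow> real"
    and h1 h0 :: "real \<Rightarrow> real"
  assumes model: "biased_two_sample_model M f0 g0 w \<theta>0 X Y T U SX SY"
    and F0_def: "F0 = cdf (density lborel f0)"
    and G0_def: "G0 = cdf (density lborel g0)"
    and Phi_NPMLE: "\<And>k. is_NPMLE SX (n0 k) (\<Phi> k)"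
    and Psi_NPMLE: "\<And>k. is_NPMLE SY (n1 k) (\<Psi> k)"
    and Fhat_def: "\<And>k \<omega>. Fhat k \<omega> = \<Phi> k (observed_sample SX (n0 k) X T \<omega>)"
    and Ghat_def: "\<And>k \<omega>. Ghat k \<omega> = \<Psi> k (observed_sample SY (n1 k) Y U \<omega>)"
    and n_def: "\<And>k. n k = n0 k + n1 k"
    and sizes_pos: "\<And>k. 0 < n0 k" "\<And>k. 0 < n1 k"
    and n_at_top: "filterlim n at_top sequentially"
    and fixed_proportions: "\<And>k. \<rho>0 = real (n0 k) / real (n k)" "\<And>k. \<rho>1 = real (n1 k) / real (n k)"
    and h1_def: "h1 = (\<lambda>x. \<theta>0 * w x / (\<rho>0 + \<rho>1 * \<theta>0 * w x))"
    and h0_def: "h0 = (\<lambda>x. 1 / (\<rho>0 + \<rho>1 * \<theta>0 * w x))"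
    and variances_pos: "0 < \<sigma>F" "0 < \<sigma>G"
    and CLT_F: "weak_conv_m
          (\<lambda>k. distr M borel (\<lambda>\<omega>. sqrt (real (n0 k)) *
             (stieltjes_integral h1 (Fhat k \<omega>) - stieltjes_integral h1 F0)))
          (density lborel (normal_density 0 \<sigma>F))"
    and CLT_G: "weak_conv_m
          (\<lambda>k. distr M borel (\<lambda>\<omega>. sqrt (real (n1 k)) *
             (stieltjes_integral h0 (Ghat k \<omega>) - stieltjes_integral h0 G0)))
          (density lborel (normal_density 0 \<sigma>G))"
    and consistent_F: "AE \<omega> in M. (\<lambda>k. SUP x\<in>{0..}. \<bar>Fhat k \<omega> x - F0 x\<bar>) \<longlonglongrightarrow> 0"
    and consistent_G: "AE \<omega> in M. (\<lambda>k. SUP x\<in>{0..}. \<bar>Ghat k \<omega> x - G0 x\<bar>) \<longlonglongrightarrow> 0"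
    and negligible_mass_defect: "\<And>e. 0 < e \<Longrightarrow>
          (\<lambda>k. measure M {\<omega> \<in> space M.
             real (n0 k) * (1 - total_mass (Fhat k \<omega>)) + real (n1 k) * (1 - total_mass (Ghat k \<omega>)) > e})
          \<longlonglongrightarrow> 0"
  shows "\<exists>c0>0. weak_conv
          (\<lambda>k x. measure M {\<omega> \<in> space M.
             neg_two_ln (weighted_EL_ratio \<rho>0 \<rho>1 (n k) w (Fhat k \<omega>) (Ghat k \<omega>) \<theta>0) \<le> ereal x})
          (cdf (scaled_chi_square_1 c0))"
proof -
  interpret model: biased_two_sample_model M f0 g0 w \<theta>0 X Y T U SX SY by (rule model)
  note X_dens = model.X_density[of 0] and Y_dens = model.Y_density[of 0]
  have f0m: "f0 \<in> borel_measurable borel"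
    using distributed_real_measurable[OF _ X_dens] model.f0_nonneg by simp
  have F_eq: "density lborel f0 = distr M lborel (X 0)" by (rule distributed_distr_eq_density[OF X_dens, symmetric])
  have G_eq: "density lborel g0 = distr M lborel (Y 0)" by (rule distributed_distr_eq_density[OF Y_dens, symmetric])
  have PF: "prob_space (density lborel f0)" unfolding F_eq
    by (intro model.prob_space_distr distributed_measurable[OF X_dens])
  have PG: "prob_space (density lborel g0)" unfolding G_eq
    by (intro model.prob_space_distr distributed_measurable[OF Y_dens])
  have RF: "real_distribution (density lborel f0)" and RG: "real_distribution (density lborel g0)"
    using PF PG by (simp_all add: real_distribution_def real_distribution_axioms_def)
  have theta_pos: "0 < \<theta>0"
  proof -
    have "0 \<le> (LINT x:{0..}|density lborel f0. w x)"
      unfolding set_lebesgue_integral_def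
      by (intro integral_nonneg_AE AE_I2) (auto simp: indicator_def model.w_nonneg)
    then have "0 \<le> \<theta>0" unfolding model.\<theta>0_eq by simp
    moreover have "\<theta>0 \<noteq> 0"
    proof
      assume "\<theta>0 = 0"
      then have "density lborel g0 = density lborel (\<lambda>_. 0)" using model.g0_eq by simp
      then have "emeasure (density lborel g0) UNIV = 0" by (simp add: emeasure_density)
      moreover have "emeasure (density lborel g0) UNIV = 1" using prob_space.emeasure_space_1[OF PG] by simp
      ultimately show False by simp
    qed
    ultimately show ?thesis by simp
  qed
  have n_pos: "0 < n k" for k using sizes_pos(1)[of k] n_def[of k] by simp
  have rho_pos: "0 < \<rho>0" "0 < \<rho>1"
    using fixed_proportions[of 0] sizes_pos[of 0] n_pos[of 0] by simp_all
  have rho_sum: "\<rho>0 + \<rho>1 = 1"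
  proof -
    have "\<rho>0 + \<rho>1 = real (n0 0) / real (n 0) + real (n1 0) / real (n 0)"
      using fixed_proportions[of 0] by (simp only:)
    also have "\<dots> = real (n0 0 + n1 0) / real (n 0)" by (simp add: add_divide_distrib)
    also have "\<dots> = 1" unfolding n_def[of 0, symmetric] using n_pos[of 0] by simp
    finally show ?thesis .
  qed
  have n0_eq: "real (n0 k) = real (n k) * \<rho>0" and n1_eq: "real (n1 k) = real (n k) * \<rho>1" for k
    using fixed_proportions[of k] n_pos[of k] by simp_all
  interpret W: biased_weights w \<rho>0 \<rho>1 \<theta>0
    by unfold_locales (fact model.w_nonneg measurable_nonneg_part_of_monotone[OF model.w_monotone] rho_pos rho_sum theta_pos)+
  note moments = W.population_moments[OF f0m model.f0_nonneg model.f0_nonneg_support model.g0_eq PF PG model.w_not_constant]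

  define OX where "OX k = (\<Pi>\<^sub>M i\<in>{..<n0 k}. obs_space)" for k
  define OY where "OY k = (\<Pi>\<^sub>M i\<in>{..<n1 k}. obs_space)" for k
  have stepP: "d \<in> space (OX k) \<Longrightarrow> step_df (\<Phi> k d)" and measP: "(\<lambda>d. \<Phi> k d x) \<in> borel_measurable (OX k)" for k d x
    using Phi_NPMLE[of k] unfolding is_NPMLE_def OX_def by blast+
  have stepQ: "d \<in> space (OY k) \<Longrightarrow> step_df (\<Psi> k d)" and measQ: "(\<lambda>d. \<Psi> k d x) \<in> borel_measurable (OY k)" for k d x
    using Psi_NPMLE[of k] unfolding is_NPMLE_def OY_def by blast+
  have stepF: "step_df (Fhat k \<omega>)" for k \<omega>
    unfolding Fhat_def by (rule stepP[unfolded OX_def, OF observed_sample_in_space])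
  have stepG: "step_df (Ghat k \<omega>)" for k \<omega>
    unfolding Ghat_def by (rule stepQ[unfolded OY_def, OF observed_sample_in_space])
  have rv: "(\<lambda>\<omega>. case s of Inl i \<Rightarrow> (X i \<omega>, T i \<omega>) | Inr i \<Rightarrow> (Y i \<omega>, U i \<omega>)) \<in> measurable M (borel \<Otimes>\<^sub>M times_space)" for s
    using model.subjects_independent unfolding model.indep_vars_def2 by blast
  have data: "(\<lambda>\<omega>. (X i \<omega>, T i \<omega>)) \<in> measurable M (borel \<Otimes>\<^sub>M times_space)"
    "(\<lambda>\<omega>. (Y i \<omega>, U i \<omega>)) \<in> measurable M (borel \<Otimes>\<^sub>M times_space)" for i
    using rv[of "Inl i"] rv[of "Inr i"] by simp_all
  have measX: "X i \<in> borel_measurable M" "T i \<in> measurable M times_space" for i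
    using measurable_compose[OF data(1)[of i] measurable_fst] measurable_compose[OF data(1)[of i] measurable_snd] by simp_all
  have measY: "Y i \<in> borel_measurable M" "U i \<in> measurable M times_space" for i
    using measurable_compose[OF data(2)[of i] measurable_fst] measurable_compose[OF data(2)[of i] measurable_snd] by simp_all
  have measF: "(\<lambda>\<omega>. Fhat k \<omega> x) \<in> borel_measurable M" for k x
    unfolding Fhat_def
    by (rule measurable_compose[OF observed_sample_measurable measP[unfolded OX_def]]) (rule measX)+
  have measG: "(\<lambda>\<omega>. Ghat k \<omega> x) \<in> borel_measurable M" for k x
    unfolding Ghat_def
    by (rule measurable_compose[OF observed_sample_measurable measQ[unfolded OY_def]]) (rule measY)+

  define b1 where "b1 = (\<lambda>v. \<theta>0 * v / (\<rho>0 + \<rho>1 * \<theta>0 * v))"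
  define b0 where "b0 = (\<lambda>v. 1 / (\<rho>0 + \<rho>1 * \<theta>0 * v))"
  have b1m: "b1 \<in> borel_measurable borel" and b0m: "b0 \<in> borel_measurable borel"
    unfolding b1_def b0_def by measurable
  have h1: "h1 = (\<lambda>x. b1 (w x))" and h0: "h0 = (\<lambda>x. b0 (w x))"
    by (simp_all add: h1_def h0_def b1_def b0_def)
  \<comment> \<open>Both population integrals have the common value \<open>\<mu>\<close>, which therefore cancels in the score.\<close>
  define \<mu> where "\<mu> = stieltjes_integral h1 F0"
  have mu_G: "stieltjes_integral h0 G0 = \<mu>"
  proof -
    have "stieltjes_integral h1 F0 = (\<integral>x. b1 (W.w_plus x) \<partial>density lborel f0)"
      unfolding h1 F0_def by (rule W.stieltjes_cdf[OF RF moments(5) b1m])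
    moreover have "stieltjes_integral h0 G0 = (\<integral>x. b0 (W.w_plus x) \<partial>density lborel g0)"
      unfolding h0 G0_def by (rule W.stieltjes_cdf[OF RG moments(6) b0m])
    ultimately show ?thesis unfolding \<mu>_def b1_def b0_def using moments(1) by simp
  qed

  define A where "A k \<omega> = sqrt (real (n0 k)) * (stieltjes_integral h1 (Fhat k \<omega>) - \<mu>)" for k \<omega>
  define B where "B k \<omega> = sqrt (real (n1 k)) * (stieltjes_integral h0 (Ghat k \<omega>) - \<mu>)" for k \<omega>
  \<comment> \<open>\<open>x\<close> is \<open>\<surd>n\<close> times the score; the factors come from \<open>n0 = n \<rho>0\<close> and \<open>n1 = n \<rho>1\<close>.\<close>
  define x where "x k \<omega> = (1 / sqrt \<rho>0) * A k \<omega> + (- 1 / sqrt \<rho>1) * B k \<omega>" for k \<omega>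
  define \<tau> where "\<tau> = sqrt ((1 / sqrt \<rho>0 * \<sigma>F)\<^sup>2 + (- 1 / sqrt \<rho>1 * \<sigma>G)\<^sup>2)"
  have tau_pos: "0 < \<tau>" using variances_pos rho_pos by (simp add: \<tau>_def add_pos_nonneg)
  have ind: "model.indep_var borel (A k) borel (B k)" for k
  proof -
    have "(\<lambda>d. sqrt (real (n0 k)) * (stieltjes_integral h1 (\<Phi> k d) - \<mu>)) \<in> borel_measurable (OX k)"
      unfolding h1 by (intro borel_measurable_times borel_measurable_diff borel_measurable_const W.stieltjes_measurable b1m stepP measP)
    moreover have "(\<lambda>d. sqrt (real (n1 k)) * (stieltjes_integral h0 (\<Psi> k d) - \<mu>)) \<in> borel_measurable (OY k)"
      unfolding h0 by (intro borel_measurable_times borel_measurable_diff borel_measurable_const W.stieltjes_measurable b0m stepQ measQ)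
    ultimately show ?thesis
      using model.indep_var_observed_samples[OF model.subjects_independent, of _ "n0 k" _ "n1 k"]
      unfolding A_def B_def Fhat_def Ghat_def OX_def OY_def by blast
  qed
  have xm: "x k \<in> borel_measurable M" for k
    using model.indep_var_rv1[OF ind] model.indep_var_rv2[OF ind] unfolding x_def by measurable
  have xconv: "weak_conv_m (\<lambda>k. distr M borel (x k)) (density lborel (normal_density 0 \<tau>))"
    unfolding x_def \<tau>_def
  proof (rule model.weak_conv_indep_normal_combination[OF ind variances_pos])
    show "weak_conv_m (\<lambda>k. distr M borel (A k)) (density lborel (normal_density 0 \<sigma>F))"
      using CLT_F unfolding A_def \<mu>_def .
    show "weak_conv_m (\<lambda>k. distr M borel (B k)) (density lborel (normal_density 0 \<sigma>G))"
      using CLT_G unfolding B_def mu_G .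
  qed (use rho_pos in auto)
  have x_eq: "x k \<omega> = sqrt (real (n k)) * (((\<Sum>i<W.pool_size (Fhat k \<omega>) (Ghat k \<omega>). W.pool_weight (Fhat k \<omega>) (Ghat k \<omega>) i *
      W.pool_bias (Fhat k \<omega>) (Ghat k \<omega>) i) - \<rho>1 * total_mass (Ghat k \<omega>)) / (\<rho>0 * \<rho>1))" for k \<omega>
  proof -
    have "x k \<omega> = sqrt (real (n k)) * (stieltjes_integral h1 (Fhat k \<omega>) - stieltjes_integral h0 (Ghat k \<omega>))"
      unfolding x_def A_def B_def n0_eq n1_eq using rho_pos by (simp add: real_sqrt_mult algebra_simps)
    then show ?thesis
      unfolding W.pool_score_at_truth[OF stepF stepG] h1_def h0_def using rho_pos by simp
  qed

  define A1 where "A1 k \<omega> = (\<Sum>i<W.pool_size (Fhat k \<omega>) (Ghat k \<omega>). W.pool_weight (Fhat k \<omega>) (Ghat k \<omega>) i *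
      W.pool_bias (Fhat k \<omega>) (Ghat k \<omega>) i)" for k \<omega>
  define A2 where "A2 k \<omega> = (\<Sum>i<W.pool_size (Fhat k \<omega>) (Ghat k \<omega>). W.pool_weight (Fhat k \<omega>) (Ghat k \<omega>) i *
      (W.pool_bias (Fhat k \<omega>) (Ghat k \<omega>) i)\<^sup>2)" for k \<omega>
  \<comment> \<open>The limit of \<open>A2\<close>, the second moment of \<open>bias\<close> in the pooled population.\<close>
  define lam where "lam = \<rho>0 * (\<integral>x. (W.bias (W.w_plus x))\<^sup>2 \<partial>density lborel f0) + \<rho>1 * (\<integral>x. (W.bias (W.w_plus x))\<^sup>2 \<partial>density lborel g0)"
  have bias_m: "W.bias \<in> borel_measurable borel" and bias2_m: "(\<lambda>v. (W.bias v)\<^sup>2) \<in> borel_measurable borel" by simp_all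
  have bias_cont: "isCont W.bias v" if "0 \<le> v" for v
    unfolding W.bias_def using W.denominator_pos[OF that theta_pos] by (intro continuous_intros) auto
  have sums: "A1 k \<omega> = \<rho>0 * stieltjes_integral (\<lambda>x. W.bias (w x)) (Fhat k \<omega>) + \<rho>1 * stieltjes_integral (\<lambda>x. W.bias (w x)) (Ghat k \<omega>)"
    "A2 k \<omega> = \<rho>0 * stieltjes_integral (\<lambda>x. (W.bias (w x))\<^sup>2) (Fhat k \<omega>) + \<rho>1 * stieltjes_integral (\<lambda>x. (W.bias (w x))\<^sup>2) (Ghat k \<omega>)" for k \<omega>
    unfolding A1_def A2_def W.pool_bias_def
    by (rule W.pool_sum_w[OF stepF stepG bias_m], rule W.pool_sum_w[OF stepF stepG bias2_m])
  have Am: "A1 k \<in> borel_measurable M" "A2 k \<in> borel_measurable M" for k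
    unfolding A1_def A2_def W.pool_bias_def
    by (rule W.pool_sum_measurable[OF stepF stepG measF measG]; simp)+
  have consist: "AE \<omega> in M. (\<forall>x. (\<lambda>k. Fhat k \<omega> x) \<longlonglongrightarrow> F0 x) \<and> (\<forall>x. (\<lambda>k. Ghat k \<omega> x) \<longlonglongrightarrow> G0 x)"
    using consistent_F consistent_G
  proof eventually_elim
    case (elim \<omega>)
    show ?case
      using pointwise_of_uniform[OF stepF RF moments(5), of "\<lambda>k. k" "\<lambda>_. \<omega>"]
        pointwise_of_uniform[OF stepG RG moments(6), of "\<lambda>k. k" "\<lambda>_. \<omega>"] elim
      unfolding F0_def G0_def by blast
  qed
  have bias_le: "\<bar>W.bias v\<bar> \<le> 1" "\<bar>(W.bias v)\<^sup>2\<bar> \<le> 1" if "0 \<le> v" for v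
    using W.bias_range[OF that] by (auto simp: power_le_one)
  have lim_stieltjes: "(\<lambda>k. stieltjes_integral (\<lambda>x. \<phi> (w x)) (H k)) \<longlonglongrightarrow> (\<integral>x. \<phi> (W.w_plus x) \<partial>density lborel f)"
    if "\<And>k. step_df (H k)" "real_distribution (density lborel f)" "f \<in> borel_measurable borel" "AE x in density lborel f. 0 \<le> x"
      "\<And>x. (\<lambda>k. H k x) \<longlonglongrightarrow> cdf (density lborel f) x"
      "\<And>v. 0 \<le> v \<Longrightarrow> isCont \<phi> v" "\<And>v. 0 \<le> v \<Longrightarrow> \<bar>\<phi> v\<bar> \<le> 1" "\<phi> \<in> borel_measurable borel" for \<phi> :: "real \<Rightarrow> real" and H and f :: "real \<Rightarrow> ennreal"
    using W.stieltjes_limit[OF model.w_monotone that(1,2,3,5,6,7,8) zero_le_one]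
    unfolding W.stieltjes_cdf[OF that(2,4,8)] .
  have g0m: "(\<lambda>x. ennreal (g0 x)) \<in> borel_measurable borel" using distributed_borel_measurable[OF Y_dens] by simp
  have f0m': "(\<lambda>x. ennreal (f0 x)) \<in> borel_measurable borel" using f0m by simp
  have A_lims: "AE \<omega> in M. (\<lambda>k. A1 k \<omega>) \<longlonglongrightarrow> \<rho>1" "AE \<omega> in M. (\<lambda>k. A2 k \<omega>) \<longlonglongrightarrow> lam"
  proof -
    have "AE \<omega> in M. (\<lambda>k. A1 k \<omega>) \<longlonglongrightarrow> \<rho>1 \<and> (\<lambda>k. A2 k \<omega>) \<longlonglongrightarrow> lam"
      using consist
    proof eventually_elim
      case (elim \<omega>)
      then have FL: "\<And>x. (\<lambda>k. Fhat k \<omega> x) \<longlonglongrightarrow> cdf (density lborel f0) x" and GL: "\<And>x. (\<lambda>k. Ghat k \<omega> x) \<longlonglongrightarrow> cdf (density lborel g0) x"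
        by (auto simp: F0_def G0_def)
      have L1: "(\<lambda>k. A1 k \<omega>) \<longlonglongrightarrow> \<rho>0 * (\<integral>x. W.bias (W.w_plus x) \<partial>density lborel f0) + \<rho>1 * (\<integral>x. W.bias (W.w_plus x) \<partial>density lborel g0)"
        unfolding sums
        by (intro tendsto_intros lim_stieltjes[OF stepF RF f0m' moments(5) FL bias_cont bias_le(1) bias_m]
            lim_stieltjes[OF stepG RG g0m moments(6) GL bias_cont bias_le(1) bias_m])
      have cont2: "isCont (\<lambda>v. (W.bias v)\<^sup>2) v" if "0 \<le> v" for v using bias_cont[OF that] by (intro continuous_intros)
      have L2: "(\<lambda>k. A2 k \<omega>) \<longlonglongrightarrow> lam"
        unfolding sums lam_def
        by (intro tendsto_intros lim_stieltjes[OF stepF RF f0m' moments(5) FL cont2 bias_le(2) bias2_m]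
            lim_stieltjes[OF stepG RG g0m moments(6) GL cont2 bias_le(2) bias2_m])
      show ?case using L1 L2 moments(2) by simp
    qed
    then show "AE \<omega> in M. (\<lambda>k. A1 k \<omega>) \<longlonglongrightarrow> \<rho>1" "AE \<omega> in M. (\<lambda>k. A2 k \<omega>) \<longlonglongrightarrow> lam" by auto
  qed
  have lam: "\<rho>1\<^sup>2 < lam" "lam < \<rho>1" using moments(3,4) by (simp_all add: lam_def)

  let ?PF = "prob_filter M"
  have massm: "(\<lambda>\<omega>. total_mass (Fhat k \<omega>)) \<in> borel_measurable M" "(\<lambda>\<omega>. total_mass (Ghat k \<omega>)) \<in> borel_measurable M" for k
    by (rule W.total_mass_measurable[OF stepF measF], rule W.total_mass_measurable[OF stepG measG])
  have mass_le: "total_mass (Fhat k \<omega>) \<le> 1" "total_mass (Ghat k \<omega>) \<le> 1" for k \<omega>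
    using step_df_representation(6)[OF stepF] step_df_representation(6)[OF stepG]
    by (simp_all add: total_mass_step_df[OF stepF] total_mass_step_df[OF stepG])
  \<comment> \<open>The total mass defect, which bounds the defects of both samples and of the pool.\<close>
  define \<Delta> where "\<Delta> k \<omega> = real (n0 k) * (1 - total_mass (Fhat k \<omega>)) + real (n1 k) * (1 - total_mass (Ghat k \<omega>))" for k \<omega>
  have \<Delta>_nonneg: "0 \<le> \<Delta> k \<omega>" for k \<omega> unfolding \<Delta>_def using mass_le by (intro add_nonneg_nonneg mult_nonneg_nonneg) auto
  have \<Delta>lim: "((\<lambda>p. \<Delta> (fst p) (snd p)) \<longlongrightarrow> 0) ?PF"
  proof (rule model.tendsto_prob_filterI)
    show "\<Delta> k \<in> borel_measurable M" for k unfolding \<Delta>_def using massm[of k] by measurable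
    show "(\<lambda>k. measure M {\<omega> \<in> space M. e < \<bar>\<Delta> k \<omega> - 0\<bar>}) \<longlonglongrightarrow> 0" if "0 < e" for e
      using negligible_mass_defect[OF that] \<Delta>_nonneg by (simp add: \<Delta>_def)
  qed
  define c where "c = (\<rho>0 * \<rho>1)\<^sup>2 * (1 / (lam - \<rho>1\<^sup>2) + 1 / (\<rho>1 - lam))"
  have c_pos: "0 < c" unfolding c_def using rho_pos lam by (intro mult_pos_pos add_pos_pos) auto
  define Z where "Z k \<omega> = neg_two_ln (weighted_EL_ratio \<rho>0 \<rho>1 (n k) w (Fhat k \<omega>) (Ghat k \<omega>) \<theta>0)" for k \<omega>
  let ?F = "\<lambda>p :: nat \<times> 'a. Fhat (fst p) (snd p)" and ?G = "\<lambda>p :: nat \<times> 'a. Ghat (fst p) (snd p)"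
  have N_lim: "filterlim (\<lambda>p :: nat \<times> 'a. real (n (fst p))) at_top ?PF"
    by (rule filterlim_compose[OF filterlim_real_sequentially
          filterlim_compose[OF n_at_top model.filterlim_fst_prob_filter]])
  have mult: "((\<lambda>p. x (fst p) (snd p) * f p) \<longlongrightarrow> 0) ?PF" if "(f \<longlongrightarrow> 0) ?PF" for f
    by (rule model.weak_conv_bounded_in_probability[OF xm real_distribution_normal[OF tau_pos] xconv _ that])
      (rule isCont_cdf_density[OF real_distribution_normal[OF tau_pos]], simp)
  have defect1: "((\<lambda>p. real (n (fst p)) * (1 - W.pool_mass (?F p) (?G p))) \<longlongrightarrow> 0) ?PF"
  proof -
    have "real (n (fst p)) * (1 - W.pool_mass (?F p) (?G p)) = \<Delta> (fst p) (snd p)" for p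
    proof -
      have "real (n (fst p)) = real (n0 (fst p)) + real (n1 (fst p))" using n_def by simp
      then show ?thesis unfolding \<Delta>_def W.pool_mass_eq[OF stepF stepG] n0_eq n1_eq
        by (simp add: algebra_simps)
    qed
    then show ?thesis using \<Delta>lim by simp
  qed
  have defect2: "((\<lambda>p. real (n (fst p)) * (1 - total_mass (?G p))) \<longlongrightarrow> 0) ?PF"
  proof (rule Lim_null_comparison)
    show "\<forall>\<^sub>F p in ?PF. norm (real (n (fst p)) * (1 - total_mass (?G p))) \<le> \<Delta> (fst p) (snd p) / \<rho>1"
    proof (rule always_eventually, rule allI)
      fix p :: "nat \<times> 'a"
      have "\<rho>1 * (real (n (fst p)) * (1 - total_mass (?G p))) \<le> \<Delta> (fst p) (snd p)"
        unfolding \<Delta>_def n1_eq n0_eq using mass_le(1)[of "fst p" "snd p"] rho_pos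
        by (simp add: mult_ac)
      then show "norm (real (n (fst p)) * (1 - total_mass (?G p))) \<le> \<Delta> (fst p) (snd p) / \<rho>1"
        using mass_le(2)[of "fst p" "snd p"] rho_pos by (simp add: pos_le_divide_eq mult_ac abs_mult)
    qed
    show "((\<lambda>p. \<Delta> (fst p) (snd p) / \<rho>1) \<longlongrightarrow> 0) ?PF" using tendsto_divide[OF \<Delta>lim tendsto_const[of \<rho>1]] rho_pos by simp
  qed
  note atom = W.pool_atom[OF stepF stepG]
  let ?m = "\<lambda>p. W.pool_size (?F p) (?G p)" and ?om = "\<lambda>p. W.pool_weight (?F p) (?G p)"
    and ?q = "\<lambda>p. W.pool_bias (?F p) (?G p)"
  note limit = EL_limit[where F="?PF" and m="?m" and om="?om"
      and q="?q" and N="\<lambda>p. real (n (fst p))" and g="\<lambda>p. total_mass (?G p)"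
      and xr="\<lambda>p. W.root_ratio (?F p) (?G p)" and x="\<lambda>p. x (fst p) (snd p)" and s="\<lambda>p. W.pool_mass (?F p) (?G p)"
      and ?A1.0="\<lambda>p. A1 (fst p) (snd p)" and ?A2.0="\<lambda>p. A2 (fst p) (snd p)" and Z="\<lambda>p. Z (fst p) (snd p)"
      and lam=lam and c=c and ?\<rho>0.0=\<rho>0 and ?\<rho>1.0=\<rho>1]
  have prem:
    "0 < W.root_ratio (?F p) (?G p) \<and> tilt_score (?m p) (?om p) (?q p) (W.root_ratio (?F p) (?G p)) = \<rho>1 * total_mass (?G p)"
    if "\<exists>!y. 0 < y \<and> tilt_score (?m p) (?om p) (?q p) y = \<rho>1 * total_mass (?G p)" for p
    using W.root_ratio_pos[OF stepF stepG] W.root_ratio_root[OF stepF stepG that] by blast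
  have Zdual: "Z (fst p) (snd p) = EL_dual_statistic \<rho>0 \<rho>1 (real (n (fst p))) (?m p) (?om p) (?q p)
      (W.pool_mass (?F p) (?G p)) (W.root_ratio (?F p) (?G p))" for p
    unfolding Z_def by (rule W.weighted_EL_ratio_dual[OF stepF stepG n_pos])
  have A1_eq: "A1 (fst p) (snd p) = (\<Sum>i<?m p. ?om p i * ?q p i)" for p
    by (simp add: A1_def)
  have A2_eq: "A2 (fst p) (snd p) = (\<Sum>i<?m p. ?om p i * (?q p i)\<^sup>2)" for p
    by (simp add: A2_def)
  have x_eq': "x (fst p) (snd p) = sqrt (real (n (fst p))) * ((A1 (fst p) (snd p) - \<rho>1 * total_mass (?G p)) / (\<rho>0 * \<rho>1))" for p
    by (simp add: x_eq A1_def)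
  note pm = W.pool_mass_le_1[OF stepF stepG] W.pool_mass_def
  note lims = model.tendsto_prob_filter_AE[OF Am(1) A_lims(1)] model.tendsto_prob_filter_AE[OF Am(2) A_lims(2)]
  have fin: "\<forall>\<^sub>F p in ?PF. \<bar>Z (fst p) (snd p)\<bar> \<noteq> \<infinity>"
    by (rule limit(1)) (fact rho_pos rho_sum atom pm A1_eq A2_eq x_eq' N_lim mult lims lam defect1 defect2 prem Zdual c_def)+
  have appr: "((\<lambda>p. real_of_ereal (Z (fst p) (snd p)) - c * (x (fst p) (snd p))\<^sup>2) \<longlongrightarrow> 0) ?PF"
    by (rule limit(2)) (fact rho_pos rho_sum atom pm A1_eq A2_eq x_eq' N_lim mult lims lam defect1 defect2 prem Zdual c_def)+
  have Zm: "Z k \<in> borel_measurable M" for k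
    unfolding Z_def by (rule W.neg_two_ln_EL_ratio_measurable[OF stepF stepG measF measG n_pos])
  have "weak_conv (\<lambda>k y. measure M {\<omega> \<in> space M. Z k \<omega> \<le> ereal y}) (cdf (scaled_chi_square_1 (c * \<tau>\<^sup>2)))"
  proof (rule model.cdf_limit_of_approximation[where Q="\<lambda>k \<omega>. c * (x k \<omega>)\<^sup>2", OF Zm _ fin appr])
    show "(\<lambda>\<omega>. c * (x k \<omega>)\<^sup>2) \<in> borel_measurable M" for k using xm[of k] by measurable
    show "(\<lambda>k. measure M {\<omega> \<in> space M. c * (x k \<omega>)\<^sup>2 \<le> y}) \<longlonglongrightarrow> cdf (scaled_chi_square_1 (c * \<tau>\<^sup>2)) y" for y
      by (rule model.square_of_asymptotically_normal[OF xm c_pos tau_pos xconv])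
  qed
  moreover have "0 < c * \<tau>\<^sup>2" using c_pos tau_pos by simp
  ultimately show ?thesis unfolding Z_def by blast
qed

end
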